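(* Consider a canonical one-dimensional exponential family $(\nu_\theta)_{\theta\in\Theta}$ with mean set $I$, variance bounded by $V>0$, and a fixed interval $[\mu^-,\mu^+]\subset I$, as described in the context, and let $\mathcal{F}$ be the associated set of $K$-armed bandit models, $K\ge 2$. Then for every bandit model $\nu\in\mathcal{F}$ and every horizon $T\ge 1$, the expected regret of the kl-UCB$^{++}$ algorithm run with horizon $T$ satisfies $$R_T\le 76\sqrt{VKT}+(\mu^+-\mu^-)K .$$
   Context: **Exponential family.** Let $\rho$ be a measure on $\mathbb{R}$, $b(\theta)=\log\int_{\mathbb{R}}e^{x\theta}\,d\rho(x)$ and $\Theta=\{\theta\in\mathbb{R}: b(\theta)<+\infty\}$. For $\theta\in\Theta$, $\nu_\theta$ is the probability law with density $\frac{d\nu_\theta}{d\rho}(x)=\exp(x\theta-b(\theta))$. The function $b$ is convex and twice differentiable on $\Theta$, and $b'(\theta)$ and $b''(\theta)>0$ are the mean and the variance of $\nu_\theta$. The family is parametrized by its mean $\mu=b'(\theta)$, which ranges over $I=b'(\Theta)=(\bar\mu^-,\bar\mu^+)$, an open interval. For $\mu=b'(\theta)$ and $\mu'=b'(\theta')$ in $I$, put $$\mathrm{kl}(\mu,\mu')=\mathrm{KL}(\nu_\theta,\nu_{\theta'})=b(\theta')-b(\theta)-b'(\theta)(\theta'-\theta).$$ For $\mu'\in I$, $\mathrm{kl}(\cdot,\mu')$ is extended by limits, with values in $[0,+\infty]$, to the finite endpoints of $I$ (needed when an empirical mean equals an endpoint of $I$; e.g. $0\log 0=0$ in the Bernoulli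 case). **Standing assumptions.** The variance is bounded over the family: $\sup_{\mu\in I} b''\big((b')^{-1}(\mu)\big)\le V<+\infty$. Consequently $\mathrm{kl}(\mu,\mu')\ge (\mu-\mu')^2/(2V)$ for all $\mu,\mu'\in I$. Two real numbers $\mu^-<\mu^+$ with $[\mu^-,\mu^+]\subset I$ are fixed. $\mathcal{F}$ is the set of bandit models $\nu=(\nu_{\theta_1},\dots,\nu_{\theta_K})$, $K\ge2$, whose arms belong to the family and have means $\mu_a=b'(\theta_a)\in[\mu^-,\mu^+]$. **Bandit game and regret.** At each round $1\le t\le T$ the player pulls an arm $A_t\in\{1,\dots,K\}$, chosen on the basis of past observations, and receives an independent draw $Y_t$ from $\nu_{\theta_{A_t}}$. Let $\mu^\star=\max_a\mu_a$ and $N_a(t)=\sum_{s=1}^t\mathbb{1}_{\{A_s=a\}}$. The expected regret is $$R_T=T\mu^\star-\mathbb{E}\Big[\sum_{t=1}^TY_t\Big]=\sum_{a=1}^K(\mu^\star-\mu_a)\,\mathbb{E}[N_a(T)].$$ **The kl-UCB$^{++}$ algorithm (with horizon $T$).** Let $\log_+(x)=\max(\log x,0)$ and $$g(n)=\log_+\!\Big(\frac{T}{Kn}\Big(\log_+^2\Big(\frac{T}{Kn}\Big)+1\Big)\Big).$$ During the first $K$ rounds each arm is pulled once (if $T<K$ the procedure simply stops after $T$ rounds). Then for $t=K,\dots,T-1$: with $\widehat\mu_a(t)=\frac1{N_a(t)}\sum_{s=1}^tY_s\mathbb{1}_{\{A_s=a\}}$, compute for every arm $a$ $$U_a(t)=\sup\Big\{\mu\in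 I:\ \mathrm{kl}\big(\widehat\mu_a(t),\mu\big)\le\frac{g(N_a(t))}{N_a(t)}\Big\}$$ (with the convention $U_a(t)=\widehat\mu_a(t)$ if this set is empty), and play $A_{t+1}\in\arg\max_{a}U_a(t)$, ties being broken arbitrarily. *)

theory Defs
  imports "HOL-Probability.Probability"
begin

section \<open>One-dimensional exponential families\<close>

text \<open>Since the integrand is positive and measurable, integrability says exactly that
  the log-partition function is \<open>< \<infinity>\<close>. The real-valued function \<open>log_partition\<close> is only meaningful
  on \<open>nat_params \<rho>\<close>.\<close>

definition nat_params :: "real measure \<Rightarrow> real set" where
  "nat_params \<rho> = {\<theta>. integrable \<rho> (\<lambda>x. exp (x * \<theta>))}"

definition log_partition :: "real measure \<Rightarrow> real \<Rightarrow> real" where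
  "log_partition \<rho> \<theta> = ln (\<integral>x. exp (x * \<theta>) \<partial>\<rho>)"

definition expfam_law :: "real measure \<Rightarrow> real \<Rightarrow> real measure" where
  "expfam_law \<rho> \<theta> = density \<rho> (\<lambda>x. ennreal (exp (x * \<theta> - log_partition \<rho> \<theta>)))"

definition expfam_mean :: "real measure \<Rightarrow> real \<Rightarrow> real" where
  "expfam_mean \<rho> = deriv (log_partition \<rho>)"

definition expfam_variance :: "real measure \<Rightarrow> real \<Rightarrow> real" where
  "expfam_variance \<rho> = deriv (deriv (log_partition \<rho>))"

definition mean_set :: "real measure \<Rightarrow> real set" where
  "mean_set \<rho> = expfam_mean \<rho> ` nat_params \<rho>"

definition param_of_mean :: "real measure \<Rightarrow> real \<Rightarrow> real" where
  "param_of_mean \<rho> = the_inv_into (nat_params \<rho>) (expfam_mean \<rho>)"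

text \<open>On an open parameter set, \<open>log_partition \<rho>\<close> is smooth, so the iterated \<open>deriv\<close> above are
  genuine derivatives. Openness of \<open>nat_params \<rho>\<close> is what makes the range \<open>mean_set \<rho>\<close> of the
  strictly increasing continuous mean map an open interval. Positivity of the variance excludes
  \<open>\<rho>\<close> null or concentrated at one point.\<close>

locale exponential_family =
  fixes \<rho> :: "real measure"
  assumes sets_rho: "sets \<rho> = sets borel"
    and nat_params_nonempty: "nat_params \<rho> \<noteq> {}"
    and open_nat_params: "open (nat_params \<rho>)"
    and variance_pos: "\<And>\<theta>. \<theta> \<in> nat_params \<rho> \<Longrightarrow> expfam_variance \<rho> \<theta> > 0"

text \<open>The library writes the reference measure first: \<open>KL_divergence b Q P\<close> is \<open>KL(P, Q)\<close>.\<close>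

definition kl :: "real measure \<Rightarrow> real \<Rightarrow> real \<Rightarrow> real" where
  "kl \<rho> \<mu> \<mu>' = KL_divergence (exp 1)
     (expfam_law \<rho> (param_of_mean \<rho> \<mu>')) (expfam_law \<rho> (param_of_mean \<rho> \<mu>))"

text \<open>Extension of the first argument by limits to the finite endpoints of the open interval
  \<open>mean_set \<rho>\<close>, which are the points of its closure outside it. The value outside the closure
  is irrelevant: empirical means lie in the closure almost surely.\<close>

definition kl_ext :: "real measure \<Rightarrow> real \<Rightarrow> real \<Rightarrow> ereal" where
  "kl_ext \<rho> x \<mu>' =
     (if x \<in> mean_set \<rho> then ereal (kl \<rho> x \<mu>')
      else if x \<in> closure (mean_set \<rho>) then Lim (at x within mean_set \<rho>) (\<lambda>m. ereal (kl \<rho> m \<mu>'))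
      else \<infinity>)"


section \<open>The bandit game\<close>

text \<open>Arms are \<open>1, \<dots>, K\<close> and rounds are \<open>1, \<dots>, T\<close>. The \<sigma>-algebra \<open>F t\<close> is the information of the
  player after round \<open>t\<close>; besides the past actions and observations it may contain auxiliary
  randomness, such as that used to break ties. The last assumption says that, conditionally on
  that information, the next reward has the law \<open>\<nu> a\<close> of the arm \<open>a\<close> which is pulled.\<close>

locale bandit_game = prob_space M + filtration "space M" F
  for M :: "'w measure" and F :: "nat \<Rightarrow> 'w measure" +
  fixes \<nu> :: "nat \<Rightarrow> real measure"
    and K T :: nat
    and A :: "nat \<Rightarrow> 'w \<Rightarrow> nat"
    and Y :: "nat \<Rightarrow> 'w \<Rightarrow> real"
  assumes subalgebra_F: "\<And>t. subalgebra M (F t)"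
    and action_measurable: "\<And>t. t < T \<Longrightarrow> A (Suc t) \<in> F t \<rightarrow>\<^sub>M count_space {1..K}"
    and reward_measurable: "\<And>t. t < T \<Longrightarrow> Y (Suc t) \<in> borel_measurable (F (Suc t))"
    and reward_law: "\<And>t B. t < T \<Longrightarrow> B \<in> sets borel \<Longrightarrow>
      AE \<omega> in M. real_cond_exp M (F t) (\<lambda>\<omega>'. indicat_real B (Y (Suc t) \<omega>')) \<omega>
        = measure (\<nu> (A (Suc t) \<omega>)) B"

definition best_mean :: "nat \<Rightarrow> (nat \<Rightarrow> real) \<Rightarrow> real" where
  "best_mean K \<mu> = Max (\<mu> ` {1..K})"

definition expected_regret ::
    "'w measure \<Rightarrow> nat \<Rightarrow> nat \<Rightarrow> (nat \<Rightarrow> real) \<Rightarrow> (nat \<Rightarrow> 'w \<Rightarrow> real) \<Rightarrow> real" where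
  "expected_regret M K T \<mu> Y = real T * best_mean K \<mu> - (\<integral>\<omega>. (\<Sum>t=1..T. Y t \<omega>) \<partial>M)"


section \<open>The kl-UCB++ algorithm\<close>

definition log_plus :: "real \<Rightarrow> real" where
  "log_plus x = max (ln x) 0"

definition exploration :: "nat \<Rightarrow> nat \<Rightarrow> nat \<Rightarrow> real" where
  "exploration K T n =
     (let x = real T / (real K * real n) in log_plus (x * ((log_plus x)\<^sup>2 + 1)))"

text \<open>For the remaining definitions, \<open>a\<close> and \<open>y\<close> are the realized sequences of actions and rewards.\<close>

definition pulls :: "(nat \<Rightarrow> nat) \<Rightarrow> nat \<Rightarrow> nat \<Rightarrow> nat" where
  "pulls a k t = card {s \<in> {1..t}. a s = k}"

definition emp_mean :: "(nat \<Rightarrow> nat) \<Rightarrow> (nat \<Rightarrow> real) \<Rightarrow> nat \<Rightarrow> nat \<Rightarrow> real" where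
  "emp_mean a y k t = (\<Sum>s | s \<in> {1..t} \<and> a s = k. y s) / real (pulls a k t)"

definition ucb_index ::
    "real measure \<Rightarrow> nat \<Rightarrow> nat \<Rightarrow> (nat \<Rightarrow> nat) \<Rightarrow> (nat \<Rightarrow> real) \<Rightarrow> nat \<Rightarrow> nat \<Rightarrow> ereal" where
  "ucb_index \<rho> K T a y k t =
     (let n = pulls a k t; m = emp_mean a y k t;
          S = {\<mu> \<in> mean_set \<rho>. kl_ext \<rho> m \<mu> \<le> ereal (exploration K T n / real n)}
      in if S = {} then ereal m else Sup (ereal ` S))"

text \<open>Injectivity on the first \<open>K\<close> rounds says that each of the \<open>K\<close> arms is pulled once in them
  (in any order); if \<open>T < K\<close>, it says that the \<open>T\<close> rounds played are on distinct arms.\<close>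

definition klucbpp_run ::
    "real measure \<Rightarrow> nat \<Rightarrow> nat \<Rightarrow> (nat \<Rightarrow> nat) \<Rightarrow> (nat \<Rightarrow> real) \<Rightarrow> bool" where
  "klucbpp_run \<rho> K T a y \<longleftrightarrow>
     a ` {1..min K T} \<subseteq> {1..K} \<and> inj_on a {1..min K T} \<and>
     (\<forall>t\<in>{K..<T}. is_arg_max (\<lambda>k. ucb_index \<rho> K T a y k t) (\<lambda>k. k \<in> {1..K}) (a (Suc t)))"

end

theory Submission
  imports Defs
begin

text \<open>
  Since the variance is at most \<open>V\<close>, the family is defined for every real parameter, it is
  sub-Gaussian, and \<open>kl(\<mu>, \<mu>') \<ge> (\<mu> - \<mu>')\<^sup>2 / (2V)\<close>. At a round where arm \<open>a\<close> is played, the gap of \<open>a\<close> is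
  at most the shortfall \<open>\<mu>\<^sup>\<star> - U\<^sup>\<star>\<close> of the index of a best arm plus the excess \<open>U\<^sub>a - \<mu>\<^sub>a\<close>.

  Shortfall: \<open>U\<^sup>\<star> < \<mu>\<^sup>\<star> - u =: v\<close> forces \<open>kl(x, v) > g(n)/n\<close> for the empirical mean \<open>x < v\<close> of the best
  arm, and \<open>kl(x, \<mu>\<^sup>\<star>) \<ge> kl(x, v) + kl(v, \<mu>\<^sup>\<star>)\<close>. With a maximal inequality for the exponential
  martingales on each cell \<open>T/K \<beta>\<^sup>-\<^sup>j\<^sup>-\<^sup>1 < n \<le> T/K \<beta>\<^sup>-\<^sup>j\<close> and \<open>g(n) \<ge> log (T/(Kn))\<close>, the probabilities sum to a
  geometric series in \<open>j\<close> after summation over \<open>u\<close>, whence a mean shortfall of order \<open>sqrt(VK/T)\<close>.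

  Excess: it is at most \<open>sqrt(2V g(n)/n)\<close>, whose sum over \<open>n\<close> is of order \<open>sqrt(VT/K)\<close> for each arm, plus
  \<open>\<delta> = sqrt(VK/T)\<close>, plus \<open>(x - \<mu>\<^sub>a - \<delta>)\<^sup>+\<close>. The latter is dominated by an exponential martingale stopped
  at the round of the next pull of \<open>a\<close>; its mean is at most \<open>sqrt(V/n) exp(-nK/(2T))\<close>.
\<close>

section \<open>Exponential families\<close>

text \<open>The game prescribes only the conditional law of each reward given the past, and pull
  counts are random, so no independent sample is attached to an arm. Probability therefore enters
  only through the processes \<open>exp_mart\<close> and two ways of stopping them. First passage
  gives the maximal inequality behind the shortfall. Stopping just before pull number
  \<open>n + 1\<close> of an arm gives, for each pair of an arm and a count \<open>n\<close>, a
  total mass of at most 1 over all rounds; this is why the excess is summed over \<open>n\<close>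
  and not over rounds. A second obstacle is that an empirical mean may be an endpoint of the mean
  set, where the divergence is only a limit, possibly infinite. Deviations are therefore rewritten
  as \<open>x \<le> m s\<close> with \<open>m s\<close> inside the mean set before any exponential
  bound is used. Origin of the constants: \<open>T * \<delta> = sqrt (V * K * T)\<close>. The
  shortfall costs \<open>39 * \<delta>\<close> per round, rounding up to the grid and the threshold
  in the excess cost \<open>\<delta>\<close> each, the bonuses add 14 and the upward deviations 4,
  in all \<open>59 * sqrt (V * K * T)\<close>.\<close>

lemma power_over_fact_le_exp:
  fixes x :: real assumes "x \<ge> 0"
  shows "x ^ k / fact k \<le> exp x"
proof -
  have "(\<Sum>n\<in>{k}. x ^ n / fact n) \<le> (\<Sum>n. x ^ n / fact n)"
    using assms summable_exp[of x] by (intro sum_le_suminf) (auto simp: field_simps)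
  then show ?thesis
    by (simp add: exp_def divide_inverse mult.commute)
qed

lemma abs_exp_minus_one_le:
  fixes z :: real
  shows "\<bar>exp z - 1\<bar> \<le> \<bar>z\<bar> * exp \<bar>z\<bar>"
proof (cases "z \<ge> 0")
  case True
  have "1 - z \<le> exp (- z)" using exp_ge_add_one_self[of "-z"] by simp
  then have "(1 - z) * exp z \<le> exp (- z) * exp z" by (intro mult_right_mono) auto
  also have "\<dots> = 1" by (simp flip: exp_add)
  finally show ?thesis using True by (simp add: algebra_simps)
next
  case False
  have "1 - exp z \<le> - z" using exp_ge_add_one_self[of z] by linarith
  also have "\<dots> \<le> - z * exp (- z)" using False by (simp add: mult_le_cancel_left1)
  finally show ?thesis using False by simp
qed

text \<open>The power of \<open>x\<close> is paid for by one more factor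
  \<open>exp (\<bar>x\<bar> * \<eta>)\<close>, and an exponential of
  \<open>2 * \<eta> * \<bar>x\<bar>\<close> is at most the sum of those of both signs. Moments at
  \<open>\<theta>\<close> are thus controlled by two neighbouring parameters.\<close>

lemma abs_power_mult_exp_le:
  fixes x \<theta> \<eta> :: real
  assumes "\<eta> > 0"
  shows "\<bar>x\<bar> ^ k * exp (x * \<theta> + \<bar>x\<bar> * \<eta>)
    \<le> fact k / \<eta> ^ k * (exp (x * (\<theta> + 2 * \<eta>)) + exp (x * (\<theta> - 2 * \<eta>)))"
proof -
  have "(\<bar>x\<bar> * \<eta>) ^ k / fact k \<le> exp (\<bar>x\<bar> * \<eta>)"
    using assms by (intro power_over_fact_le_exp) auto
  then have "\<bar>x\<bar> ^ k \<le> fact k / \<eta> ^ k * exp (\<bar>x\<bar> * \<eta>)"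
    using assms by (simp add: field_simps power_mult_distrib)
  then have "\<bar>x\<bar> ^ k * exp (x * \<theta> + \<bar>x\<bar> * \<eta>)
      \<le> fact k / \<eta> ^ k * exp (\<bar>x\<bar> * \<eta>) * exp (x * \<theta> + \<bar>x\<bar> * \<eta>)"
    by (intro mult_right_mono) auto
  also have "\<dots> = fact k / \<eta> ^ k * exp (x * \<theta> + 2 * \<eta> * \<bar>x\<bar>)"
    by (simp add: mult.assoc algebra_simps flip: exp_add)
  also have "\<dots> \<le> fact k / \<eta> ^ k * (exp (x * (\<theta> + 2 * \<eta>)) + exp (x * (\<theta> - 2 * \<eta>)))"
    using assms
    by (intro mult_left_mono; cases "x \<ge> 0")
      (auto simp: algebra_simps intro: add_increasing add_increasing2)
  finally show ?thesis .
qed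

section \<open>Moments and differentiation under the integral sign\<close>

context exponential_family
begin

declare sets_rho [measurable_cong]

lemma space_rho [simp]: "space \<rho> = UNIV"
  using sets_eq_imp_space_eq[OF sets_rho] by simp

lemma nat_params_radius:
  assumes "\<theta> \<in> nat_params \<rho>"
  obtains \<eta> where "\<eta> > 0" "\<And>t. \<bar>t - \<theta>\<bar> \<le> 2 * \<eta> \<Longrightarrow> t \<in> nat_params \<rho>"
proof -
  obtain e where e: "e > 0" "cball \<theta> e \<subseteq> nat_params \<rho>"
    using open_nat_params assms open_contains_cball by blast
  show ?thesis
  proof
    show "e / 2 > 0" using e by simp
    show "t \<in> nat_params \<rho>" if "\<bar>t - \<theta>\<bar> \<le> 2 * (e / 2)" for t
    proof -
      have "t \<in> cball \<theta> e" using that by (simp add: dist_real_def abs_minus_commute)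
      then show ?thesis using e by blast
    qed
  qed
qed

text \<open>The factor \<open>exp (\<bar>x\<bar> * \<eta>)\<close> makes this one function dominate
  the difference quotients at \<open>\<theta>\<close> for all steps of size at most
  \<open>\<eta>\<close>.\<close>

lemma integrable_moment_aux:
  assumes "\<eta> > 0" "\<theta> + 2 * \<eta> \<in> nat_params \<rho>" "\<theta> - 2 * \<eta> \<in> nat_params \<rho>"
  shows "integrable \<rho> (\<lambda>x. \<bar>x\<bar> ^ k * exp (x * \<theta> + \<bar>x\<bar> * \<eta>))"
proof (rule Bochner_Integration.integrable_bound)
  show "integrable \<rho> (\<lambda>x. fact k / \<eta> ^ k * (exp (x * (\<theta> + 2 * \<eta>)) + exp (x * (\<theta> - 2 * \<eta>))))"
    using assms by (auto simp: nat_params_def)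
  show "AE x in \<rho>. norm (\<bar>x\<bar> ^ k * exp (x * \<theta> + \<bar>x\<bar> * \<eta>))
    \<le> norm (fact k / \<eta> ^ k * (exp (x * (\<theta> + 2 * \<eta>)) + exp (x * (\<theta> - 2 * \<eta>))))"
  proof (rule AE_I2)
    fix x
    show "norm (\<bar>x\<bar> ^ k * exp (x * \<theta> + \<bar>x\<bar> * \<eta>))
      \<le> norm (fact k / \<eta> ^ k * (exp (x * (\<theta> + 2 * \<eta>)) + exp (x * (\<theta> - 2 * \<eta>))))"
      using abs_power_mult_exp_le[OF assms(1), of x k \<theta>] assms(1)
      by (simp add: abs_mult)
  qed
qed measurable

lemma integrable_moment:
  assumes "\<theta> \<in> nat_params \<rho>"
  shows "integrable \<rho> (\<lambda>x. x ^ k * exp (x * \<theta>))"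
proof -
  obtain \<eta> where \<eta>: "\<eta> > 0" "\<And>t. \<bar>t - \<theta>\<bar> \<le> 2 * \<eta> \<Longrightarrow> t \<in> nat_params \<rho>"
    using nat_params_radius[OF assms] by blast
  show ?thesis
  proof (rule Bochner_Integration.integrable_bound)
    show "integrable \<rho> (\<lambda>x. \<bar>x\<bar> ^ k * exp (x * \<theta> + \<bar>x\<bar> * \<eta>))"
      using \<eta> by (intro integrable_moment_aux) auto
    show "AE x in \<rho>. norm (x ^ k * exp (x * \<theta>)) \<le> norm (\<bar>x\<bar> ^ k * exp (x * \<theta> + \<bar>x\<bar> * \<eta>))"
      using \<eta>(1) by (intro AE_I2) (auto simp: abs_mult power_abs intro!: mult_left_mono)
  qed measurable
qed

text \<open>Dominated convergence along an arbitrary sequence of nonzero steps tending to 0; the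
  dominating function comes from \<open>abs_exp_minus_one_le\<close> and is integrable by
  \<open>integrable_moment_aux\<close>.\<close>

lemma has_real_derivative_moment:
  assumes "\<theta> \<in> nat_params \<rho>"
  shows "((\<lambda>t. \<integral>x. x ^ k * exp (x * t) \<partial>\<rho>) has_real_derivative
     (\<integral>x. x ^ Suc k * exp (x * \<theta>) \<partial>\<rho>)) (at \<theta>)"
proof -
  obtain \<eta> where \<eta>: "\<eta> > 0" "\<And>t. \<bar>t - \<theta>\<bar> \<le> 2 * \<eta> \<Longrightarrow> t \<in> nat_params \<rho>"
    using nat_params_radius[OF assms] by blast
  let ?f = "\<lambda>t. \<integral>x. x ^ k * exp (x * t) \<partial>\<rho>"
  let ?q = "\<lambda>h x. (x ^ k * exp (x * (\<theta> + h)) - x ^ k * exp (x * \<theta>)) / h"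
  have "((\<lambda>h. (?f (\<theta> + h) - ?f \<theta>) / h) \<longlongrightarrow> (\<integral>x. x ^ Suc k * exp (x * \<theta>) \<partial>\<rho>)) (at 0)"
    unfolding tendsto_at_iff_sequentially
  proof (intro allI impI)
    fix X :: "nat \<Rightarrow> real"
    assume X0: "\<forall>i. X i \<in> UNIV - {0}" and X: "X \<longlonglongrightarrow> 0"
    \<comment> \<open>The domination holds only for steps smaller than \<open>\<eta>\<close>; hence
      the shift by \<open>N\<close>, undone by \<open>LIMSEQ_offset\<close>.\<close>
    obtain N where N: "\<And>n. n \<ge> N \<Longrightarrow> \<bar>X n\<bar> < \<eta>"
      using LIMSEQ_D[OF X \<eta>(1)] by auto
    have "(\<lambda>n. ((\<lambda>h. (?f (\<theta> + h) - ?f \<theta>) / h) \<circ> X) (n + N)) = (\<lambda>n. \<integral>x. ?q (X (n + N)) x \<partial>\<rho>)"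
    proof
      fix n
      have "\<theta> + X (n + N) \<in> nat_params \<rho>"
        using N[of "n + N"] \<eta> by auto
      then show "((\<lambda>h. (?f (\<theta> + h) - ?f \<theta>) / h) \<circ> X) (n + N) = (\<integral>x. ?q (X (n + N)) x \<partial>\<rho>)"
        using integrable_moment assms by (simp add: Bochner_Integration.integral_diff)
    qed
    moreover have "(\<lambda>n. \<integral>x. ?q (X (n + N)) x \<partial>\<rho>) \<longlonglongrightarrow> (\<integral>x. x ^ Suc k * exp (x * \<theta>) \<partial>\<rho>)"
    proof (rule integral_dominated_convergence)
      show "integrable \<rho> (\<lambda>x. \<bar>x\<bar> ^ Suc k * exp (x * \<theta> + \<bar>x\<bar> * \<eta>))"
        using \<eta> by (intro integrable_moment_aux) auto
      show "AE x in \<rho>. (\<lambda>n. ?q (X (n + N)) x) \<longlonglongrightarrow> x ^ Suc k * exp (x * \<theta>)"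
      proof (rule AE_I2)
        fix x
        have "((\<lambda>t. x ^ k * exp (x * t)) has_real_derivative x ^ Suc k * exp (x * \<theta>)) (at \<theta>)"
          by (auto intro!: derivative_eq_intros)
        then have "((\<lambda>h. ?q h x) \<longlongrightarrow> x ^ Suc k * exp (x * \<theta>)) (at 0)"
          unfolding DERIV_def .
        then have "((\<lambda>h. ?q h x) \<circ> X) \<longlonglongrightarrow> x ^ Suc k * exp (x * \<theta>)"
          using X0 X unfolding tendsto_at_iff_sequentially by blast
        then show "(\<lambda>n. ?q (X (n + N)) x) \<longlonglongrightarrow> x ^ Suc k * exp (x * \<theta>)"
          using LIMSEQ_ignore_initial_segment[of _ _ N] by (fastforce simp: o_def)
      qed
      show "AE x in \<rho>. norm (?q (X (n + N)) x) \<le> \<bar>x\<bar> ^ Suc k * exp (x * \<theta> + \<bar>x\<bar> * \<eta>)" for n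
      proof (rule AE_I2)
        fix x
        let ?h = "X (n + N)"
        have h: "?h \<noteq> 0" "\<bar>?h\<bar> \<le> \<eta>" using X0 N[of "n + N"] by auto
        have "x ^ k * exp (x * (\<theta> + ?h)) - x ^ k * exp (x * \<theta>)
          = x ^ k * exp (x * \<theta>) * (exp (x * ?h) - 1)"
          by (simp add: algebra_simps exp_add)
        then have "norm (?q ?h x) = \<bar>x\<bar> ^ k * exp (x * \<theta>) * \<bar>exp (x * ?h) - 1\<bar> / \<bar>?h\<bar>"
          by (simp add: abs_mult power_abs)
        also have "\<dots> \<le> \<bar>x\<bar> ^ k * exp (x * \<theta>) * (\<bar>x * ?h\<bar> * exp \<bar>x * ?h\<bar>) / \<bar>?h\<bar>"
          by (intro divide_right_mono mult_left_mono abs_exp_minus_one_le) auto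
        also have "\<dots> = \<bar>x\<bar> ^ Suc k * exp (x * \<theta>) * exp (\<bar>x\<bar> * \<bar>?h\<bar>)"
          using h by (simp add: abs_mult)
        also have "\<dots> \<le> \<bar>x\<bar> ^ Suc k * exp (x * \<theta>) * exp (\<bar>x\<bar> * \<eta>)"
          using h by (intro mult_left_mono) (auto intro: mult_left_mono)
        finally show "norm (?q ?h x) \<le> \<bar>x\<bar> ^ Suc k * exp (x * \<theta> + \<bar>x\<bar> * \<eta>)"
          by (simp add: exp_add mult.assoc)
      qed
    qed measurable
    ultimately have "(\<lambda>n. ((\<lambda>h. (?f (\<theta> + h) - ?f \<theta>) / h) \<circ> X) (n + N))
        \<longlonglongrightarrow> (\<integral>x. x ^ Suc k * exp (x * \<theta>) \<partial>\<rho>)"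
      by (simp only:)
    then show "((\<lambda>h. (?f (\<theta> + h) - ?f \<theta>) / h) \<circ> X) \<longlonglongrightarrow> (\<integral>x. x ^ Suc k * exp (x * \<theta>) \<partial>\<rho>)"
      by (rule LIMSEQ_offset)
  qed
  then show ?thesis unfolding DERIV_def .
qed

text \<open>A vanishing integral of a positive function means that the measure is null, which the
  positive variance forbids.\<close>

lemma partition_pos:
  assumes "\<theta> \<in> nat_params \<rho>"
  shows "(\<integral>x. exp (x * \<theta>) \<partial>\<rho>) > 0"
proof (rule ccontr)
  assume "\<not> ?thesis"
  moreover have "(\<integral>x. exp (x * \<theta>) \<partial>\<rho>) \<ge> 0" by (intro integral_nonneg_AE) auto
  ultimately have "(\<integral>x. exp (x * \<theta>) \<partial>\<rho>) = 0" by linarith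
  then have "AE x in \<rho>. exp (x * \<theta>) = 0"
    using assms by (subst (asm) integral_nonneg_eq_0_iff_AE) (auto simp: nat_params_def)
  then have AE_False: "AE x in \<rho>. False" by simp
  have "(\<integral>x. exp (x * t) \<partial>\<rho>) = 0" for t
  proof -
    have "AE x in \<rho>. exp (x * t) = 0" using AE_False by eventually_elim simp
    then show ?thesis by (rule integral_eq_zero_AE)
  qed
  \<comment> \<open>Here the default value \<open>ln 0 = 0\<close> matters: the log-partition
    function is constant, and its second derivative is 0.\<close>
  then have "log_partition \<rho> = (\<lambda>_. 0)"
    by (auto simp: log_partition_def)
  then have "expfam_variance \<rho> \<theta> = 0"
    by (simp add: expfam_variance_def)
  then show False using variance_pos[OF assms] by simp
qed

section \<open>Mean and variance as derivatives of the log-partition function\<close>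

lemma exp_log_partition:
  "\<theta> \<in> nat_params \<rho> \<Longrightarrow> exp (log_partition \<rho> \<theta>) = (\<integral>x. exp (x * \<theta>) \<partial>\<rho>)"
  using partition_pos by (simp add: log_partition_def)

text \<open>The moments keep the form \<open>x ^ 1\<close> and \<open>x ^ 0\<close>, to which
  \<open>has_real_derivative_moment\<close> applies once more for the second derivative.\<close>

lemma has_real_derivative_log_partition_moment:
  assumes "\<theta> \<in> nat_params \<rho>"
  shows "(log_partition \<rho> has_real_derivative
    (\<integral>x. x ^ 1 * exp (x * \<theta>) \<partial>\<rho>) / (\<integral>x. x ^ 0 * exp (x * \<theta>) \<partial>\<rho>)) (at \<theta>)"
  using has_real_derivative_moment[OF assms, of 0] partition_pos[OF assms]
  unfolding log_partition_def[abs_def]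
  by (auto intro!: derivative_eq_intros)

lemma expfam_mean_eq_moment:
  "\<theta> \<in> nat_params \<rho> \<Longrightarrow> expfam_mean \<rho> \<theta> =
    (\<integral>x. x ^ 1 * exp (x * \<theta>) \<partial>\<rho>) / (\<integral>x. x ^ 0 * exp (x * \<theta>) \<partial>\<rho>)"
  unfolding expfam_mean_def
  by (rule DERIV_imp_deriv[OF has_real_derivative_log_partition_moment])

lemma has_real_derivative_log_partition:
  "\<theta> \<in> nat_params \<rho> \<Longrightarrow> (log_partition \<rho> has_real_derivative expfam_mean \<rho> \<theta>) (at \<theta>)"
  using has_real_derivative_log_partition_moment expfam_mean_eq_moment by simp

text \<open>The variance is a \<open>deriv\<close> by definition, so it is enough that some
  derivative exists. It does, since the mean agrees on the open parameter set with a quotient of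
  differentiable moments.\<close>

lemma has_real_derivative_expfam_mean:
  assumes "\<theta> \<in> nat_params \<rho>"
  shows "(expfam_mean \<rho> has_real_derivative expfam_variance \<rho> \<theta>) (at \<theta>)"
proof -
  have "\<exists>D. ((\<lambda>t. (\<integral>x. x ^ 1 * exp (x * t) \<partial>\<rho>) / (\<integral>x. x ^ 0 * exp (x * t) \<partial>\<rho>))
      has_real_derivative D) (at \<theta>)"
    using has_real_derivative_moment[OF assms, of 1] has_real_derivative_moment[OF assms, of 0]
      partition_pos[OF assms]
    by (intro exI derivative_eq_intros) auto
  then obtain D where "((\<lambda>t. (\<integral>x. x ^ 1 * exp (x * t) \<partial>\<rho>) / (\<integral>x. x ^ 0 * exp (x * t) \<partial>\<rho>))
      has_real_derivative D) (at \<theta>)" ..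
  then have D: "(expfam_mean \<rho> has_real_derivative D) (at \<theta>)"
    by (rule has_field_derivative_transform_within_open[OF _ open_nat_params assms])
      (metis expfam_mean_eq_moment)
  then have "expfam_variance \<rho> \<theta> = D"
    unfolding expfam_variance_def using DERIV_imp_deriv by (simp add: expfam_mean_def[abs_def])
  then show ?thesis using D by simp
qed

lemma prob_space_law:
  assumes "\<theta> \<in> nat_params \<rho>"
  shows "prob_space (expfam_law \<rho> \<theta>)"
proof
  have "(\<integral>\<^sup>+x. ennreal (exp (x * \<theta> - log_partition \<rho> \<theta>)) \<partial>\<rho>)
      = (\<integral>\<^sup>+x. ennreal (exp (x * \<theta>) / exp (log_partition \<rho> \<theta>)) \<partial>\<rho>)"
    by (simp add: exp_diff)
  also have "\<dots> = ennreal (\<integral>x. exp (x * \<theta>) / exp (log_partition \<rho> \<theta>) \<partial>\<rho>)"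
    using assms by (intro nn_integral_eq_integral) (auto simp: nat_params_def)
  also have "\<dots> = 1"
    using partition_pos[OF assms] by (simp add: exp_log_partition[OF assms])
  finally show "emeasure (expfam_law \<rho> \<theta>) (space (expfam_law \<rho> \<theta>)) = 1"
    unfolding expfam_law_def by (subst emeasure_density) (auto simp: sets_rho)
qed

lemma sets_law [simp, measurable_cong]: "sets (expfam_law \<rho> \<theta>) = sets borel"
  by (simp add: expfam_law_def sets_rho)

lemma convex_nat_params: "convex (nat_params \<rho>)"
proof (rule convexI)
  fix s t u v :: real
  assume st: "s \<in> nat_params \<rho>" "t \<in> nat_params \<rho>" and uv: "0 \<le> u" "0 \<le> v" "u + v = 1"
  have "integrable \<rho> (\<lambda>x. exp (x * (u * s + v * t)))"
  proof (rule Bochner_Integration.integrable_bound)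
    show "integrable \<rho> (\<lambda>x. exp (x * s) + exp (x * t))"
      using st by (auto simp: nat_params_def)
    have "exp (x * (u * s + v * t)) \<le> exp (x * s) + exp (x * t)" for x
    proof -
      have "x * (u * s + v * t) = u * (x * s) + v * (x * t)"
        by (simp add: algebra_simps)
      also have "\<dots> \<le> max (x * s) (x * t)"
        using uv convex_bound_le[of "x * s" "max (x * s) (x * t)" "x * t" u v] by simp
      finally show ?thesis
        by (smt (verit) exp_ge_zero exp_le_cancel_iff)
    qed
    then show "AE x in \<rho>. norm (exp (x * (u * s + v * t))) \<le> norm (exp (x * s) + exp (x * t))"
      by (intro AE_I2) auto
  qed measurable
  then show "u *\<^sub>R s + v *\<^sub>R t \<in> nat_params \<rho>"
    by (simp add: nat_params_def)
qed

lemma expfam_mean_strict_mono: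
  assumes "s \<in> nat_params \<rho>" "t \<in> nat_params \<rho>" "s < t"
  shows "expfam_mean \<rho> s < expfam_mean \<rho> t"
proof (rule DERIV_pos_imp_increasing[OF assms(3)])
  fix x assume "s \<le> x" "x \<le> t"
  then have "x \<in> nat_params \<rho>"
    using mem_is_interval_1_I[OF convex_nat_params[folded is_interval_convex_1] assms(1,2)] by simp
  then show "\<exists>y. (expfam_mean \<rho> has_real_derivative y) (at x) \<and> y > 0"
    using has_real_derivative_expfam_mean variance_pos by blast
qed

lemma inj_on_expfam_mean: "inj_on (expfam_mean \<rho>) (nat_params \<rho>)"
  by (rule inj_onI) (metis expfam_mean_strict_mono linorder_neqE_linordered_idom order_less_irrefl)

lemma param_of_mean_expfam_mean [simp]:
  "\<theta> \<in> nat_params \<rho> \<Longrightarrow> param_of_mean \<rho> (expfam_mean \<rho> \<theta>) = \<theta>"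
  unfolding param_of_mean_def using the_inv_into_f_f[OF inj_on_expfam_mean] by simp

end

text \<open>With a bounded variance \<open>log_partition\<close> stays bounded near a finite endpoint of the open set
  of natural parameters; by Fatou's lemma such an endpoint would itself be a natural parameter.
  Hence every real number is a natural parameter.\<close>

locale bounded_variance_family = exponential_family +
  fixes V :: real
  assumes V_pos: "V > 0"
    and variance_le_aux: "\<And>\<mu>. \<mu> \<in> mean_set \<rho> \<Longrightarrow> expfam_variance \<rho> (param_of_mean \<rho> \<mu>) \<le> V"
begin

abbreviation b where "b \<equiv> log_partition \<rho>"
abbreviation m where "m \<equiv> expfam_mean \<rho>"

section \<open>Quadratic bounds; every real number is a natural parameter\<close>

lemma variance_le: "\<theta> \<in> nat_params \<rho> \<Longrightarrow> expfam_variance \<rho> \<theta> \<le> V"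
  using variance_le_aux[of "m \<theta>"] by (simp add: mean_set_def)

lemma log_partition_above_tangent_aux:
  assumes "s \<in> nat_params \<rho>" "t \<in> nat_params \<rho>"
  shows "b t - b s - m s * (t - s) \<ge> 0"
proof -
  have "b t - b s \<ge> m s * (t - s)"
  proof (rule convex_on_imp_above_tangent)
    show "convex_on (nat_params \<rho>) b"
      by (rule f''_ge0_imp_convex[OF convex_nat_params has_real_derivative_log_partition
            has_real_derivative_expfam_mean])
        (auto intro: order_less_imp_le variance_pos)
    show "connected (nat_params \<rho>)" by (rule convex_connected[OF convex_nat_params])
    show "s \<in> interior (nat_params \<rho>)" using open_nat_params assms by (simp add: interior_open)
    show "(b has_real_derivative m s) (at s within nat_params \<rho>)"
      using has_real_derivative_log_partition assms has_field_derivative_at_within by blast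
  qed (use assms in auto)
  then show ?thesis by simp
qed

text \<open>The function \<open>V / 2 * x\<^sup>2 - b x\<close> is convex, because its second
  derivative is \<open>V\<close> minus the variance; the claim is its tangent inequality at
  \<open>s\<close>.\<close>

lemma log_partition_quadratic_upper_aux:
  assumes "s \<in> nat_params \<rho>" "t \<in> nat_params \<rho>"
  shows "b t - b s - m s * (t - s) \<le> V / 2 * (t - s)\<^sup>2"
proof -
  let ?g = "\<lambda>x. V / 2 * x\<^sup>2 - b x"
  have d1: "(?g has_real_derivative V * x - m x) (at x)" if "x \<in> nat_params \<rho>" for x
    using has_real_derivative_log_partition[OF that]
    by (auto intro!: derivative_eq_intros)
  have d2: "((\<lambda>x. V * x - m x) has_real_derivative V - expfam_variance \<rho> x) (at x)"
    if "x \<in> nat_params \<rho>" for x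
    using has_real_derivative_expfam_mean[OF that]
    by (auto intro!: derivative_eq_intros)
  have "?g t - ?g s \<ge> (V * s - m s) * (t - s)"
  proof (rule convex_on_imp_above_tangent)
    show "convex_on (nat_params \<rho>) ?g"
      by (rule f''_ge0_imp_convex[OF convex_nat_params d1 d2]) (auto intro: variance_le)
    show "connected (nat_params \<rho>)" by (rule convex_connected[OF convex_nat_params])
    show "s \<in> interior (nat_params \<rho>)" using open_nat_params assms by (simp add: interior_open)
    show "(?g has_real_derivative V * s - m s) (at s within nat_params \<rho>)"
      using d1[OF assms(1)] has_field_derivative_at_within by blast
  qed (use assms in auto)
  then have "b t - b s - m s * (t - s) \<le> V / 2 * t\<^sup>2 - V / 2 * s\<^sup>2 - V * s * (t - s)"
    by (simp add: algebra_simps)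
  also have "\<dots> = V / 2 * (t - s)\<^sup>2"
    by (simp add: power2_eq_square field_simps)
  finally show ?thesis .
qed

lemma closed_nat_params: "closed (nat_params \<rho>)"
  unfolding closed_sequential_limits
proof (intro allI impI, elim conjE)
  fix X :: "nat \<Rightarrow> real" and z
  assume X: "\<forall>n. X n \<in> nat_params \<rho>" and Xz: "X \<longlonglongrightarrow> z"
  obtain s where s: "s \<in> nat_params \<rho>" using nat_params_nonempty by blast
  \<comment> \<open>A bound for \<open>b\<close> on the parameter set that is continuous at
    \<open>z\<close> as well, where nothing is known about \<open>b\<close> yet.\<close>
  let ?B = "\<lambda>t. b s + m s * (t - s) + V / 2 * (t - s)\<^sup>2"
  have "(\<lambda>n. exp (?B (X n))) \<longlonglongrightarrow> exp (?B z)"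
    using Xz by (auto intro!: tendsto_intros)
  then have lim: "(\<lambda>n. ennreal (exp (?B (X n)))) \<longlonglongrightarrow> ennreal (exp (?B z))"
    by (intro tendsto_ennrealI)
  have "(\<integral>\<^sup>+x. ennreal (exp (x * z)) \<partial>\<rho>) = (\<integral>\<^sup>+x. liminf (\<lambda>n. ennreal (exp (x * X n))) \<partial>\<rho>)"
  proof (rule nn_integral_cong)
    fix x
    have "(\<lambda>n. ennreal (exp (x * X n))) \<longlonglongrightarrow> ennreal (exp (x * z))"
      using Xz by (auto intro!: tendsto_intros tendsto_ennrealI)
    then show "ennreal (exp (x * z)) = liminf (\<lambda>n. ennreal (exp (x * X n)))"
      using lim_imp_Liminf[OF sequentially_bot] by metis
  qed
  also have "\<dots> \<le> liminf (\<lambda>n. \<integral>\<^sup>+x. ennreal (exp (x * X n)) \<partial>\<rho>)"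
    by (intro nn_integral_liminf) measurable
  also have "\<dots> \<le> liminf (\<lambda>n. ennreal (exp (?B (X n))))"
  proof (intro Liminf_mono always_eventually allI)
    fix n
    have Xn: "X n \<in> nat_params \<rho>" using X by blast
    then have "(\<integral>\<^sup>+x. ennreal (exp (x * X n)) \<partial>\<rho>) = ennreal (exp (b (X n)))"
      by (subst nn_integral_eq_integral) (auto simp: nat_params_def exp_log_partition)
    also have "\<dots> \<le> ennreal (exp (?B (X n)))"
      using log_partition_quadratic_upper_aux[OF s Xn] by (intro ennreal_leI) simp
    finally show "(\<integral>\<^sup>+x. ennreal (exp (x * X n)) \<partial>\<rho>) \<le> ennreal (exp (?B (X n)))" .
  qed
  also have "\<dots> = ennreal (exp (?B z))"
    using lim_imp_Liminf[OF sequentially_bot lim] .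
  finally have "(\<integral>\<^sup>+x. ennreal (exp (x * z)) \<partial>\<rho>) < \<infinity>"
    using ennreal_less_top le_less_trans by (metis infinity_ennreal_def)
  then show "z \<in> nat_params \<rho>"
    unfolding nat_params_def by (auto intro!: integrableI_nonneg)
qed

lemma nat_params_UNIV [simp]: "nat_params \<rho> = UNIV"
  using clopen[of "nat_params \<rho>"] open_nat_params closed_nat_params nat_params_nonempty by blast

end

section \<open>The divergence and the upper confidence index\<close>

context bounded_variance_family
begin

section \<open>The Bregman divergence of the log-partition function\<close>

lemma integrable_exp [simp]: "integrable \<rho> (\<lambda>x. exp (x * \<theta>))"
  using nat_params_UNIV[unfolded nat_params_def] by blast

lemma mean_set_eq: "mean_set \<rho> = range m"
  by (simp add: mean_set_def)

lemma mean_less_iff [simp]: "m s < m t \<longleftrightarrow> s < t"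
  using expfam_mean_strict_mono[of s t] expfam_mean_strict_mono[of t s]
  by (cases s t rule: linorder_cases) auto

lemma mean_le_iff [simp]: "m s \<le> m t \<longleftrightarrow> s \<le> t"
  by (simp add: not_less flip: not_less)

lemma has_real_derivative_b: "(b has_real_derivative m t) (at t)"
  by (rule has_real_derivative_log_partition) simp

lemma isCont_mean: "isCont m t"
  using has_real_derivative_expfam_mean[of t] DERIV_isCont by simp

lemma isCont_b: "isCont b t"
  using has_real_derivative_b DERIV_isCont by blast

lemma connected_range_mean: "connected (range m)"
  by (intro connected_continuous_image continuous_at_imp_continuous_on ballI isCont_mean) simp

text \<open>The divergence written in natural parameters (see \<open>kl_eq_bregman\<close>), where
  it is smooth and needs no inverse of the mean map.\<close>

definition bregman :: "real \<Rightarrow> real \<Rightarrow> real" where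
  "bregman s t = b t - b s - m s * (t - s)"

lemma bregman_refl [simp]: "bregman s s = 0"
  by (simp add: bregman_def)

lemma bregman_nonneg: "bregman s t \<ge> 0"
  unfolding bregman_def by (rule log_partition_above_tangent_aux) simp_all

lemma bregman_le: "bregman s t \<le> V / 2 * (t - s)\<^sup>2"
  unfolding bregman_def by (rule log_partition_quadratic_upper_aux) simp_all

text \<open>Descent argument: a step of length \<open>1/V\<close> along the gradient of the function
  \<open>z \<mapsto> b z - m s * z\<close>, starting from \<open>t\<close>, cannot go below its minimum, attained at \<open>s\<close>.\<close>

lemma bregman_ge: "(m s - m t)\<^sup>2 / (2 * V) \<le> bregman s t"
proof -
  define z where "z = t + (m s - m t) / V"
  have "bregman s z \<ge> 0" by (rule bregman_nonneg)
  moreover have "bregman s t - bregman s z = (m s - m t) * (z - t) - bregman t z"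
    by (simp add: bregman_def algebra_simps)
  moreover have "bregman t z \<le> V / 2 * ((m s - m t) / V)\<^sup>2"
    using bregman_le[of t z] by (simp add: z_def)
  moreover have "(m s - m t) * (z - t) - V / 2 * ((m s - m t) / V)\<^sup>2 = (m s - m t)\<^sup>2 / (2 * V)"
    using V_pos by (simp add: z_def power2_eq_square field_simps)
  ultimately show ?thesis by linarith
qed

lemma bregman_three_points:
  "bregman s t = bregman s v + bregman v t + (m v - m s) * (t - v)"
  by (simp add: bregman_def algebra_simps)

text \<open>The cross term of the three-point identity is a product of two factors of equal sign, as
  \<open>m\<close> is increasing. Both orders of the points are needed, one for each end of the mean
  set.\<close>

lemma bregman_superadditive:
  assumes "s \<le> v \<and> v \<le> t \<or> t \<le> v \<and> v \<le> s"
  shows "bregman s v + bregman v t \<le> bregman s t"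
proof -
  have "(m v - m s) * (t - v) \<ge> 0"
    using assms by (auto intro: mult_nonneg_nonneg mult_nonpos_nonpos)
  then show ?thesis using bregman_three_points[of s t v] by simp
qed

lemma bregman_mono_left:
  "s \<le> v \<and> v \<le> t \<or> t \<le> v \<and> v \<le> s \<Longrightarrow> bregman v t \<le> bregman s t"
  using bregman_superadditive[of s v t] bregman_nonneg[of s v] by simp

lemma bregman_mono_right:
  "s \<le> v \<and> v \<le> t \<or> t \<le> v \<and> v \<le> s \<Longrightarrow> bregman s v \<le> bregman s t"
  using bregman_superadditive[of s v t] bregman_nonneg[of v t] by simp

section \<open>Generating function, divergence and support of the laws\<close>

lemma prob_space_law': "prob_space (expfam_law \<rho> \<theta>)"
  by (rule prob_space_law) simp

lemma nn_integral_exp_law: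
  "(\<integral>\<^sup>+x. ennreal (exp (l * x)) \<partial>expfam_law \<rho> \<theta>) = ennreal (exp (b (\<theta> + l) - b \<theta>))"
proof -
  have "(\<integral>\<^sup>+x. ennreal (exp (l * x)) \<partial>expfam_law \<rho> \<theta>)
      = (\<integral>\<^sup>+x. ennreal (exp (x * \<theta> - b \<theta>)) * ennreal (exp (l * x)) \<partial>\<rho>)"
    unfolding expfam_law_def by (subst nn_integral_density) auto
  also have "\<dots> = (\<integral>\<^sup>+x. ennreal (exp (- b \<theta>) * exp (x * (\<theta> + l))) \<partial>\<rho>)"
    by (intro nn_integral_cong) (simp add: algebra_simps flip: ennreal_mult exp_add)
  also have "\<dots> = ennreal (exp (- b \<theta>) * exp (b (\<theta> + l)))"
    by (subst nn_integral_eq_integral) (auto simp: exp_log_partition)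
  finally show ?thesis by (simp add: algebra_simps flip: exp_add)
qed

lemma has_bochner_integral_law: "has_bochner_integral (expfam_law \<rho> \<theta>) (\<lambda>x. x) (m \<theta>)"
proof -
  have i: "integrable \<rho> (\<lambda>x. x ^ 1 * exp (x * \<theta>))" by (rule integrable_moment) simp
  have eq: "exp (x * \<theta> - b \<theta>) * x = x ^ 1 * exp (x * \<theta>) / (\<integral>x. exp (x * \<theta>) \<partial>\<rho>)" for x
    by (simp add: exp_diff exp_log_partition)
  have "has_bochner_integral \<rho> (\<lambda>x. exp (x * \<theta> - b \<theta>) * x) (m \<theta>)"
    unfolding eq using i by (simp add: has_bochner_integral_iff expfam_mean_eq_moment)
  then show ?thesis
    unfolding expfam_law_def by (intro has_bochner_integral_density) auto
qed

text \<open>One law is a density of the other with a log-likelihood ratio affine in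
  \<open>x\<close>, so that only the mean \<open>m s\<close> enters its integral.\<close>

lemma kl_eq_bregman [simp]: "kl \<rho> (m s) (m t) = bregman s t"
proof -
  interpret S: prob_space "expfam_law \<rho> s" by (rule prob_space_law')
  interpret T: prob_space "expfam_law \<rho> t" by (rule prob_space_law')
  let ?f = "\<lambda>x. exp (x * s - b s - (x * t - b t))"
  have "density (expfam_law \<rho> t) (\<lambda>x. ennreal (?f x)) = expfam_law \<rho> s"
    unfolding expfam_law_def
    by (subst density_density_eq) (auto simp: mult.commute simp flip: ennreal_mult exp_add)
  then have "kl \<rho> (m s) (m t) = KL_divergence (exp 1) (expfam_law \<rho> t)
      (density (expfam_law \<rho> t) (\<lambda>x. ennreal (?f x)))"
    by (simp add: kl_def)
  also have "\<dots> = (\<integral>x. ?f x * log (exp 1) (?f x) \<partial>expfam_law \<rho> t)"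
    by (subst T.KL_density) (auto simp: expfam_law_def)
  also have "\<dots> = (\<integral>x. x * s - b s - (x * t - b t) \<partial>density (expfam_law \<rho> t) (\<lambda>x. ennreal (?f x)))"
    by (subst integral_real_density) (auto simp: expfam_law_def log_def)
  also have "density (expfam_law \<rho> t) (\<lambda>x. ennreal (?f x)) = expfam_law \<rho> s" by fact
  also have "(\<integral>x. x * s - b s - (x * t - b t) \<partial>expfam_law \<rho> s) = m s * s - b s - (m s * t - b t)"
    using has_bochner_integral_law[of s]
    by (simp add: has_bochner_integral_iff S.prob_space)
  also have "\<dots> = bregman s t" by (simp add: bregman_def algebra_simps)
  finally show ?thesis .
qed

lemma law_tail_le:
  "emeasure (expfam_law \<rho> \<theta>) {x. d \<le> l * x} \<le> ennreal (exp (b (\<theta> + l) - b \<theta> - d))"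
proof -
  have "(\<integral>\<^sup>+x. indicator {x. d \<le> l * x} x \<partial>expfam_law \<rho> \<theta>)
      \<le> (\<integral>\<^sup>+x. ennreal (exp (- d)) * ennreal (exp (l * x)) \<partial>expfam_law \<rho> \<theta>)"
  proof (intro nn_integral_mono)
    fix x
    have "ennreal (exp (- d)) * ennreal (exp (l * x)) = ennreal (exp (l * x - d))"
      by (simp add: ennreal_mult[symmetric] exp_add[symmetric])
    then show "indicator {x. d \<le> l * x} x \<le> ennreal (exp (- d)) * ennreal (exp (l * x))"
      by (auto simp: indicator_def)
  qed
  moreover have "(\<integral>\<^sup>+x. indicator {x. d \<le> l * x} x \<partial>expfam_law \<rho> \<theta>)
      = emeasure (expfam_law \<rho> \<theta>) {x. d \<le> l * x}"
    by (rule nn_integral_indicator) simp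
  moreover have "(\<integral>\<^sup>+x. ennreal (exp (- d)) * ennreal (exp (l * x)) \<partial>expfam_law \<rho> \<theta>)
      = ennreal (exp (- d)) * ennreal (exp (b (\<theta> + l) - b \<theta>))"
    unfolding nn_integral_exp_law[symmetric] by (rule nn_integral_cmult) measurable
  moreover have "ennreal (exp (- d)) * ennreal (exp (b (\<theta> + l) - b \<theta>))
      = ennreal (exp (b (\<theta> + l) - b \<theta> - d))"
    by (simp add: ennreal_mult[symmetric] exp_add[symmetric])
  ultimately show ?thesis by (simp only:)
qed

text \<open>Chernoff's bound with exponent \<open>s * n\<close> for arbitrarily large
  \<open>n\<close>: convexity bounds the growth of \<open>b\<close> by \<open>n * (s * c)\<close>,
  so the probability of exceeding \<open>s * c + e\<close> is at most \<open>exp (- (n * e))\<close>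
  for every \<open>n\<close>. The sign \<open>s\<close> treats both tails at once.\<close>

lemma AE_law_less:
  assumes e: "e > 0" and s: "s = 1 \<or> s = - 1" and bd: "\<And>t. s * m t \<le> s * c"
  shows "AE x in expfam_law \<rho> \<theta>. s * x < s * c + e"
proof (rule AE_I')
  let ?N = "{x. s * c + e \<le> s * x}"
  have "emeasure (expfam_law \<rho> \<theta>) ?N \<le> ennreal (exp (- (real n * e)))" for n
  proof (cases "n = 0")
    case True
    then show ?thesis using prob_space.emeasure_le_1[OF prob_space_law'] by simp
  next
    case False
    let ?l = "s * real n"
    have "?N = {x. real n * (s * c + e) \<le> ?l * x}"
      using False by (auto simp: mult.assoc mult.left_commute[of s])
    then have "emeasure (expfam_law \<rho> \<theta>) ?N
        \<le> ennreal (exp (b (\<theta> + ?l) - b \<theta> - real n * (s * c + e)))"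
      using law_tail_le[of \<theta> "real n * (s * c + e)" ?l] by simp
    also have "\<dots> \<le> ennreal (exp (- (real n * e)))"
    proof -
      have "b (\<theta> + ?l) - b \<theta> = m (\<theta> + ?l) * ?l - bregman (\<theta> + ?l) \<theta>"
        by (simp add: bregman_def)
      also have "\<dots> \<le> real n * (s * m (\<theta> + ?l))"
        using bregman_nonneg[of "\<theta> + ?l" \<theta>] by (simp add: algebra_simps)
      also have "\<dots> \<le> real n * (s * c)" by (intro mult_left_mono bd) auto
      finally show ?thesis by (intro ennreal_leI) (simp add: algebra_simps)
    qed
    finally show ?thesis .
  qed
  moreover have "(\<lambda>n. ennreal (exp (- (real n * e)))) \<longlonglongrightarrow> ennreal 0"
  proof (intro tendsto_ennrealI)
    have "filterlim (\<lambda>n. real n * e) at_top sequentially"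
      using filterlim_tendsto_pos_mult_at_top[OF tendsto_const e filterlim_real_sequentially]
      by (simp add: mult.commute)
    then show "(\<lambda>n. exp (- (real n * e))) \<longlonglongrightarrow> 0"
      using filterlim_compose[OF exp_at_bot] filterlim_uminus_at_top by blast
  qed
  ultimately have "emeasure (expfam_law \<rho> \<theta>) ?N \<le> 0"
    by (intro LIMSEQ_le_const[of _ 0 "emeasure (expfam_law \<rho> \<theta>) ?N"]) auto
  then show "?N \<in> null_sets (expfam_law \<rho> \<theta>)"
    by (auto simp: null_sets_def)
qed auto

lemma AE_law_le:
  assumes s: "s = 1 \<or> s = - 1" and bd: "\<And>t. s * m t \<le> s * c"
  shows "AE x in expfam_law \<rho> \<theta>. s * x \<le> s * c"
proof -
  have "AE x in expfam_law \<rho> \<theta>. \<forall>n. s * x < s * c + 1 / real (Suc n)"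
    by (subst AE_all_countable) (intro allI AE_law_less s bd, simp)
  then show ?thesis
  proof eventually_elim
    case (elim x)
    show ?case
    proof (rule field_le_epsilon)
      fix e :: real assume "e > 0"
      then obtain n where "1 / real (Suc n) < e" by (metis nat_approx_posE)
      then show "s * x \<le> s * c + e" using elim[rule_format, of n] by linarith
    qed
  qed
qed

lemma not_in_mean_set_cases:
  assumes "x \<notin> mean_set \<rho>"
  shows "(\<forall>t. x < m t) \<or> (\<forall>t. m t < x)"
proof (rule ccontr)
  assume "\<not> ?thesis"
  then obtain s t where "m s \<le> x" "x \<le> m t" by (auto simp: not_less)
  then have "x \<in> range m"
    using connected_range_mean by (auto simp: connected_iff_interval)
  then show False using assms by (simp add: mean_set_eq)
qed

text \<open>Keeps rewards, and by convexity empirical means, where \<open>kl_ext\<close> is the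
  limit of a divergence. A point outside the connected mean set lies on one side of it, and the
  almost sure bounds push it onto the endpoint.\<close>

lemma AE_law_closure: "AE x in expfam_law \<rho> \<theta>. x \<in> closure (mean_set \<rho>)"
proof -
  have "AE x in expfam_law \<rho> \<theta>. bdd_below (range m) \<longrightarrow> Inf (range m) \<le> x"
  proof (cases "bdd_below (range m)")
    case True
    then show ?thesis
      using AE_law_le[of "-1" "Inf (range m)" \<theta>] by (auto intro: cInf_lower)
  qed simp
  moreover have "AE x in expfam_law \<rho> \<theta>. bdd_above (range m) \<longrightarrow> x \<le> Sup (range m)"
  proof (cases "bdd_above (range m)")
    case True
    then show ?thesis
      using AE_law_le[of "1" "Sup (range m)" \<theta>] by (auto intro: cSup_upper)
  qed simp
  ultimately show ?thesis
  proof eventually_elim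
    case (elim x)
    show ?case
    proof (cases "x \<in> mean_set \<rho>")
      case False
      from not_in_mean_set_cases[OF this] show ?thesis
      proof
        assume *: "\<forall>t. x < m t"
        then have bdd: "bdd_below (range m)" by (auto intro!: bdd_belowI less_imp_le)
        have "x \<le> Inf (range m)" using * by (intro cInf_greatest) (auto intro: less_imp_le)
        then have "x = Inf (range m)" using elim bdd by simp
        then show ?thesis using closure_contains_Inf[OF _ bdd] by (simp add: mean_set_eq)
      next
        assume *: "\<forall>t. m t < x"
        then have bdd: "bdd_above (range m)" by (auto intro!: bdd_aboveI less_imp_le)
        have "Sup (range m) \<le> x" using * by (intro cSup_least) (auto intro: less_imp_le)
        then have "x = Sup (range m)" using elim bdd by simp
        then show ?thesis using closure_contains_Sup[OF _ bdd] by (simp add: mean_set_eq)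
      qed
    qed (use closure_subset in blast)
  qed
qed

section \<open>The divergence at the endpoints of the mean set\<close>

lemma convex_closure_mean_set: "convex (closure (mean_set \<rho>))"
  using connected_range_mean by (intro convex_closure) (simp add: mean_set_eq connected_convex_1)

lemma kl_ext_mean [simp]: "kl_ext \<rho> (m s) (m t) = ereal (bregman s t)"
  by (simp add: kl_ext_def mean_set_eq)

lemma at_endpoint_neq_bot:
  assumes "x \<in> closure (mean_set \<rho>)" "x \<notin> mean_set \<rho>"
  shows "at x within mean_set \<rho> \<noteq> bot"
  using assms by (auto simp: trivial_limit_within closure_def)

text \<open>\<open>Lim\<close> is informative only if a limit exists. It does, since the divergence
  grows as its first argument moves away from \<open>m t\<close>; the limit is a supremum, possibly
  infinite.\<close>

lemma kl_ext_endpoint: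
  assumes x: "x \<in> closure (mean_set \<rho>)" "x \<notin> mean_set \<rho>"
  shows "((\<lambda>\<mu>. ereal (kl \<rho> \<mu> (m t))) \<longlongrightarrow> kl_ext \<rho> x (m t)) (at x within mean_set \<rho>)"
proof -
  have "\<exists>L. ((\<lambda>\<mu>. ereal (kl \<rho> \<mu> (m t))) \<longlongrightarrow> L) (at x within mean_set \<rho>)"
    using not_in_mean_set_cases[OF x(2)]
  proof
    assume less: "\<forall>s. x < m s"
    have near: "\<forall>\<^sub>F \<mu> in at x within mean_set \<rho>. \<exists>s<r. \<mu> = m s" for r
    proof -
      have "\<forall>\<^sub>F \<mu> in at x within mean_set \<rho>. \<mu> < m r"
        using less order_tendstoD(2)[OF tendsto_ident_at] by blast
      moreover have "\<forall>\<^sub>F \<mu> in at x within mean_set \<rho>. \<mu> \<in> mean_set \<rho>"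
        by (auto simp: eventually_at_filter)
      ultimately show ?thesis
        by eventually_elim (auto simp: mean_set_eq)
    qed
    show ?thesis
    proof (intro exI order_tendstoI)
      fix a assume "a < (SUP s\<in>{..t}. ereal (bregman s t))"
      then obtain s where s: "s \<le> t" "a < ereal (bregman s t)" by (auto simp: less_SUP_iff)
      show "\<forall>\<^sub>F \<mu> in at x within mean_set \<rho>. a < ereal (kl \<rho> \<mu> (m t))"
        using near[of s]
      proof eventually_elim
        case (elim \<mu>)
        then obtain r where r: "r < s" "\<mu> = m r" by blast
        have "bregman s t \<le> bregman r t" using r s by (intro bregman_mono_left) auto
        then show ?case using r s by (simp add: less_le_trans)
      qed
    next
      fix a assume a: "(SUP s\<in>{..t}. ereal (bregman s t)) < a"
      show "\<forall>\<^sub>F \<mu> in at x within mean_set \<rho>. ereal (kl \<rho> \<mu> (m t)) < a"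
        using near[of t]
      proof eventually_elim
        case (elim \<mu>)
        then obtain r where r: "r < t" "\<mu> = m r" by blast
        have "ereal (bregman r t) \<le> (SUP s\<in>{..t}. ereal (bregman s t))"
          using r by (intro SUP_upper) auto
        then show ?case using r a by (simp add: le_less_trans)
      qed
    qed
  next
    assume less: "\<forall>s. m s < x"
    have near: "\<forall>\<^sub>F \<mu> in at x within mean_set \<rho>. \<exists>s>r. \<mu> = m s" for r
    proof -
      have "\<forall>\<^sub>F \<mu> in at x within mean_set \<rho>. m r < \<mu>"
        using less order_tendstoD(1)[OF tendsto_ident_at] by blast
      moreover have "\<forall>\<^sub>F \<mu> in at x within mean_set \<rho>. \<mu> \<in> mean_set \<rho>"
        by (auto simp: eventually_at_filter)
      ultimately show ?thesis
        by eventually_elim (auto simp: mean_set_eq)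
    qed
    show ?thesis
    proof (intro exI order_tendstoI)
      fix a assume "a < (SUP s\<in>{t..}. ereal (bregman s t))"
      then obtain s where s: "t \<le> s" "a < ereal (bregman s t)" by (auto simp: less_SUP_iff)
      show "\<forall>\<^sub>F \<mu> in at x within mean_set \<rho>. a < ereal (kl \<rho> \<mu> (m t))"
        using near[of s]
      proof eventually_elim
        case (elim \<mu>)
        then obtain r where r: "s < r" "\<mu> = m r" by blast
        have "bregman s t \<le> bregman r t" using r s by (intro bregman_mono_left) auto
        then show ?case using r s by (simp add: less_le_trans)
      qed
    next
      fix a assume a: "(SUP s\<in>{t..}. ereal (bregman s t)) < a"
      show "\<forall>\<^sub>F \<mu> in at x within mean_set \<rho>. ereal (kl \<rho> \<mu> (m t)) < a"
        using near[of t]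
      proof eventually_elim
        case (elim \<mu>)
        then obtain r where r: "t < r" "\<mu> = m r" by blast
        have "ereal (bregman r t) \<le> (SUP s\<in>{t..}. ereal (bregman s t))"
          using r by (intro SUP_upper) auto
        then show ?case using r a by (simp add: le_less_trans)
      qed
    qed
  qed
  then obtain L where L: "((\<lambda>\<mu>. ereal (kl \<rho> \<mu> (m t))) \<longlongrightarrow> L) (at x within mean_set \<rho>)" ..
  then have "kl_ext \<rho> x (m t) = L"
    using x tendsto_Lim[OF at_endpoint_neq_bot[OF x] L] by (simp add: kl_ext_def)
  then show ?thesis using L by simp
qed

lemma kl_ext_ge:
  assumes "x \<in> closure (mean_set \<rho>)"
  shows "ereal ((x - m t)\<^sup>2 / (2 * V)) \<le> kl_ext \<rho> x (m t)"
proof (cases "x \<in> mean_set \<rho>")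
  case True
  then show ?thesis using bregman_ge by (auto simp: mean_set_eq)
next
  case False
  show ?thesis
  proof (rule tendsto_le[OF at_endpoint_neq_bot[OF assms False] kl_ext_endpoint[OF assms False]])
    show "((\<lambda>\<mu>. ereal ((\<mu> - m t)\<^sup>2 / (2 * V))) \<longlongrightarrow> ereal ((x - m t)\<^sup>2 / (2 * V)))
        (at x within mean_set \<rho>)"
      using V_pos by (intro tendsto_intros) auto
    have "\<forall>\<^sub>F \<mu> in at x within mean_set \<rho>. \<mu> \<in> mean_set \<rho>"
      by (auto simp: eventually_at_filter)
    then show "\<forall>\<^sub>F \<mu> in at x within mean_set \<rho>. ereal ((\<mu> - m t)\<^sup>2 / (2 * V)) \<le> ereal (kl \<rho> \<mu> (m t))"
      by eventually_elim (use bregman_ge in \<open>auto simp: mean_set_eq\<close>)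
  qed
qed

text \<open>For \<open>ucb_index_less_imp\<close>: when the empirical mean is the upper endpoint, a
  confidence set that contains one mean contains all larger ones.\<close>

lemma kl_ext_upper_endpoint_antimono:
  assumes x: "x \<in> closure (mean_set \<rho>)" "\<And>s. m s < x" and t: "t \<le> t'"
  shows "kl_ext \<rho> x (m t') \<le> kl_ext \<rho> x (m t)"
proof -
  have nx: "x \<notin> mean_set \<rho>" using x(2) by (auto simp: mean_set_eq)
  show ?thesis
  proof (rule tendsto_le[OF at_endpoint_neq_bot[OF x(1) nx] kl_ext_endpoint[OF x(1) nx]
        kl_ext_endpoint[OF x(1) nx]])
    have "\<forall>\<^sub>F \<mu> in at x within mean_set \<rho>. m t' < \<mu>"
      using x(2) order_tendstoD(1)[OF tendsto_ident_at] by blast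
    moreover have "\<forall>\<^sub>F \<mu> in at x within mean_set \<rho>. \<mu> \<in> mean_set \<rho>"
      by (auto simp: eventually_at_filter)
    ultimately show "\<forall>\<^sub>F \<mu> in at x within mean_set \<rho>. ereal (kl \<rho> \<mu> (m t')) \<le> ereal (kl \<rho> \<mu> (m t))"
    proof eventually_elim
      case (elim \<mu>)
      then obtain s where "\<mu> = m s" "t' < s" by (auto simp: mean_set_eq)
      then show ?case using t by (auto intro!: bregman_mono_right)
    qed
  qed
qed

text \<open>Turns a deviation measured by the divergence into a one-sided deviation, to which Chernoff's
  bound applies with a single exponent.\<close>

lemma kl_ext_lower_deviation:
  assumes \<gamma>: "\<gamma> \<ge> 0"
  obtains (level) s where "s \<le> v" "bregman s v = \<gamma>"
      "\<And>x. x \<in> closure (mean_set \<rho>) \<Longrightarrow> x < m v \<Longrightarrow> ereal \<gamma> < kl_ext \<rho> x (m v) \<Longrightarrow> x \<le> m s"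
    | (never) "\<And>x. x \<in> closure (mean_set \<rho>) \<Longrightarrow> x < m v \<Longrightarrow> \<not> ereal \<gamma> < kl_ext \<rho> x (m v)"
proof (cases "\<exists>r\<le>v. \<gamma> \<le> bregman r v")
  case True
  then obtain r where r: "r \<le> v" "\<gamma> \<le> bregman r v" by blast
  \<comment> \<open>Hitting the level exactly, by continuity, keeps the whole of
    \<open>\<gamma>\<close> in the exponent of the later Chernoff bound.\<close>
  have "\<exists>s\<ge>r. s \<le> v \<and> bregman s v = \<gamma>"
    using r \<gamma> unfolding bregman_def
    by (intro IVT2') (auto intro!: continuous_at_imp_continuous_on continuous_intros isCont_b isCont_mean)
  then obtain s where s: "s \<le> v" "bregman s v = \<gamma>" by blast
  show ?thesis
  proof (rule level[OF s])
    fix x assume x: "x \<in> closure (mean_set \<rho>)" "x < m v" "ereal \<gamma> < kl_ext \<rho> x (m v)"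
    show "x \<le> m s"
    proof (cases "x \<in> mean_set \<rho>")
      case True
      then obtain q where q: "x = m q" by (auto simp: mean_set_eq)
      show ?thesis
      proof (rule ccontr)
        assume "\<not> x \<le> m s"
        then have "bregman q v \<le> bregman s v"
          using q x(2) by (intro bregman_mono_left) auto
        then show False using x(3) q s by simp
      qed
    next
      case False
      then show ?thesis
        using not_in_mean_set_cases[OF False] x(2) by (meson less_asym less_imp_le)
    qed
  qed
next
  case False
  \<comment> \<open>The divergence may stay below \<open>\<gamma>\<close> all the way to a finite
    lower endpoint, as for Bernoulli laws; its limit there is then at most \<open>\<gamma>\<close>
    too.\<close>
  then have lt: "bregman r v \<le> \<gamma>" if "r \<le> v" for r using that by force
  show ?thesis
  proof (rule never)
    fix x assume x: "x \<in> closure (mean_set \<rho>)" "x < m v"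
    show "\<not> ereal \<gamma> < kl_ext \<rho> x (m v)"
    proof (cases "x \<in> mean_set \<rho>")
      case True
      then show ?thesis using lt x(2) by (auto simp: mean_set_eq not_less)
    next
      case False
      have "\<forall>\<^sub>F \<mu> in at x within mean_set \<rho>. \<mu> < m v"
        using x(2) order_tendstoD(2)[OF tendsto_ident_at] by blast
      moreover have "\<forall>\<^sub>F \<mu> in at x within mean_set \<rho>. \<mu> \<in> mean_set \<rho>"
        by (auto simp: eventually_at_filter)
      ultimately have "\<forall>\<^sub>F \<mu> in at x within mean_set \<rho>. ereal (kl \<rho> \<mu> (m v)) \<le> ereal \<gamma>"
        by eventually_elim (auto simp: mean_set_eq lt)
      then have "kl_ext \<rho> x (m v) \<le> ereal \<gamma>"
        by (intro tendsto_upperbound[OF kl_ext_endpoint[OF x(1) False]]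
            at_endpoint_neq_bot[OF x(1) False])
      then show ?thesis by simp
    qed
  qed
qed

section \<open>The upper confidence index\<close>

lemma exploration_nonneg: "exploration K T n \<ge> 0"
  by (simp add: exploration_def log_plus_def Let_def)

text \<open>An index below \<open>m v\<close> keeps all means from \<open>m v\<close> on out of the
  confidence set, which gives the divergence bound. An empirical mean at or above \<open>m v\<close>
  would put such a mean into it: itself if it lies in the mean set; otherwise it is the upper
  endpoint, and by monotonicity any element of the set can be raised to at least \<open>m v\<close>.
  The set is nonempty in that case, as the fallback index would be the empirical mean.\<close>

lemma ucb_index_less_imp:
  assumes x: "emp_mean a y k t \<in> closure (mean_set \<rho>)"
    and less: "ucb_index \<rho> K T a y k t < ereal (m v)"
  shows "emp_mean a y k t < m v"
    and "ereal (exploration K T (pulls a k t) / real (pulls a k t)) < kl_ext \<rho> (emp_mean a y k t) (m v)"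
proof -
  define x where "x = emp_mean a y k t"
  define c where "c = exploration K T (pulls a k t) / real (pulls a k t)"
  define S where "S = {\<mu> \<in> mean_set \<rho>. kl_ext \<rho> x \<mu> \<le> ereal c}"
  have c: "c \<ge> 0" by (simp add: c_def exploration_nonneg)
  have U: "(if S = {} then ereal x else Sup (ereal ` S)) < ereal (m v)"
    using less unfolding ucb_index_def Let_def S_def x_def c_def .
  have notS: "\<mu> \<notin> S" if "m v \<le> \<mu>" for \<mu>
  proof
    assume \<mu>: "\<mu> \<in> S"
    then have "ereal \<mu> \<le> Sup (ereal ` S)" by (intro Sup_upper) auto
    moreover have "Sup (ereal ` S) < ereal (m v)" using U \<mu> by (auto split: if_splits)
    ultimately have "ereal \<mu> < ereal (m v)" by (rule le_less_trans)
    then show False using that by simp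
  qed
  show "ereal (exploration K T (pulls a k t) / real (pulls a k t)) < kl_ext \<rho> (emp_mean a y k t) (m v)"
    using notS[of "m v"] by (simp add: S_def c_def x_def mean_set_eq not_le)
  show "emp_mean a y k t < m v"
  proof (rule ccontr)
    assume "\<not> ?thesis"
    then have ge: "m v \<le> x" by (simp add: x_def)
    show False
    proof (cases "x \<in> mean_set \<rho>")
      case True
      then have "x \<in> S" using c by (auto simp: S_def mean_set_eq)
      then show False using notS ge by blast
    next
      case False
      then have up: "\<And>s. m s < x" using not_in_mean_set_cases[OF False] ge by (meson not_le)
      have "S \<noteq> {}" using U ge by auto
      then obtain s where s: "m s \<in> S" by (auto simp: S_def mean_set_eq)
      have "kl_ext \<rho> x (m (max s v)) \<le> kl_ext \<rho> x (m s)"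
        using x up by (intro kl_ext_upper_endpoint_antimono) (auto simp: x_def)
      then have "m (max s v) \<in> S" using s by (auto simp: S_def mean_set_eq)
      then show False using notS[of "m (max s v)"] by simp
    qed
  qed
qed

text \<open>Serves the levels below the whole mean set, which are not of the form
  \<open>m v\<close>.\<close>

lemma ucb_index_ge:
  assumes x: "emp_mean a y k t \<in> closure (mean_set \<rho>)" and l: "\<And>s. l \<le> m s"
  shows "ereal l \<le> ucb_index \<rho> K T a y k t"
proof -
  define x where "x = emp_mean a y k t"
  define S where "S = {\<mu> \<in> mean_set \<rho>. kl_ext \<rho> x \<mu>
    \<le> ereal (exploration K T (pulls a k t) / real (pulls a k t))}"
  have "closure (mean_set \<rho>) \<subseteq> {l..}"
    using l by (intro closure_minimal) (auto simp: mean_set_eq)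
  then have "l \<le> x" using assms by (auto simp: x_def)
  moreover have "ereal l \<le> Sup (ereal ` S)" if "\<mu> \<in> S" for \<mu>
    using that l by (intro Sup_upper2[of "ereal \<mu>"]) (auto simp: S_def mean_set_eq)
  ultimately show ?thesis by (auto simp: ucb_index_def Let_def S_def x_def)
qed

text \<open>The quadratic lower bound on the divergence confines the confidence set to a Gaussian
  interval; the fallback value for an empty set satisfies the bound because the root is
  nonnegative.\<close>

lemma ucb_index_le:
  assumes x: "emp_mean a y k t \<in> closure (mean_set \<rho>)"
  shows "ucb_index \<rho> K T a y k t
    \<le> ereal (emp_mean a y k t + sqrt (2 * V * (exploration K T (pulls a k t) / real (pulls a k t))))"
proof -
  define x where "x = emp_mean a y k t"
  define c where "c = exploration K T (pulls a k t) / real (pulls a k t)"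
  define S where "S = {\<mu> \<in> mean_set \<rho>. kl_ext \<rho> x \<mu> \<le> ereal c}"
  have c: "c \<ge> 0" by (simp add: c_def exploration_nonneg)
  have "\<mu> \<le> x + sqrt (2 * V * c)" if "\<mu> \<in> S" for \<mu>
  proof -
    obtain s where s: "\<mu> = m s" using \<open>\<mu> \<in> S\<close> by (auto simp: S_def mean_set_eq)
    have "ereal ((x - \<mu>)\<^sup>2 / (2 * V)) \<le> kl_ext \<rho> x \<mu>"
      unfolding s using assms by (intro kl_ext_ge) (simp add: x_def)
    also have "\<dots> \<le> ereal c" using that by (simp add: S_def)
    finally have "(x - \<mu>)\<^sup>2 \<le> 2 * V * c" using V_pos by (simp add: field_simps)
    then have "\<bar>x - \<mu>\<bar> \<le> sqrt (2 * V * c)" using real_le_rsqrt by fastforce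
    then show ?thesis by linarith
  qed
  then have "Sup (ereal ` S) \<le> ereal (x + sqrt (2 * V * c))"
    by (intro Sup_least) auto
  moreover have "0 \<le> sqrt (2 * V * c)" using V_pos c by simp
  ultimately show ?thesis
    by (auto simp: ucb_index_def Let_def S_def x_def c_def)
qed

end

section \<open>Exponential martingales of a bandit game\<close>

locale bandit_game_laws = bandit_game +
  assumes prob_space_arm: "\<And>k. k \<in> {1..K} \<Longrightarrow> prob_space (\<nu> k)"
    and sets_arm: "\<And>k. k \<in> {1..K} \<Longrightarrow> sets (\<nu> k) = sets borel"
begin

section \<open>Pull counts, reward sums and their measurability\<close>

lemma measurable_F: "f \<in> measurable (F t) N \<Longrightarrow> f \<in> measurable M N"
  by (rule measurable_from_subalg[OF subalgebra_F])

lemma sets_F: "G \<in> sets (F t) \<Longrightarrow> G \<in> sets M"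
  using subalgebra_F by (auto simp: subalgebra_def)

lemma measurable_F_mono: "f \<in> measurable (F s) N \<Longrightarrow> s \<le> t \<Longrightarrow> f \<in> measurable (F t) N"
  using sets_F_mono[of s t] space_F by (auto simp: measurable_def)

lemma action_in: "t < T \<Longrightarrow> \<omega> \<in> space M \<Longrightarrow> A (Suc t) \<omega> \<in> {1..K}"
  using measurable_space[OF action_measurable] space_F by fastforce

lemma action_measurable_nat:
  assumes "1 \<le> s" "s \<le> T" "s \<le> Suc t"
  shows "A s \<in> measurable (F t) (count_space UNIV)"
proof -
  have "A (Suc (s - 1)) \<in> measurable (F (s - 1)) (count_space {1..K})"
    using assms by (intro action_measurable) auto
  then have "A s \<in> measurable (F (s - 1)) (count_space {1..K})" using assms by simp
  then have "A s \<in> measurable (F (s - 1)) (count_space UNIV)"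
    by (rule measurable_compose[where g = "\<lambda>x. x"]) simp
  then show ?thesis using assms by (intro measurable_F_mono[of _ "s - 1" _ t]) auto
qed

lemma action_set:
  assumes "t < T"
  shows "{\<omega> \<in> space M. A (Suc t) \<omega> = k} \<in> sets (F t)"
proof -
  have [measurable]: "A (Suc t) \<in> measurable (F t) (count_space UNIV)"
    using assms by (intro action_measurable_nat) auto
  show ?thesis unfolding space_F[of t, symmetric] by measurable
qed

definition num_pulls :: "nat \<Rightarrow> nat \<Rightarrow> 'a \<Rightarrow> nat" where
  "num_pulls k t \<omega> = pulls (\<lambda>s. A s \<omega>) k t"

definition reward_sum :: "nat \<Rightarrow> nat \<Rightarrow> 'a \<Rightarrow> real" where
  "reward_sum k t \<omega> = (\<Sum>s | s \<in> {1..t} \<and> A s \<omega> = k. Y s \<omega>)"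

lemma num_pulls_0 [simp]: "num_pulls k 0 \<omega> = 0"
  by (simp add: num_pulls_def pulls_def)

lemma reward_sum_0 [simp]: "reward_sum k 0 \<omega> = 0"
  by (simp add: reward_sum_def)

lemma rounds_Suc: "{s. s \<in> {1..Suc t} \<and> A s \<omega> = k} =
    (if A (Suc t) \<omega> = k then insert (Suc t) {s. s \<in> {1..t} \<and> A s \<omega> = k}
     else {s. s \<in> {1..t} \<and> A s \<omega> = k})"
  by (auto simp: le_Suc_eq)

lemma num_pulls_Suc: "num_pulls k (Suc t) \<omega> = num_pulls k t \<omega> + (if A (Suc t) \<omega> = k then 1 else 0)"
  unfolding num_pulls_def pulls_def rounds_Suc by simp

lemma reward_sum_Suc:
  "reward_sum k (Suc t) \<omega> = reward_sum k t \<omega> + (if A (Suc t) \<omega> = k then Y (Suc t) \<omega> else 0)"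
  unfolding reward_sum_def rounds_Suc by simp

lemma num_pulls_mono: "s \<le> t \<Longrightarrow> num_pulls k s \<omega> \<le> num_pulls k t \<omega>"
  by (induction t rule: dec_induct) (auto simp: num_pulls_Suc)

lemma num_pulls_less: "s < t \<Longrightarrow> A (Suc s) \<omega> = k \<Longrightarrow> num_pulls k s \<omega> < num_pulls k t \<omega>"
  using num_pulls_mono[of "Suc s" t k \<omega>] by (simp add: num_pulls_Suc)

lemma num_pulls_measurable:
  "t \<le> T \<Longrightarrow> num_pulls k t \<in> measurable (F t) (count_space UNIV)"
proof (induction t)
  case 0
  then show ?case by simp
next
  case (Suc t)
  have [measurable]: "num_pulls k t \<in> measurable (F (Suc t)) (count_space UNIV)"
    using Suc by (intro measurable_F_mono[of _ t _ "Suc t"]) auto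
  have [measurable]: "A (Suc t) \<in> measurable (F (Suc t)) (count_space UNIV)"
    using Suc by (intro action_measurable_nat) auto
  show ?case unfolding num_pulls_Suc[abs_def] by measurable
qed

lemma reward_sum_measurable:
  "t \<le> T \<Longrightarrow> reward_sum k t \<in> borel_measurable (F t)"
proof (induction t)
  case 0
  then show ?case by simp
next
  case (Suc t)
  have [measurable]: "reward_sum k t \<in> borel_measurable (F (Suc t))"
    using Suc by (intro measurable_F_mono[of _ t _ "Suc t"]) auto
  have [measurable]: "A (Suc t) \<in> measurable (F (Suc t)) (count_space UNIV)"
    using Suc by (intro action_measurable_nat) auto
  have [measurable]: "Y (Suc t) \<in> borel_measurable (F (Suc t))"
    using Suc by (intro reward_measurable) auto
  show ?case unfolding reward_sum_Suc[abs_def] by measurable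
qed

section \<open>The conditional law of the rewards\<close>

lemma reward_measurable_M: "t < T \<Longrightarrow> Y (Suc t) \<in> borel_measurable M"
  by (rule measurable_F[OF reward_measurable])

text \<open>Indexed by \<open>t\<close> although it concerns round \<open>Suc t\<close>: the choice
  for that round is already known in \<open>F t\<close>.\<close>

abbreviation plays :: "nat \<Rightarrow> nat \<Rightarrow> 'a set" where
  "plays k t \<equiv> {\<omega> \<in> space M. A (Suc t) \<omega> = k}"

lemma plays_sets: "t < T \<Longrightarrow> plays k t \<in> sets M"
  by (rule sets_F[OF action_set])

lemma integral_reward_indicator:
  assumes t: "t < T" and k: "k \<in> {1..K}" and B: "B \<in> sets borel"
    and H: "H \<in> borel_measurable (F t)" "integrable M H"
  shows "(\<integral>\<omega>. H \<omega> * indicator (plays k t) \<omega> * indicator B (Y (Suc t) \<omega>) \<partial>M)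
    = measure (\<nu> k) B * (\<integral>\<omega>. H \<omega> * indicator (plays k t) \<omega> \<partial>M)"
proof -
  interpret fs: finite_measure_subalgebra M "F t"
    by unfold_locales (rule subalgebra_F)
  have [measurable]: "H \<in> borel_measurable (F t)" "H \<in> borel_measurable M" "B \<in> sets borel"
    by (rule H(1), rule measurable_F[OF H(1)], rule B)
  have [measurable]: "plays k t \<in> sets (F t)" "plays k t \<in> sets M"
    by (rule action_set[OF t], rule plays_sets[OF t])
  have [measurable]: "Y (Suc t) \<in> borel_measurable M"
    by (rule reward_measurable_M[OF t])
  let ?h = "\<lambda>\<omega>. H \<omega> * indicator (plays k t) \<omega>"
  let ?g = "\<lambda>\<omega>. indicat_real B (Y (Suc t) \<omega>)"
  have "integrable M (\<lambda>\<omega>. ?h \<omega> * ?g \<omega>)"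
    by (rule Bochner_Integration.integrable_bound[OF H(2)])
      (auto intro!: AE_I2 simp: indicator_def)
  moreover have "?h \<in> borel_measurable (F t)" by measurable
  ultimately have "(\<integral>\<omega>. ?h \<omega> * ?g \<omega> \<partial>M) = (\<integral>\<omega>. ?h \<omega> * real_cond_exp M (F t) ?g \<omega> \<partial>M)"
    by (intro fs.real_cond_exp_intg(2)[symmetric]) measurable
  also have "\<dots> = (\<integral>\<omega>. measure (\<nu> k) B * ?h \<omega> \<partial>M)"
  proof (rule integral_cong_AE)
    have "AE \<omega> in M. real_cond_exp M (F t) ?g \<omega> = measure (\<nu> (A (Suc t) \<omega>)) B"
      by (rule reward_law[OF t B])
    then show "AE \<omega> in M. ?h \<omega> * real_cond_exp M (F t) ?g \<omega> = measure (\<nu> k) B * ?h \<omega>"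
      by eventually_elim (auto simp: indicator_def)
    show "(\<lambda>\<omega>. ?h \<omega> * real_cond_exp M (F t) ?g \<omega>) \<in> borel_measurable M"
      by measurable
  qed measurable
  finally show ?thesis by simp
qed

text \<open>The working form of the conditional law: on the event that arm \<open>k\<close> is
  chosen, the next reward is independent of past weights. With \<open>H\<close> fixed, both sides
  are integrals of \<open>f\<close> against finite measures, which agree on Borel sets by
  \<open>integral_reward_indicator\<close>.\<close>

lemma nn_integral_reward:
  assumes t: "t < T" and k: "k \<in> {1..K}"
    and H: "H \<in> borel_measurable (F t)" "integrable M H" "\<And>\<omega>. H \<omega> \<ge> 0"
    and f[measurable]: "f \<in> borel_measurable borel"
  shows "(\<integral>\<^sup>+\<omega>. ennreal (H \<omega> * indicator (plays k t) \<omega>) * f (Y (Suc t) \<omega>) \<partial>M)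
    = (\<integral>\<^sup>+\<omega>. ennreal (H \<omega> * indicator (plays k t) \<omega>) \<partial>M) * (\<integral>\<^sup>+x. f x \<partial>\<nu> k)"
proof -
  interpret \<nu>: prob_space "\<nu> k" by (rule prob_space_arm[OF k])
  have [measurable_cong]: "sets (\<nu> k) = sets borel" by (rule sets_arm[OF k])
  have [measurable]: "H \<in> borel_measurable M" by (rule measurable_F[OF H(1)])
  have [measurable]: "plays k t \<in> sets M"
    by (rule plays_sets[OF t])
  have [measurable]: "Y (Suc t) \<in> borel_measurable M"
    by (rule reward_measurable_M[OF t])
  let ?h = "\<lambda>\<omega>. H \<omega> * indicator (plays k t) \<omega>"
  have h: "integrable M ?h"
    by (rule Bochner_Integration.integrable_bound[OF H(2)]) (auto intro!: AE_I2 simp: indicator_def)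
  have h_eq: "(\<integral>\<^sup>+\<omega>. ennreal (?h \<omega>) \<partial>M) = ennreal (\<integral>\<omega>. ?h \<omega> \<partial>M)"
    using H(3) by (intro nn_integral_eq_integral h) (auto simp: indicator_def)
  have "distr (density M (\<lambda>\<omega>. ennreal (?h \<omega>))) borel (Y (Suc t))
      = scale_measure (\<integral>\<^sup>+\<omega>. ennreal (?h \<omega>) \<partial>M) (\<nu> k)"
  proof (rule measure_eqI)
    fix B assume "B \<in> sets (distr (density M (\<lambda>\<omega>. ennreal (?h \<omega>))) borel (Y (Suc t)))"
    then have B[measurable]: "B \<in> sets borel" by simp
    have "emeasure (distr (density M (\<lambda>\<omega>. ennreal (?h \<omega>))) borel (Y (Suc t))) B
        = (\<integral>\<^sup>+\<omega>. ennreal (?h \<omega>) * indicator (Y (Suc t) -` B \<inter> space M) \<omega> \<partial>M)"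
      by (subst emeasure_distr) (auto simp: emeasure_density)
    also have "\<dots> = (\<integral>\<^sup>+\<omega>. ennreal (?h \<omega> * indicator B (Y (Suc t) \<omega>)) \<partial>M)"
      by (intro nn_integral_cong) (auto simp: indicator_def)
    also have "\<dots> = ennreal (\<integral>\<omega>. ?h \<omega> * indicator B (Y (Suc t) \<omega>) \<partial>M)"
    proof (rule nn_integral_eq_integral)
      show "integrable M (\<lambda>\<omega>. ?h \<omega> * indicator B (Y (Suc t) \<omega>))"
        by (rule Bochner_Integration.integrable_bound[OF H(2)]) (auto intro!: AE_I2 simp: indicator_def)
    qed (use H(3) in \<open>auto simp: indicator_def\<close>)
    also have "\<dots> = emeasure (scale_measure (\<integral>\<^sup>+\<omega>. ennreal (?h \<omega>) \<partial>M) (\<nu> k)) B"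
      unfolding integral_reward_indicator[OF t k B H(1,2)] emeasure_scale_measure h_eq
        \<nu>.emeasure_eq_measure
      by (subst mult.commute) (rule ennreal_mult''[OF measure_nonneg])
    finally show "emeasure (distr (density M (\<lambda>\<omega>. ennreal (?h \<omega>))) borel (Y (Suc t))) B
        = emeasure (scale_measure (\<integral>\<^sup>+\<omega>. ennreal (?h \<omega>) \<partial>M) (\<nu> k)) B" .
  qed (simp add: sets_arm[OF k])
  then have "(\<integral>\<^sup>+x. f x \<partial>distr (density M (\<lambda>\<omega>. ennreal (?h \<omega>))) borel (Y (Suc t)))
      = (\<integral>\<^sup>+x. f x \<partial>scale_measure (\<integral>\<^sup>+\<omega>. ennreal (?h \<omega>) \<partial>M) (\<nu> k))"
    by simp
  then show ?thesis
    by (simp add: nn_integral_distr nn_integral_density nn_integral_scale_measure)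
qed

lemma AE_reward_in:
  assumes C: "C \<in> sets borel" "\<And>k. k \<in> {1..K} \<Longrightarrow> AE x in \<nu> k. x \<in> C"
  shows "AE \<omega> in M. \<forall>t\<in>{1..T}. Y t \<omega> \<in> C"
proof -
  have "AE \<omega> in M. Y (Suc t) \<omega> \<in> C" if t: "t < T" for t
  proof -
    have [measurable]: "plays k t \<in> sets M" for k
      by (rule plays_sets[OF t])
    have [measurable]: "Y (Suc t) \<in> borel_measurable M" "C \<in> sets borel"
      by (rule reward_measurable_M[OF t], rule C(1))
    have "AE \<omega> in M. A (Suc t) \<omega> = k \<longrightarrow> Y (Suc t) \<omega> \<in> C" if k: "k \<in> {1..K}" for k
    proof -
      have [measurable_cong]: "sets (\<nu> k) = sets borel" by (rule sets_arm[OF k])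
      have "(\<integral>\<^sup>+x. indicator (- C) x \<partial>\<nu> k) = 0"
        using C(2)[OF k] by (subst nn_integral_0_iff_AE) (auto elim!: eventually_mono)
      then have "(\<integral>\<^sup>+\<omega>. ennreal (1 * indicator (plays k t) \<omega>) * indicator (- C) (Y (Suc t) \<omega>) \<partial>M) = 0"
        by (subst nn_integral_reward[OF t k]) (use C in auto)
      then have "AE \<omega> in M. ennreal (1 * indicator (plays k t) \<omega>) * indicator (- C) (Y (Suc t) \<omega>) = 0"
        by (subst (asm) nn_integral_0_iff_AE) auto
      moreover have "AE \<omega> in M. \<omega> \<in> space M" by simp
      ultimately show ?thesis
        by eventually_elim (auto simp: indicator_def split: if_splits)
    qed
    then have "AE \<omega> in M. \<forall>k\<in>{1..K}. A (Suc t) \<omega> = k \<longrightarrow> Y (Suc t) \<omega> \<in> C"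
      by (intro AE_finite_allI) auto
    moreover have "AE \<omega> in M. \<omega> \<in> space M" by simp
    ultimately show ?thesis
      by eventually_elim (use action_in[OF t] in blast)
  qed
  then have "AE \<omega> in M. \<forall>t\<in>{..<T}. Y (Suc t) \<omega> \<in> C"
    by (intro AE_finite_allI) auto
  then show ?thesis
  proof eventually_elim
    case (elim \<omega>)
    show ?case
    proof
      fix t assume "t \<in> {1..T}"
      then show "Y t \<omega> \<in> C" using elim by (cases t) auto
    qed
  qed
qed

lemma integral_reward:
  assumes t: "t < T" and \<mu>: "\<And>k. k \<in> {1..K} \<Longrightarrow> has_bochner_integral (\<nu> k) (\<lambda>x. x) (\<mu> k)"
  shows "integrable M (Y (Suc t))" "(\<integral>\<omega>. Y (Suc t) \<omega> \<partial>M) = (\<integral>\<omega>. \<mu> (A (Suc t) \<omega>) \<partial>M)"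
proof -
  have [measurable]: "plays k t \<in> sets M" for k
    by (rule plays_sets[OF t])
  have [measurable]: "Y (Suc t) \<in> borel_measurable M"
    by (rule reward_measurable_M[OF t])
  have arm: "has_bochner_integral M (\<lambda>\<omega>. indicator (plays k t) \<omega> * Y (Suc t) \<omega>)
      (\<mu> k * prob (plays k t))" if k: "k \<in> {1..K}" for k
  proof -
    let ?f = "\<lambda>\<omega>. indicator (plays k t) \<omega> * Y (Suc t) \<omega>"
    have [measurable_cong]: "sets (\<nu> k) = sets borel" by (rule sets_arm[OF k])
    have int: "integrable (\<nu> k) (\<lambda>x. x)" "(\<integral>x. x \<partial>\<nu> k) = \<mu> k"
      using \<mu>[OF k] by (auto simp: has_bochner_integral_iff)
    \<comment> \<open>\<open>g 0 = 0\<close> makes the integrand vanish off the event. The identity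
      is used for the absolute value and for the positive and negative parts.\<close>
    have eq: "(\<integral>\<^sup>+\<omega>. g (?f \<omega>) \<partial>M) = ennreal (prob (plays k t)) * (\<integral>\<^sup>+x. g x \<partial>\<nu> k)"
      if [measurable]: "g \<in> borel_measurable borel" and g0: "g 0 = 0" for g :: "real \<Rightarrow> ennreal"
    proof -
      have "(\<integral>\<^sup>+\<omega>. g (?f \<omega>) \<partial>M) = (\<integral>\<^sup>+\<omega>. ennreal (1 * indicator (plays k t) \<omega>) * g (Y (Suc t) \<omega>) \<partial>M)"
        by (intro nn_integral_cong) (auto simp: indicator_def g0)
      also have "\<dots> = (\<integral>\<^sup>+\<omega>. ennreal (1 * indicator (plays k t) \<omega>) \<partial>M) * (\<integral>\<^sup>+x. g x \<partial>\<nu> k)"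
        by (rule nn_integral_reward[OF t k]) auto
      also have "(\<integral>\<^sup>+\<omega>. ennreal (1 * indicator (plays k t) \<omega>) \<partial>M) = ennreal (prob (plays k t))"
        by (simp add: ennreal_indicator emeasure_eq_measure)
      finally show ?thesis .
    qed
    have "(\<integral>\<^sup>+x. ennreal (norm x) \<partial>\<nu> k) < \<infinity>"
      using int(1) by (simp add: integrable_iff_bounded)
    then have "(\<integral>\<^sup>+\<omega>. ennreal (norm (?f \<omega>)) \<partial>M) < \<infinity>"
      by (subst eq[of "\<lambda>x. ennreal (norm x)"]) (auto simp: ennreal_mult_less_top)
    then have i: "integrable M ?f" by (auto simp: integrable_iff_bounded)
    have "(\<integral>\<omega>. ?f \<omega> \<partial>M) = \<mu> k * prob (plays k t)"
      unfolding real_lebesgue_integral_def[OF i] int(2)[symmetric] real_lebesgue_integral_def[OF int(1)]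
      by (subst eq[of "\<lambda>x. ennreal x"], simp, simp, subst eq[of "\<lambda>x. ennreal (- x)"])
        (auto simp: enn2real_mult algebra_simps)
    then show ?thesis using i by (simp add: has_bochner_integral_iff)
  qed
  have part: "(\<Sum>k\<in>{1..K}. indicator (plays k t) \<omega> * g k) = g (A (Suc t) \<omega>)"
    if "\<omega> \<in> space M" for g :: "nat \<Rightarrow> real" and \<omega>
  proof -
    have "(\<Sum>k\<in>{1..K}. indicator (plays k t) \<omega> * g k) = (\<Sum>k\<in>{1..K}. if A (Suc t) \<omega> = k then g k else 0)"
      using that by (intro sum.cong) (auto simp: indicator_def)
    then show ?thesis using action_in[OF t that] by simp
  qed
  have part1: "(\<Sum>k\<in>{1..K}. indicator (plays k t) \<omega> * Y (Suc t) \<omega>) = Y (Suc t) \<omega>"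
    if "\<omega> \<in> space M" for \<omega>
    using part[OF that, of "\<lambda>_. Y (Suc t) \<omega>"] .
  have "has_bochner_integral M (\<lambda>\<omega>. \<Sum>k\<in>{1..K}. indicator (plays k t) \<omega> * Y (Suc t) \<omega>)
      (\<Sum>k\<in>{1..K}. \<mu> k * prob (plays k t))"
    using arm by (intro has_bochner_integral_sum) auto
  then have "has_bochner_integral M (Y (Suc t)) (\<Sum>k\<in>{1..K}. \<mu> k * prob (plays k t))"
    by (simp only: has_bochner_integral_cong[OF refl part1 refl])
  moreover have "has_bochner_integral M (\<lambda>\<omega>. \<Sum>k\<in>{1..K}. indicator (plays k t) \<omega> * \<mu> k)
      (\<Sum>k\<in>{1..K}. prob (plays k t) * \<mu> k)"
    by (intro has_bochner_integral_sum has_bochner_integral_mult_left has_bochner_integral_real_indicator)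
      (auto simp: less_top[symmetric])
  then have "has_bochner_integral M (\<lambda>\<omega>. \<mu> (A (Suc t) \<omega>)) (\<Sum>k\<in>{1..K}. prob (plays k t) * \<mu> k)"
    by (simp only: has_bochner_integral_cong[OF refl part refl])
  ultimately show "integrable M (Y (Suc t))" "(\<integral>\<omega>. Y (Suc t) \<omega> \<partial>M) = (\<integral>\<omega>. \<mu> (A (Suc t) \<omega>) \<partial>M)"
    by (auto simp: has_bochner_integral_iff mult.commute)
qed

text \<open>Wald's exponential martingale of arm \<open>k\<close>, once \<open>\<psi>\<close> is the
  logarithm of its moment generating function at \<open>l\<close>; it moves only when arm
  \<open>k\<close> is pulled.\<close>

definition exp_mart :: "nat \<Rightarrow> real \<Rightarrow> real \<Rightarrow> nat \<Rightarrow> 'a \<Rightarrow> real" where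
  "exp_mart k l \<psi> t \<omega> = exp (l * reward_sum k t \<omega> - \<psi> * real (num_pulls k t \<omega>))"

lemma exp_mart_measurable: "t \<le> T \<Longrightarrow> exp_mart k l \<psi> t \<in> borel_measurable (F t)"
proof -
  assume t: "t \<le> T"
  have [measurable]: "reward_sum k t \<in> borel_measurable (F t)"
    "num_pulls k t \<in> measurable (F t) (count_space UNIV)"
    using reward_sum_measurable num_pulls_measurable t by auto
  show ?thesis unfolding exp_mart_def[abs_def] by measurable
qed

lemma exp_mart_measurable_M: "t \<le> T \<Longrightarrow> exp_mart k l \<psi> t \<in> borel_measurable M"
  by (rule measurable_F[OF exp_mart_measurable])

section \<open>Optional stopping and the maximal inequality\<close>

context
  fixes k :: nat and l \<psi> :: real
  assumes k: "k \<in> {1..K}" and mgf: "(\<integral>\<^sup>+x. ennreal (exp (l * x)) \<partial>\<nu> k) = ennreal (exp \<psi>)"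
begin

abbreviation "Z \<equiv> exp_mart k l \<psi>"

text \<open>The martingale property, tested on an event of the past. Off \<open>plays k t\<close>
  the process stands still; on it the process is multiplied by a factor of conditional mean
  1.\<close>

lemma nn_integral_exp_mart_step:
  assumes t: "t < T" and Z: "integrable M (Z t)" and G: "G \<in> sets (F t)"
  shows "(\<integral>\<^sup>+\<omega>. ennreal (Z (Suc t) \<omega>) * indicator G \<omega> \<partial>M) = (\<integral>\<^sup>+\<omega>. ennreal (Z t \<omega>) * indicator G \<omega> \<partial>M)"
proof -
  have G'[measurable]: "G \<in> sets (F t)" "G \<in> sets M"
    by (rule G, rule sets_F[OF G])
  have ZF[measurable]: "Z t \<in> borel_measurable (F t)" "Z t \<in> borel_measurable M"
    "Z (Suc t) \<in> borel_measurable M"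
    using t by (auto intro!: exp_mart_measurable exp_mart_measurable_M)
  have P[measurable]: "plays k t \<in> sets M"
    by (rule plays_sets[OF t])
  have [measurable]: "Y (Suc t) \<in> borel_measurable M"
    by (rule reward_measurable_M[OF t])
  let ?H = "\<lambda>\<omega>. Z t \<omega> * indicator G \<omega>"
  have H1: "?H \<in> borel_measurable (F t)" by measurable
  have H2: "integrable M ?H" by (rule integrable_real_mult_indicator[OF G'(2) Z])
  have H3: "?H \<omega> \<ge> 0" for \<omega> by (simp add: exp_mart_def)
  note H = H1 H2 H3
  have "(\<integral>\<^sup>+\<omega>. ennreal (Z (Suc t) \<omega>) * indicator G \<omega> \<partial>M)
      = (\<integral>\<^sup>+\<omega>. ennreal (?H \<omega>) * indicator (- plays k t) \<omega>
          + ennreal (?H \<omega> * indicator (plays k t) \<omega>) * ennreal (exp (l * Y (Suc t) \<omega> - \<psi>)) \<partial>M)"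
    by (intro nn_integral_cong)
      (auto simp: indicator_def exp_mart_def num_pulls_Suc reward_sum_Suc ennreal_mult[symmetric]
        exp_add[symmetric] algebra_simps)
  also have "\<dots> = (\<integral>\<^sup>+\<omega>. ennreal (?H \<omega>) * indicator (- plays k t) \<omega> \<partial>M)
      + (\<integral>\<^sup>+\<omega>. ennreal (?H \<omega> * indicator (plays k t) \<omega>) * ennreal (exp (l * Y (Suc t) \<omega> - \<psi>)) \<partial>M)"
    by (intro nn_integral_add) measurable
  also have "(\<integral>\<^sup>+\<omega>. ennreal (?H \<omega> * indicator (plays k t) \<omega>) * ennreal (exp (l * Y (Suc t) \<omega> - \<psi>)) \<partial>M)
      = (\<integral>\<^sup>+\<omega>. ennreal (?H \<omega> * indicator (plays k t) \<omega>) \<partial>M) * (\<integral>\<^sup>+x. ennreal (exp (l * x - \<psi>)) \<partial>\<nu> k)"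
    by (rule nn_integral_reward[OF t k H]) measurable
  also have "(\<integral>\<^sup>+x. ennreal (exp (l * x - \<psi>)) \<partial>\<nu> k) = 1"
  proof -
    have [measurable_cong]: "sets (\<nu> k) = sets borel" by (rule sets_arm[OF k])
    have "(\<integral>\<^sup>+x. ennreal (exp (l * x - \<psi>)) \<partial>\<nu> k)
        = (\<integral>\<^sup>+x. ennreal (exp (- \<psi>)) * ennreal (exp (l * x)) \<partial>\<nu> k)"
      by (intro nn_integral_cong) (simp add: ennreal_mult[symmetric] exp_add[symmetric])
    also have "\<dots> = ennreal (exp (- \<psi>)) * ennreal (exp \<psi>)"
      unfolding mgf[symmetric] by (rule nn_integral_cmult) measurable
    finally show ?thesis by (simp add: ennreal_mult[symmetric] exp_add[symmetric])
  qed
  also have "(\<integral>\<^sup>+\<omega>. ennreal (?H \<omega>) * indicator (- plays k t) \<omega> \<partial>M)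
      + (\<integral>\<^sup>+\<omega>. ennreal (?H \<omega> * indicator (plays k t) \<omega>) \<partial>M) * 1
      = (\<integral>\<^sup>+\<omega>. ennreal (?H \<omega>) * indicator (- plays k t) \<omega> + ennreal (?H \<omega> * indicator (plays k t) \<omega>) \<partial>M)"
    unfolding mult_1_right by (rule nn_integral_add[symmetric]) measurable
  also have "\<dots> = (\<integral>\<^sup>+\<omega>. ennreal (Z t \<omega>) * indicator G \<omega> \<partial>M)"
    by (intro nn_integral_cong) (auto simp: indicator_def)
  finally show ?thesis .
qed

lemma nn_integral_exp_mart: "t \<le> T \<Longrightarrow> (\<integral>\<^sup>+\<omega>. ennreal (Z t \<omega>) \<partial>M) = 1"
proof (induction t)
  case 0
  then show ?case by (simp add: exp_mart_def emeasure_space_1)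
next
  case (Suc t)
  have "integrable M (Z t)"
    using Suc exp_mart_measurable_M[of t]
    by (intro integrableI_nonneg) (auto simp: exp_mart_def)
  then have "(\<integral>\<^sup>+\<omega>. ennreal (Z (Suc t) \<omega>) * indicator (space M) \<omega> \<partial>M)
      = (\<integral>\<^sup>+\<omega>. ennreal (Z t \<omega>) * indicator (space M) \<omega> \<partial>M)"
    using Suc sets.top[of "F t"] by (intro nn_integral_exp_mart_step) (auto simp: space_F)
  then show ?case using Suc by (simp cong: nn_integral_cong)
qed

lemma integrable_exp_mart: "t \<le> T \<Longrightarrow> integrable M (Z t)"
  using nn_integral_exp_mart[of t] exp_mart_measurable_M[of t]
  by (intro integrableI_nonneg) (auto simp: exp_mart_def)

text \<open>Optional stopping: disjoint events \<open>G t\<close> encode the stopping time which is \<open>t\<close> on \<open>G t\<close>.\<close>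

lemma exp_mart_optional_stopping:
  assumes G: "\<And>t. t < n \<Longrightarrow> G t \<in> sets (F t)" and disj: "disjoint_family_on G {..<n}" and n: "n \<le> Suc T"
  shows "(\<Sum>t<n. \<integral>\<^sup>+\<omega>. ennreal (Z t \<omega>) * indicator (G t) \<omega> \<partial>M) \<le> 1"
proof -
  let ?I = "\<lambda>t G. \<integral>\<^sup>+\<omega>. ennreal (Z t \<omega>) * indicator G \<omega> \<partial>M"
  \<comment> \<open>\<open>R t\<close> is the event of not having stopped before \<open>t\<close>.
    The mass on it splits into the part stopped at \<open>t\<close> and the part on
    \<open>R (Suc t)\<close>, which a martingale step preserves; hence stopped mass plus remaining
    mass never exceeds 1.\<close>
  define R where "R t = space M - (\<Union>s<t. G s)" for t
  have GM: "G t \<in> sets M" if "t < n" for t using G[OF that] sets_F by blast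
  have split: "?I t (R t) = ?I t (G t) + ?I t (R (Suc t))" if t: "t < n" for t
  proof -
    have [measurable]: "Z t \<in> borel_measurable M" "G t \<in> sets M" "R (Suc t) \<in> sets M"
        using exp_mart_measurable_M[of t] t n GM by (auto simp: R_def intro!: sets.Diff sets.finite_UN)
    have "G t \<subseteq> space M" using GM[OF t] sets.sets_into_space by blast
    moreover have "G s \<inter> G t = {}" if "s < t" for s
      using disj t that by (auto simp: disjoint_family_on_def)
    ultimately have "R t = G t \<union> R (Suc t)" "G t \<inter> R (Suc t) = {}"
      by (auto simp: R_def less_Suc_eq)
    then have "?I t (R t) = (\<integral>\<^sup>+\<omega>. ennreal (Z t \<omega>) * indicator (G t) \<omega> + ennreal (Z t \<omega>) * indicator (R (Suc t)) \<omega> \<partial>M)"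
      by (intro nn_integral_cong) (auto simp: indicator_def)
    also have "\<dots> = ?I t (G t) + ?I t (R (Suc t))" by (intro nn_integral_add) measurable
    finally show ?thesis .
  qed
  have step: "?I (Suc t) (R (Suc t)) = ?I t (R (Suc t))" if t: "Suc t < n" for t
  proof (rule nn_integral_exp_mart_step)
    show "t < T" using t n by simp
    then show "integrable M (Z t)" by (intro integrable_exp_mart) simp
    have "G s \<in> sets (F t)" if "s < Suc t" for s
      using G[of s] sets_F_mono[of s t] that t by auto
    then show "R (Suc t) \<in> sets (F t)"
      unfolding R_def space_F[of t, symmetric] by (intro sets.Diff sets.finite_UN) auto
  qed
  have "j < n \<Longrightarrow> (\<Sum>t<j. ?I t (G t)) + ?I j (R j) \<le> 1" for j
  proof (induction j)
    case 0
    then show ?case by (simp add: R_def exp_mart_def emeasure_space_1)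
  next
    case (Suc j)
    have eq: "(\<Sum>t<Suc j. ?I t (G t)) + ?I (Suc j) (R (Suc j)) = (\<Sum>t<j. ?I t (G t)) + ?I j (R j)"
      using split[of j] step[of j] Suc.prems
      by (simp only: sum.lessThan_Suc add.assoc Suc_lessD)
    show ?case unfolding eq using Suc by (intro Suc.IH) simp
  qed
  then show ?thesis
  proof (cases n)
    case (Suc j)
    have "(\<Sum>t<n. ?I t (G t)) \<le> (\<Sum>t<j. ?I t (G t)) + ?I j (R j)"
      using split[of j] Suc by (simp add: add_left_mono)
    also have "\<dots> \<le> 1" using \<open>\<And>j. j < n \<Longrightarrow> (\<Sum>t<j. ?I t (G t)) + ?I j (R j) \<le> 1\<close> Suc by simp
    finally show ?thesis .
  qed simp
qed

text \<open>Ville's inequality: stop at the first passage above \<open>c\<close>, where the process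
  is at least \<open>c\<close>.\<close>

lemma exp_mart_maximal:
  assumes "c > 0"
  shows "{\<omega> \<in> space M. \<exists>t\<le>T. c \<le> Z t \<omega>} \<in> sets M"
    and "prob {\<omega> \<in> space M. \<exists>t\<le>T. c \<le> Z t \<omega>} \<le> 1 / c"
proof -
  define G where "G t = {\<omega> \<in> space M. c \<le> Z t \<omega> \<and> (\<forall>s<t. Z s \<omega> < c)}" for t
  have GF: "G t \<in> sets (F t)" if "t < Suc T" for t
  proof -
    have ZF: "Z s \<in> borel_measurable (F t)" if "s \<le> t" for s
      using that \<open>t < Suc T\<close> by (intro measurable_F_mono[of _ s _ t] exp_mart_measurable) auto
    have "{\<omega> \<in> space (F t). Z s \<omega> < c} \<in> sets (F t)" if "s \<le> t" for s
      using borel_measurable_less[OF ZF[OF that] borel_measurable_const] .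
    moreover have "{\<omega> \<in> space (F t). c \<le> Z t \<omega>} \<in> sets (F t)"
      using borel_measurable_le[OF borel_measurable_const ZF[OF order_refl]] .
    ultimately have "{\<omega> \<in> space (F t). c \<le> Z t \<omega> \<and> (\<forall>s\<in>{..<t}. Z s \<omega> < c)} \<in> sets (F t)"
      by (intro sets.sets_Collect_conj sets.sets_Collect_finite_All) auto
    then show ?thesis by (simp add: G_def space_F Ball_def)
  qed
  have GM: "G t \<in> sets M" if "t < Suc T" for t using GF[OF that] sets_F by blast
  have disj: "disjoint_family_on G {..<Suc T}"
    unfolding disjoint_family_on_def
  proof (intro ballI impI)
    fix s t :: nat assume "s \<noteq> t"
    then have "s < t \<or> t < s" by auto
    then show "G s \<inter> G t = {}" by (fastforce simp: G_def)
  qed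
  have eq: "{\<omega> \<in> space M. \<exists>t\<le>T. c \<le> Z t \<omega>} = (\<Union>t<Suc T. G t)"
  proof (intro equalityI subsetI)
    fix \<omega> assume "\<omega> \<in> {\<omega> \<in> space M. \<exists>t\<le>T. c \<le> Z t \<omega>}"
    then obtain t where t: "\<omega> \<in> space M" "t \<le> T" "c \<le> Z t \<omega>" by blast
    define s where "s = (LEAST s. c \<le> Z s \<omega>)"
    have "c \<le> Z s \<omega>" "s \<le> t" "\<forall>r<s. Z r \<omega> < c"
      unfolding s_def using t by (auto intro: LeastI Least_le dest: not_less_Least simp: not_le[symmetric])
    then show "\<omega> \<in> (\<Union>t<Suc T. G t)" using t by (auto simp: G_def intro!: bexI[of _ s])
  qed (auto simp: G_def less_Suc_eq_le)
  show sets: "{\<omega> \<in> space M. \<exists>t\<le>T. c \<le> Z t \<omega>} \<in> sets M"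
    unfolding eq using GM by (intro sets.finite_UN) auto
  have "ennreal c * emeasure M (\<Union>t<Suc T. G t) = ennreal c * (\<Sum>t<Suc T. emeasure M (G t))"
    using GM by (subst sum_emeasure[OF _ disj]) auto
  also have "\<dots> = (\<Sum>t<Suc T. ennreal c * emeasure M (G t))" by (rule sum_distrib_left)
  also have "\<dots> \<le> (\<Sum>t<Suc T. \<integral>\<^sup>+\<omega>. ennreal (Z t \<omega>) * indicator (G t) \<omega> \<partial>M)"
  proof (intro sum_mono)
    fix t assume "t \<in> {..<Suc T}"
    then have "ennreal c * emeasure M (G t) = (\<integral>\<^sup>+\<omega>. ennreal c * indicator (G t) \<omega> \<partial>M)"
      using GM by (intro nn_integral_cmult_indicator[symmetric]) auto
    also have "\<dots> \<le> (\<integral>\<^sup>+\<omega>. ennreal (Z t \<omega>) * indicator (G t) \<omega> \<partial>M)"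
      by (intro nn_integral_mono) (auto simp: indicator_def G_def intro: ennreal_leI)
    finally show "ennreal c * emeasure M (G t) \<le> (\<integral>\<^sup>+\<omega>. ennreal (Z t \<omega>) * indicator (G t) \<omega> \<partial>M)" .
  qed
  also have "\<dots> \<le> 1" by (rule exp_mart_optional_stopping[OF GF disj]) auto
  finally have "ennreal (c * prob (\<Union>t<Suc T. G t)) \<le> 1"
    using assms by (simp add: emeasure_eq_measure ennreal_mult)
  then have "c * prob (\<Union>t<Suc T. G t) \<le> 1" by (simp add: ennreal_le_1)
  then show "prob {\<omega> \<in> space M. \<exists>t\<le>T. c \<le> Z t \<omega>} \<le> 1 / c"
    unfolding eq using assms by (simp add: field_simps)
qed

text \<open>The stopping time is the last instant before pull number \<open>n + 1\<close> of arm
  \<open>k\<close>. The events for different \<open>t\<close> are disjoint because every pull raises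
  the count, so the sum over all rounds costs no more than one.\<close>

lemma exp_mart_nth_pull:
  "(\<Sum>t<T. \<integral>\<^sup>+\<omega>. ennreal (Z t \<omega>) * indicator {\<omega> \<in> space M. A (Suc t) \<omega> = k \<and> num_pulls k t \<omega> = n} \<omega> \<partial>M) \<le> 1"
proof (rule exp_mart_optional_stopping)
  fix t assume t: "t < T"
  have [measurable]: "A (Suc t) \<in> measurable (F t) (count_space UNIV)"
    "num_pulls k t \<in> measurable (F t) (count_space UNIV)"
    using t by (auto intro!: action_measurable_nat num_pulls_measurable)
  show "{\<omega> \<in> space M. A (Suc t) \<omega> = k \<and> num_pulls k t \<omega> = n} \<in> sets (F t)"
    unfolding space_F[of t, symmetric] by measurable
next
  show "disjoint_family_on (\<lambda>t. {\<omega> \<in> space M. A (Suc t) \<omega> = k \<and> num_pulls k t \<omega> = n}) {..<T}"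
    unfolding disjoint_family_on_def
  proof (intro ballI impI)
    fix s t :: nat assume "s \<noteq> t"
    then have "s < t \<or> t < s" by auto
    then show "{\<omega> \<in> space M. A (Suc s) \<omega> = k \<and> num_pulls k s \<omega> = n}
        \<inter> {\<omega> \<in> space M. A (Suc t) \<omega> = k \<and> num_pulls k t \<omega> = n} = {}"
      using num_pulls_less[of s t _ k] num_pulls_less[of t s _ k] by fastforce
  qed
qed simp

end

end

section \<open>Sums and the exploration function\<close>

lemma sum_powers_exp_le:
  fixes c :: real
  assumes "c > 0"
  shows "(\<Sum>k=1..n. exp (- (c * real k))) \<le> 1 / c"
proof -
  define q where "q = exp (- c)"
  have q: "0 < q" "q < 1" using assms by (auto simp: q_def)
  have "(\<Sum>k=1..n. exp (- (c * real k))) = (\<Sum>k=1..n. q ^ k)"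
    by (simp add: q_def exp_of_nat_mult[symmetric] mult.commute)
  also have "\<dots> = q * (\<Sum>k<n. q ^ k)"
    by (simp add: sum_distrib_left sum.atLeast1_atMost_eq)
  also have "\<dots> = q * (1 - q ^ n) / (1 - q)"
    using q by (simp add: sum_gp_strict)
  also have "\<dots> \<le> q / (1 - q)"
    using q by (intro divide_right_mono) (auto simp: mult_left_le)
  also have "\<dots> = 1 / (exp c - 1)"
    using q assms by (simp add: q_def exp_minus field_simps)
  also have "\<dots> \<le> 1 / c"
  proof -
    have "c \<le> exp c - 1" using exp_ge_add_one_self[of c] by linarith
    then show ?thesis using assms by (intro divide_left_mono) (auto intro!: mult_pos_pos)
  qed
  finally show ?thesis .
qed

text \<open>Completing the square with \<open>(sqrt a * k - 1 / 2)\<^sup>2 \<ge> 0\<close> replaces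
  the Gaussian by a geometric term at the cost of \<open>exp (1 / 4) \<le> sqrt 2\<close>.\<close>

lemma sum_gaussian_le:
  fixes a :: real
  assumes "a > 0"
  shows "(\<Sum>k=1..n. exp (- (a * (real k)\<^sup>2))) \<le> sqrt (2 / a)"
proof -
  have "exp (- (a * (real k)\<^sup>2)) \<le> sqrt 2 * exp (- (sqrt a * real k))" for k
  proof -
    have "(exp (1 / 4 :: real))\<^sup>2 = exp (1 / 2)" by (simp flip: exp_double)
    moreover have "(exp (1 / 2 :: real))\<^sup>2 \<le> 2\<^sup>2"
      using exp_le by (simp flip: exp_double)
    then have "exp (1 / 2 :: real) \<le> 2" by (rule power2_le_imp_le) simp
    ultimately have e: "exp (1 / 4 :: real) \<le> sqrt 2" by (intro real_le_rsqrt) simp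
    have "0 \<le> (sqrt a * real k - 1 / 2)\<^sup>2" by simp
    then have "- (a * (real k)\<^sup>2) \<le> 1 / 4 + (- (sqrt a * real k))"
      using assms by (simp add: power2_diff power_mult_distrib power_divide)
    then have "exp (- (a * (real k)\<^sup>2)) \<le> exp (1 / 4) * exp (- (sqrt a * real k))"
      by (simp flip: exp_add)
    also have "\<dots> \<le> sqrt 2 * exp (- (sqrt a * real k))"
      using e by (intro mult_right_mono) auto
    finally show ?thesis .
  qed
  then have "(\<Sum>k=1..n. exp (- (a * (real k)\<^sup>2))) \<le> (\<Sum>k=1..n. sqrt 2 * exp (- (sqrt a * real k)))"
    by (intro sum_mono) auto
  also have "\<dots> = sqrt 2 * (\<Sum>k=1..n. exp (- (sqrt a * real k)))" by (simp add: sum_distrib_left)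
  also have "\<dots> \<le> sqrt 2 * (1 / sqrt a)"
    using assms by (intro mult_left_mono sum_powers_exp_le) auto
  finally show ?thesis by (simp add: real_sqrt_divide)
qed

lemma sum_inverse_sqrt_le: "(\<Sum>n=1..N. 1 / sqrt (real n)) \<le> 2 * sqrt (real N)"
proof (induction N)
  case (Suc N)
  have "1 = (sqrt (real (Suc N)) - sqrt (real N)) * (sqrt (real (Suc N)) + sqrt (real N))"
    by (simp add: algebra_simps flip: power2_eq_square)
  also have "\<dots> \<le> (sqrt (real (Suc N)) - sqrt (real N)) * (2 * sqrt (real (Suc N)))"
    by (intro mult_left_mono) auto
  finally have "1 / sqrt (real (Suc N)) \<le> 2 * (sqrt (real (Suc N)) - sqrt (real N))"
    by (simp add: field_simps)
  then show ?case using Suc by simp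
qed simp

text \<open>Telescoping of fourth roots. The exponent 3/4 is that of \<open>sqrt (g(n) / n)\<close>
  after \<open>g(n)\<close> has been bounded by a multiple of \<open>n\<close> to the power
  -1/2.\<close>

lemma sum_inverse_three_quarters_le:
  "(\<Sum>n=1..N. 1 / (sqrt (sqrt (real n))) ^ 3) \<le> 4 * sqrt (sqrt (real N))"
proof (induction N)
  case (Suc N)
  define x y where "x = sqrt (sqrt (real (Suc N)))" and "y = sqrt (sqrt (real N))"
  have xy: "0 \<le> y" "y \<le> x" "0 < x" by (auto simp: x_def y_def)
  have p4: "sqrt (sqrt (real M)) ^ 4 = real M" for M
  proof -
    have "sqrt (sqrt (real M)) ^ (2 * 2) = ((sqrt (sqrt (real M)))\<^sup>2)\<^sup>2" by (rule power_mult)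
    then show ?thesis by simp
  qed
  have "1 = x ^ 4 - y ^ 4" unfolding x_def y_def p4 by simp
  also have "\<dots> = (x - y) * (x ^ 3 + x\<^sup>2 * y + x * y\<^sup>2 + y ^ 3)"
    by (simp add: algebra_simps power2_eq_square power3_eq_cube power4_eq_xxxx)
  also have "\<dots> \<le> (x - y) * (x ^ 3 + x\<^sup>2 * x + x * x\<^sup>2 + x ^ 3)"
    using xy by (intro mult_left_mono add_mono mult_mono power_mono) auto
  also have "\<dots> = (x - y) * (4 * x ^ 3)" by (simp add: power2_eq_square power3_eq_cube)
  finally have "1 / x ^ 3 \<le> 4 * (x - y)" using xy by (simp add: field_simps)
  then show ?case using Suc by (simp add: x_def y_def)
qed simp

text \<open>Split at \<open>L\<close>: up to \<open>L\<close> the exponential is dropped, beyond it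
  \<open>1 / sqrt n\<close> is at most \<open>1 / sqrt L\<close> and a geometric series remains.
  Each half gives \<open>2 * sqrt L\<close>.\<close>

lemma sum_inverse_sqrt_exp_le:
  fixes L :: real
  assumes L: "L > 0"
  shows "(\<Sum>n=1..N. 1 / sqrt (real n) * exp (- (real n / (2 * L)))) \<le> 4 * sqrt L"
proof -
  let ?P = "min N (nat \<lfloor>L\<rfloor>)"
  have le: "1 / sqrt (real n) * exp (- (real n / (2 * L)))
    \<le> (if n \<le> ?P then 1 / sqrt (real n) else 0) + 1 / sqrt L * exp (- (1 / (2 * L) * real n))"
    if n: "n \<in> {1..N}" for n
  proof (cases "real n \<le> L")
    case True
    then have "n \<le> ?P" using n by (auto simp: le_nat_floor)
    moreover have "1 / sqrt (real n) * exp (- (real n / (2 * L))) \<le> 1 / sqrt (real n) * 1"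
      using L by (intro mult_left_mono) auto
    ultimately show ?thesis using L by (simp add: add_increasing2)
  next
    case False
    then have "1 / sqrt (real n) \<le> 1 / sqrt L"
      using L n by (intro divide_left_mono) auto
    moreover have "exp (- (1 / (2 * L) * real n)) = exp (- (real n / (2 * L)))" by simp
    ultimately have "1 / sqrt (real n) * exp (- (real n / (2 * L))) \<le> 1 / sqrt L * exp (- (1 / (2 * L) * real n))"
      by (simp only: mult_right_mono exp_ge_zero)
    then show ?thesis by (simp add: add_increasing)
  qed
  have "(\<Sum>n=1..N. 1 / sqrt (real n) * exp (- (real n / (2 * L))))
    \<le> (\<Sum>n=1..N. if n \<le> ?P then 1 / sqrt (real n) else 0)
      + (\<Sum>n=1..N. 1 / sqrt L * exp (- (1 / (2 * L) * real n)))"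
    unfolding sum.distrib[symmetric] by (intro sum_mono le)
  also have "(\<Sum>n=1..N. if n \<le> ?P then 1 / sqrt (real n) else 0) = (\<Sum>n=1..?P. 1 / sqrt (real n))"
    by (intro sum.mono_neutral_cong_right) auto
  also have "(\<Sum>n=1..N. 1 / sqrt L * exp (- (1 / (2 * L) * real n)))
      = 1 / sqrt L * (\<Sum>n=1..N. exp (- (1 / (2 * L) * real n)))"
    by (simp add: sum_distrib_left)
  finally have "(\<Sum>n=1..N. 1 / sqrt (real n) * exp (- (real n / (2 * L))))
    \<le> (\<Sum>n=1..?P. 1 / sqrt (real n)) + 1 / sqrt L * (\<Sum>n=1..N. exp (- (1 / (2 * L) * real n)))" .
  moreover have "1 / sqrt L * (\<Sum>n=1..N. exp (- (1 / (2 * L) * real n))) \<le> 1 / sqrt L * (1 / (1 / (2 * L)))"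
    using L by (intro mult_left_mono sum_powers_exp_le) auto
  moreover have "1 / sqrt L * (1 / (1 / (2 * L))) = 2 * sqrt L"
    using L by (simp add: divide_eq_eq)
  moreover have "real ?P \<le> L"
    by (rule order_trans[OF _ of_nat_floor[OF less_imp_le[OF L]]]) simp
  then have "sqrt (real ?P) \<le> sqrt L" by (rule real_sqrt_le_mono)
  moreover have "(\<Sum>n=1..?P. 1 / sqrt (real n)) \<le> 2 * sqrt (real ?P)" by (rule sum_inverse_sqrt_le)
  ultimately show ?thesis by linarith
qed

section \<open>Bounds for the exploration function\<close>

lemma exploration_ge_ln:
  assumes "K \<ge> 1" "n \<ge> 1" "real K * real n \<le> real T"
  shows "ln (real T / (real K * real n)) \<le> exploration K T n"
proof -
  let ?x = "real T / (real K * real n)"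
  have x: "?x \<ge> 1" using assms by (simp add: field_simps)
  then have "?x * 1 \<le> ?x * ((log_plus ?x)\<^sup>2 + 1)" by (intro mult_left_mono) auto
  then have "ln ?x \<le> ln (?x * ((log_plus ?x)\<^sup>2 + 1))" using x by simp
  also have "\<dots> \<le> exploration K T n" by (simp add: exploration_def log_plus_def Let_def)
  finally show ?thesis .
qed

lemma exploration_eq_0:
  assumes "K \<ge> 1" "n \<ge> 1" "real T \<le> real K * real n"
  shows "exploration K T n = 0"
proof -
  let ?x = "real T / (real K * real n)"
  have x: "0 \<le> ?x" "?x \<le> 1" using assms by (simp_all add: field_simps)
  then have "ln ?x \<le> 0" by (cases "?x = 0") auto
  then have "log_plus ?x = 0" by (simp add: log_plus_def)
  then have "exploration K T n = log_plus ?x" by (simp add: exploration_def Let_def)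
  then show ?thesis using \<open>log_plus ?x = 0\<close> by simp
qed

text \<open>With \<open>s = ln x\<close> for the ratio \<open>x\<close>,
  \<open>s\<^sup>2 + 1 \<le> (1 + s)\<^sup>2\<close> gives a bound of \<open>3 * s\<close>, and
  \<open>s\<close> is at most \<open>2 * sqrt x\<close>. Any power of \<open>x\<close> with exponent
  below 1 would preserve the order of the sum of the bonuses.\<close>

lemma exploration_le_sqrt:
  assumes "K \<ge> 1" "n \<ge> 1" "real K * real n \<le> real T"
  shows "exploration K T n \<le> 6 * sqrt (real T / (real K * real n))"
proof -
  let ?x = "real T / (real K * real n)"
  have x: "?x \<ge> 1" using assms by (simp add: field_simps)
  define s where "s = ln ?x"
  have s: "s \<ge> 0" using x by (simp add: s_def)
  have lp: "log_plus ?x = s" using s by (simp add: log_plus_def s_def)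
  have "ln (?x * (s\<^sup>2 + 1)) = s + ln (s\<^sup>2 + 1)"
    using x by (subst ln_mult_pos) (auto simp: s_def add_nonneg_pos)
  also have "s\<^sup>2 + 1 \<le> (1 + s)\<^sup>2" using s by (simp add: power2_sum)
  then have "ln (s\<^sup>2 + 1) \<le> ln ((1 + s)\<^sup>2)"
    using s by (intro ln_le_cancel_iff[THEN iffD2]) (auto simp: add_nonneg_pos)
  also have "\<dots> = 2 * ln (1 + s)" using s by (simp add: ln_realpow)
  also have "\<dots> \<le> 2 * s" using ln_add_one_self_le_self[OF s] by simp
  finally have "ln (?x * (s\<^sup>2 + 1)) \<le> 3 * s" by simp
  moreover have "exploration K T n = max (ln (?x * (s\<^sup>2 + 1))) 0"
    unfolding exploration_def Let_def lp log_plus_def[of "?x * (s\<^sup>2 + 1)"] ..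
  ultimately have "exploration K T n \<le> 3 * s" using s by simp
  also have "s = 2 * ln (sqrt ?x)" using x by (simp add: s_def ln_sqrt)
  also have "ln (sqrt ?x) \<le> sqrt ?x" using ln_bound[of "sqrt ?x"] x by simp
  finally show ?thesis by simp
qed

text \<open>The bonus vanishes once \<open>n\<close> reaches \<open>T / K\<close>. Up to there, two
  fourth roots of \<open>T / K\<close>, one from the summand and one from the sum, combine into a
  square root; 14 is \<open>4 * sqrt 12\<close> rounded up.\<close>

lemma sum_exploration_le:
  fixes V :: real
  assumes V: "V > 0" and K: "K \<ge> 1"
  shows "(\<Sum>n=1..N. sqrt (2 * V * (exploration K T n / real n))) \<le> 14 * sqrt (V * (real T / real K))"
proof -
  define L where "L = real T / real K"
  have L: "L \<ge> 0" by (simp add: L_def)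
  let ?P = "min N (nat \<lfloor>L\<rfloor>)"
  have P: "real ?P \<le> L" by (rule order_trans[OF _ of_nat_floor[OF L]]) simp
  have le: "sqrt (2 * V * (exploration K T n / real n))
    \<le> (if n \<le> ?P then sqrt (12 * V) * sqrt (sqrt L) * (1 / (sqrt (sqrt (real n))) ^ 3) else 0)"
    if n: "n \<in> {1..N}" for n
  proof (cases "real n \<le> L")
    case True
    then have nP: "n \<le> ?P" using n by (auto simp: le_nat_floor)
    have "exploration K T n \<le> 6 * sqrt (real T / (real K * real n))"
      using True n K by (intro exploration_le_sqrt) (auto simp: L_def field_simps)
    also have "\<dots> = 6 * (sqrt L / sqrt (real n))" by (simp add: L_def real_sqrt_divide real_sqrt_mult)
    finally have "2 * V * (exploration K T n / real n) \<le> 2 * V * (6 * (sqrt L / sqrt (real n)) / real n)"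
      using V n by (intro mult_left_mono divide_right_mono) auto
    also have "\<dots> = 12 * V * sqrt L / (sqrt (real n)) ^ 3"
    proof -
      have "real n = (sqrt (real n))\<^sup>2" by simp
      then have "sqrt (real n) * real n = sqrt (real n) ^ 3"
        by (metis power2_eq_square power3_eq_cube mult.assoc)
      then show ?thesis by (simp add: field_simps)
    qed
    finally have "sqrt (2 * V * (exploration K T n / real n)) \<le> sqrt (12 * V * sqrt L / (sqrt (real n)) ^ 3)"
      by simp
    also have "\<dots> = sqrt (12 * V) * sqrt (sqrt L) * (1 / (sqrt (sqrt (real n))) ^ 3)"
      by (simp add: real_sqrt_divide real_sqrt_mult real_sqrt_power)
    finally show ?thesis using nP by simp
  next
    case False
    then have "exploration K T n = 0"
      using n K by (intro exploration_eq_0) (auto simp: L_def field_simps)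
    then show ?thesis using V L by simp
  qed
  have "(\<Sum>n=1..N. sqrt (2 * V * (exploration K T n / real n)))
    \<le> (\<Sum>n=1..N. if n \<le> ?P then sqrt (12 * V) * sqrt (sqrt L) * (1 / (sqrt (sqrt (real n))) ^ 3) else 0)"
    by (intro sum_mono le)
  also have "\<dots> = (\<Sum>n=1..?P. sqrt (12 * V) * sqrt (sqrt L) * (1 / (sqrt (sqrt (real n))) ^ 3))"
    by (intro sum.mono_neutral_cong_right) auto
  also have "\<dots> = sqrt (12 * V) * sqrt (sqrt L) * (\<Sum>n=1..?P. 1 / (sqrt (sqrt (real n))) ^ 3)"
    by (simp only: sum_distrib_left)
  also have "\<dots> \<le> sqrt (12 * V) * sqrt (sqrt L) * (4 * sqrt (sqrt (real ?P)))"
    using V L by (intro mult_left_mono sum_inverse_three_quarters_le) auto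
  also have "\<dots> \<le> sqrt (12 * V) * sqrt (sqrt L) * (4 * sqrt (sqrt L))"
    using V L P by (intro mult_left_mono) auto
  also have "\<dots> = (4 * sqrt 12) * (sqrt V * sqrt L)"
    using L by (simp add: real_sqrt_mult)
  also have "\<dots> \<le> 14 * (sqrt V * sqrt L)"
  proof (intro mult_right_mono)
    have "sqrt 12 \<le> (7 / 2 :: real)" by (rule real_le_lsqrt) (auto simp: power2_eq_square)
    then show "4 * sqrt 12 \<le> (14 :: real)" by simp
  qed (use V L in auto)
  finally show ?thesis unfolding L_def real_sqrt_mult[of V] .
qed

text \<open>The geometric ratio of the peeling: \<open>16/15\<close> satisfies \<open>(16/15) ^ 4 \<le> 4/3\<close>.\<close>

definition peel_ratio :: real where "peel_ratio = 16 / 15"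

text \<open>With \<open>r\<close> the ratio, the Gaussian sum of cell \<open>j\<close> is at most
  \<open>2 * r ^ (2 * (j + 1))\<close>, and the weight \<open>r ^ (-3 * j)\<close> leaves a
  geometric series in \<open>1 / r\<close> with sum below 16. This gives
  \<open>2 * r\<^sup>2 * 16 \<le> 37\<close>, to which the term without peeling adds 2.\<close>

lemma sum_peeling_le:
  "(\<Sum>k=1..n. exp (- ((real k)\<^sup>2 / 2))
      + (\<Sum>j<J. (1 / peel_ratio ^ 3) ^ j * exp (- ((real k)\<^sup>2 / (2 * (peel_ratio ^ 4) ^ (j + 1)))))) \<le> 39"
proof -
  let ?r = peel_ratio
  have r: "?r > 0" by (simp add: peel_ratio_def)
  have g: "(\<Sum>k=1..n. exp (- ((real k)\<^sup>2 / (2 * c)))) \<le> 2 * sqrt c" if "c > 0" for c :: real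
  proof -
    have "(\<Sum>k=1..n. exp (- ((real k)\<^sup>2 / (2 * c)))) = (\<Sum>k=1..n. exp (- (1 / (2 * c) * (real k)\<^sup>2)))"
      by (simp add: mult.commute)
    also have "\<dots> \<le> sqrt (2 / (1 / (2 * c)))" using that by (intro sum_gaussian_le) simp
    also have "\<dots> = 2 * sqrt c" by (simp add: real_sqrt_mult)
    finally show ?thesis .
  qed
  have "(\<Sum>k=1..n. exp (- ((real k)\<^sup>2 / 2))
      + (\<Sum>j<J. (1 / ?r ^ 3) ^ j * exp (- ((real k)\<^sup>2 / (2 * (?r ^ 4) ^ (j + 1))))))
      = (\<Sum>k=1..n. exp (- ((real k)\<^sup>2 / (2 * 1))))
        + (\<Sum>j<J. (1 / ?r ^ 3) ^ j * (\<Sum>k=1..n. exp (- ((real k)\<^sup>2 / (2 * (?r ^ 4) ^ (j + 1))))))"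
    by (subst sum.distrib, subst sum.swap) (simp add: sum_distrib_left)
  also have "\<dots> \<le> 2 * sqrt 1 + (\<Sum>j<J. (1 / ?r ^ 3) ^ j * (2 * sqrt ((?r ^ 4) ^ (j + 1))))"
    using r by (intro add_mono sum_mono mult_left_mono g) auto
  also have "(\<Sum>j<J. (1 / ?r ^ 3) ^ j * (2 * sqrt ((?r ^ 4) ^ (j + 1)))) = (\<Sum>j<J. 2 * ?r\<^sup>2 * (1 / ?r) ^ j)"
  proof (intro sum.cong refl)
    fix j
    have "(?r ^ 4) ^ (j + 1) = ((?r\<^sup>2) ^ (j + 1))\<^sup>2"
      by (simp flip: power_mult add: algebra_simps)
    then have "sqrt ((?r ^ 4) ^ (j + 1)) = (?r\<^sup>2) ^ (j + 1)" using r by simp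
    moreover have "(1 / ?r ^ 3) ^ j * (?r\<^sup>2) ^ j = (1 / ?r) ^ j"
      using r by (simp flip: power_mult_distrib) (simp add: power2_eq_square power3_eq_cube)
    ultimately show "(1 / ?r ^ 3) ^ j * (2 * sqrt ((?r ^ 4) ^ (j + 1))) = 2 * ?r\<^sup>2 * (1 / ?r) ^ j"
      by (simp add: algebra_simps)
  qed
  also have "\<dots> = 2 * ?r\<^sup>2 * (\<Sum>j<J. (1 / ?r) ^ j)" by (simp add: sum_distrib_left)
  also have "\<dots> = 2 * ?r\<^sup>2 * ((1 - (1 / ?r) ^ J) / (1 - 1 / ?r))"
    by (subst sum_gp_strict) (simp add: peel_ratio_def)
  also have "\<dots> \<le> 2 * ?r\<^sup>2 * (1 / (1 - 1 / ?r))"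
    by (intro mult_left_mono divide_right_mono) (auto simp: peel_ratio_def)
  also have "\<dots> \<le> 37" by (simp add: peel_ratio_def power2_eq_square)
  finally show ?thesis by simp
qed

section \<open>Regret of kl-UCB++\<close>

context bandit_game_laws
begin

lemma exp_mart_nth_pull_integral:
  assumes k: "k \<in> {1..K}" and mgf: "(\<integral>\<^sup>+x. ennreal (exp (l * x)) \<partial>\<nu> k) = ennreal (exp \<psi>)"
  shows "(\<Sum>t<T. \<integral>\<omega>. exp_mart k l \<psi> t \<omega>
    * indicator {\<omega> \<in> space M. A (Suc t) \<omega> = k \<and> num_pulls k t \<omega> = n} \<omega> \<partial>M) \<le> 1"
    (is "(\<Sum>t<T. \<integral>\<omega>. ?Z t \<omega> * indicator (?G t) \<omega> \<partial>M) \<le> 1")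
    and "t < T \<Longrightarrow> integrable M (\<lambda>\<omega>. exp_mart k l \<psi> t \<omega>
    * indicator {\<omega> \<in> space M. A (Suc t) \<omega> = k \<and> num_pulls k t \<omega> = n} \<omega>)"
proof -
  have G: "?G t \<in> sets M" if t: "t < T" for t
  proof -
    have [measurable]: "A (Suc t) \<in> measurable M (count_space UNIV)"
      "num_pulls k t \<in> measurable M (count_space UNIV)"
      by (rule measurable_F[OF action_measurable_nat[of _ t]], use t in auto)
        (rule measurable_F[OF num_pulls_measurable], use t in auto)
    show ?thesis by measurable
  qed
  have i: "integrable M (\<lambda>\<omega>. ?Z t \<omega> * indicator (?G t) \<omega>)" if "t < T" for t
    using integrable_exp_mart[OF k mgf, of t] that
    by (intro integrable_real_mult_indicator G) auto
  show "t < T \<Longrightarrow> integrable M (\<lambda>\<omega>. ?Z t \<omega> * indicator (?G t) \<omega>)" by (rule i)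
  have "ennreal (\<Sum>t<T. \<integral>\<omega>. ?Z t \<omega> * indicator (?G t) \<omega> \<partial>M)
      = (\<Sum>t<T. ennreal (\<integral>\<omega>. ?Z t \<omega> * indicator (?G t) \<omega> \<partial>M))"
    by (intro sum_ennreal[symmetric] integral_nonneg_AE) (auto simp: exp_mart_def indicator_def)
  also have "\<dots> = (\<Sum>t<T. \<integral>\<^sup>+\<omega>. ennreal (?Z t \<omega>) * indicator (?G t) \<omega> \<partial>M)"
  proof (intro sum.cong refl)
    fix t assume "t \<in> {..<T}"
    then have "ennreal (\<integral>\<omega>. ?Z t \<omega> * indicator (?G t) \<omega> \<partial>M) = (\<integral>\<^sup>+\<omega>. ennreal (?Z t \<omega> * indicator (?G t) \<omega>) \<partial>M)"
      by (intro nn_integral_eq_integral[symmetric] i) (auto simp: exp_mart_def indicator_def)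
    also have "\<dots> = (\<integral>\<^sup>+\<omega>. ennreal (?Z t \<omega>) * indicator (?G t) \<omega> \<partial>M)"
      by (intro nn_integral_cong) (auto simp: indicator_def)
    finally show "ennreal (\<integral>\<omega>. ?Z t \<omega> * indicator (?G t) \<omega> \<partial>M)
      = (\<integral>\<^sup>+\<omega>. ennreal (?Z t \<omega>) * indicator (?G t) \<omega> \<partial>M)" .
  qed
  also have "\<dots> \<le> 1" by (rule exp_mart_nth_pull[OF k mgf])
  finally show "(\<Sum>t<T. \<integral>\<omega>. ?Z t \<omega> * indicator (?G t) \<omega> \<partial>M) \<le> 1"
    by (simp add: ennreal_le_1)
qed

end

locale klucb_setting =
  bounded_variance_family \<rho> V + bandit_game_laws M F "\<lambda>k. expfam_law \<rho> (\<theta> k)" K T A Y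
  for \<rho> :: "real measure" and V :: real and M :: "'w measure" and F \<theta> K T A Y +
  assumes K_pos: "K \<ge> 1" and K_le_T: "K \<le> T"
begin

text \<open>The pulls per arm under an even split, and the count from which the exploration bonus is
  zero.\<close>

definition L :: real where "L = real T / real K"

text \<open>The standard deviation scale of an empirical mean after \<open>L\<close> pulls; it
  serves as grid step for the shortfall and as threshold for the excess.\<close>

definition \<delta> :: real where "\<delta> = sqrt (V / L)"

definition emp :: "nat \<Rightarrow> nat \<Rightarrow> 'w \<Rightarrow> real" where
  "emp k t \<omega> = emp_mean (\<lambda>s. A s \<omega>) (\<lambda>s. Y s \<omega>) k t"

definition index :: "nat \<Rightarrow> nat \<Rightarrow> 'w \<Rightarrow> ereal" where
  "index k t \<omega> = ucb_index \<rho> K T (\<lambda>s. A s \<omega>) (\<lambda>s. Y s \<omega>) k t"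

lemma L_pos: "L > 0"
  using K_pos K_le_T by (simp add: L_def)

lemma \<delta>_pos: "\<delta> > 0"
  using V_pos L_pos by (simp add: \<delta>_def)

lemma emp_eq: "emp k t \<omega> = reward_sum k t \<omega> / real (num_pulls k t \<omega>)"
  by (simp add: emp_def emp_mean_def reward_sum_def num_pulls_def)

section \<open>The shortfall of the index of a best arm\<close>

lemma emp_in_closure:
  assumes Y: "\<forall>s\<in>{1..T}. Y s \<omega> \<in> closure (mean_set \<rho>)" and t: "t \<le> T" and n: "num_pulls k t \<omega> \<ge> 1"
  shows "emp k t \<omega> \<in> closure (mean_set \<rho>)"
proof -
  let ?S = "{s \<in> {1..t}. A s \<omega> = k}"
  have card: "num_pulls k t \<omega> = card ?S" by (simp add: num_pulls_def pulls_def)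
  have "(\<Sum>s\<in>?S. 1 / real (card ?S)) = 1"
    unfolding sum_constant card[symmetric] using n by simp
  then have "(\<Sum>s\<in>?S. (1 / real (card ?S)) *\<^sub>R Y s \<omega>) \<in> closure (mean_set \<rho>)"
    using Y t by (intro convex_sum convex_closure_mean_set) auto
  moreover have "emp k t \<omega> = (\<Sum>s\<in>?S. (1 / real (card ?S)) *\<^sub>R Y s \<omega>)"
    unfolding emp_eq reward_sum_def card by (simp add: sum_divide_distrib)
  ultimately show ?thesis by simp
qed

text \<open>The exponent does not depend on the number of pulls, so that a single maximal inequality covers a
  whole cell of the peeling.\<close>

lemma lower_deviation_cell:
  assumes k: "k \<in> {1..K}" and \<gamma>: "\<gamma> \<ge> 0" and n0: "n0 \<ge> 0" and v: "v \<le> \<theta> k"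
  obtains E where "E \<in> sets M" "prob E \<le> exp (- (n0 * (\<gamma> + (m v - m (\<theta> k))\<^sup>2 / (2 * V))))"
    "\<And>\<omega> t. \<omega> \<in> space M \<Longrightarrow> \<omega> \<notin> E \<Longrightarrow> t \<le> T \<Longrightarrow> n0 \<le> real (num_pulls k t \<omega>) \<Longrightarrow>
      num_pulls k t \<omega> \<ge> 1 \<Longrightarrow> emp k t \<omega> \<in> closure (mean_set \<rho>) \<Longrightarrow> emp k t \<omega> < m v \<Longrightarrow>
      \<not> ereal \<gamma> < kl_ext \<rho> (emp k t \<omega>) (m v)"
  using \<gamma>
proof (cases rule: kl_ext_lower_deviation[of \<gamma> v, consumes 1, case_names level never])
  case never
  show ?thesis by (rule that[of "{}"]) (use never in auto)
next
  case (level s)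
  let ?D = "\<gamma> + (m v - m (\<theta> k))\<^sup>2 / (2 * V)"
  \<comment> \<open>This exponent tilts the law of the arm from \<open>\<theta> k\<close> to
    \<open>s\<close>. It is nonpositive, so \<open>emp k t \<omega> \<le> m s\<close> gives a lower
    bound for the martingale, whose rate at \<open>m s\<close> is exactly
    \<open>bregman s (\<theta> k)\<close>.\<close>
  let ?l = "s - \<theta> k" and ?\<psi> = "b s - b (\<theta> k)"
  let ?Z = "exp_mart k ?l ?\<psi>"
  have mgf: "(\<integral>\<^sup>+x. ennreal (exp (?l * x)) \<partial>expfam_law \<rho> (\<theta> k)) = ennreal (exp ?\<psi>)"
    using nn_integral_exp_law[where l = ?l and \<theta> = "\<theta> k"] by simp
  let ?E = "{\<omega> \<in> space M. \<exists>t\<le>T. exp (n0 * ?D) \<le> ?Z t \<omega>}"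
  show ?thesis
  proof (rule that[of ?E])
    show "?E \<in> sets M" by (rule exp_mart_maximal(1)[OF k mgf]) simp
    have "prob ?E \<le> 1 / exp (n0 * ?D)" by (rule exp_mart_maximal(2)[OF k mgf]) simp
    then show "prob ?E \<le> exp (- (n0 * ?D))" by (simp add: exp_minus inverse_eq_divide)
    fix \<omega> t
    assume \<omega>: "\<omega> \<in> space M" "\<omega> \<notin> ?E" and t: "t \<le> T" and n: "n0 \<le> real (num_pulls k t \<omega>)"
      "num_pulls k t \<omega> \<ge> 1" and x: "emp k t \<omega> \<in> closure (mean_set \<rho>)" "emp k t \<omega> < m v"
    show "\<not> ereal \<gamma> < kl_ext \<rho> (emp k t \<omega>) (m v)"
    proof
      assume "ereal \<gamma> < kl_ext \<rho> (emp k t \<omega>) (m v)"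
      then have le: "emp k t \<omega> \<le> m s" by (rule level(3)[OF x])
      let ?n = "real (num_pulls k t \<omega>)"
      have D: "0 \<le> ?D" using \<gamma> V_pos by simp
      have "?D \<le> bregman s v + bregman v (\<theta> k)"
        using level(2) bregman_ge[of v "\<theta> k"] by simp
      also have "\<dots> \<le> bregman s (\<theta> k)" using level(1) v by (intro bregman_superadditive) auto
      also have "\<dots> = ?l * m s - ?\<psi>" by (simp add: bregman_def algebra_simps)
      also have "\<dots> \<le> ?l * emp k t \<omega> - ?\<psi>"
        using le level(1) v by (intro diff_right_mono mult_left_mono_neg) auto
      finally have "?n * ?D \<le> ?n * (?l * emp k t \<omega> - ?\<psi>)" by (intro mult_left_mono) auto
      also have "\<dots> = ?l * (?n * emp k t \<omega>) - ?\<psi> * ?n"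
        by (simp add: algebra_simps)
      also have "?n * emp k t \<omega> = reward_sum k t \<omega>"
        using n by (simp add: emp_eq)
      finally have "?n * ?D \<le> ?l * reward_sum k t \<omega> - ?\<psi> * ?n" .
      moreover have "n0 * ?D \<le> ?n * ?D" using n D by (intro mult_right_mono) auto
      ultimately have "exp (n0 * ?D) \<le> ?Z t \<omega>" by (simp add: exp_mart_def)
      then show False using \<omega> t by blast
    qed
  qed
qed

text \<open>Union bound over the cells, with \<open>y\<close> standing for \<open>L\<close> times
  the Gaussian rate of the deviation. The first term belongs to the counts from \<open>L\<close> on,
  the term of index \<open>j\<close> to the \<open>j\<close>-th cell below \<open>L\<close>.\<close>

definition dev_bound :: "nat \<Rightarrow> real \<Rightarrow> real" where
  "dev_bound J y = exp (- y) + (\<Sum>j<J. (1 / peel_ratio ^ 3) ^ j * exp (- (y / (peel_ratio ^ 4) ^ (j + 1))))"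

lemma dev_bound_nonneg: "dev_bound J y \<ge> 0"
  unfolding dev_bound_def by (intro add_nonneg_nonneg sum_nonneg) (auto simp: peel_ratio_def)

text \<open>Peeling over the random number of pulls: on each cell one threshold for the divergence
  and one lower bound for the count suffice, so one event per cell covers all its rounds. The choice
  of \<open>J\<close> makes \<open>J\<close> cells reach down to a single pull.\<close>

lemma index_lower_deviation_mean:
  assumes k: "k \<in> {1..K}" and v: "v \<le> \<theta> k" and J: "L < (peel_ratio ^ 4) ^ J"
  obtains E where "E \<in> sets M" "prob E \<le> dev_bound J (L * ((m v - m (\<theta> k))\<^sup>2 / (2 * V)))"
    "\<And>\<omega> t. \<omega> \<in> space M \<Longrightarrow> \<omega> \<notin> E \<Longrightarrow> t \<le> T \<Longrightarrow> num_pulls k t \<omega> \<ge> 1 \<Longrightarrow>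
      emp k t \<omega> \<in> closure (mean_set \<rho>) \<Longrightarrow> ereal (m v) \<le> index k t \<omega>"
proof -
  let ?\<beta> = "peel_ratio ^ 4"
  let ?u = "(m v - m (\<theta> k))\<^sup>2 / (2 * V)"
  have \<beta>: "?\<beta> > 1" by (simp add: peel_ratio_def)
  have lnr: "0 < ln peel_ratio" by (simp add: peel_ratio_def)
  have ln\<beta>: "ln ?\<beta> = 4 * ln peel_ratio"
    by (subst ln_realpow) (auto simp: peel_ratio_def)
  \<comment> \<open>\<open>ln (L / n) / n\<close> decreases on a cell; this is its value at the
    right end \<open>n = L / ?\<beta> ^ j\<close>.\<close>
  define \<gamma> where "\<gamma> j = real j * ln ?\<beta> * ?\<beta> ^ j / L" for j
  have \<gamma>: "\<gamma> j \<ge> 0" for j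
    using L_pos \<beta> by (auto simp: \<gamma>_def intro!: divide_nonneg_pos mult_nonneg_nonneg)
  have "\<exists>E. E \<in> sets M \<and> prob E \<le> exp (- (L / ?\<beta> ^ (j + 1) * (\<gamma> j + ?u))) \<and>
    (\<forall>\<omega> t. \<omega> \<in> space M \<longrightarrow> \<omega> \<notin> E \<longrightarrow> t \<le> T \<longrightarrow> L / ?\<beta> ^ (j + 1) \<le> real (num_pulls k t \<omega>) \<longrightarrow>
      num_pulls k t \<omega> \<ge> 1 \<longrightarrow> emp k t \<omega> \<in> closure (mean_set \<rho>) \<longrightarrow> emp k t \<omega> < m v \<longrightarrow>
      \<not> ereal (\<gamma> j) < kl_ext \<rho> (emp k t \<omega>) (m v))" for j
  proof -
    have "L / ?\<beta> ^ (j + 1) \<ge> 0"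
      using L_pos by (intro divide_nonneg_pos) (auto simp: peel_ratio_def)
    from lower_deviation_cell[OF k \<gamma>[of j] this v] show ?thesis by metis
  qed
  then obtain E where E: "\<And>j. E j \<in> sets M"
    "\<And>j. prob (E j) \<le> exp (- (L / ?\<beta> ^ (j + 1) * (\<gamma> j + ?u)))"
    "\<And>j \<omega> t. \<omega> \<in> space M \<Longrightarrow> \<omega> \<notin> E j \<Longrightarrow> t \<le> T \<Longrightarrow> L / ?\<beta> ^ (j + 1) \<le> real (num_pulls k t \<omega>) \<Longrightarrow>
      num_pulls k t \<omega> \<ge> 1 \<Longrightarrow> emp k t \<omega> \<in> closure (mean_set \<rho>) \<Longrightarrow> emp k t \<omega> < m v \<Longrightarrow>
      \<not> ereal (\<gamma> j) < kl_ext \<rho> (emp k t \<omega>) (m v)"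
    by metis
  \<comment> \<open>For counts of at least \<open>L\<close> the bonus is zero, so the threshold is 0
    and only the Gaussian term remains in the exponent.\<close>
  obtain E' where E': "E' \<in> sets M" "prob E' \<le> exp (- (L * (0 + ?u)))"
    "\<And>\<omega> t. \<omega> \<in> space M \<Longrightarrow> \<omega> \<notin> E' \<Longrightarrow> t \<le> T \<Longrightarrow> L \<le> real (num_pulls k t \<omega>) \<Longrightarrow>
      num_pulls k t \<omega> \<ge> 1 \<Longrightarrow> emp k t \<omega> \<in> closure (mean_set \<rho>) \<Longrightarrow> emp k t \<omega> < m v \<Longrightarrow>
      \<not> ereal 0 < kl_ext \<rho> (emp k t \<omega>) (m v)"
    using lower_deviation_cell[OF k order_refl less_imp_le[OF L_pos] v] by metis
  have cell: "exp (- (L / ?\<beta> ^ (j + 1) * (\<gamma> j + ?u)))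
    \<le> (1 / peel_ratio ^ 3) ^ j * exp (- (L * ?u / ?\<beta> ^ (j + 1)))" for j
  proof -
    have "L / ?\<beta> ^ (j + 1) * \<gamma> j = real j * ln peel_ratio * (4 / ?\<beta>)"
      using L_pos \<beta> by (simp add: \<gamma>_def ln\<beta> field_simps)
    \<comment> \<open>The count is underestimated by a factor of up to \<open>?\<beta>\<close> on a
      cell; \<open>4 / ?\<beta> \<ge> 3\<close> turns this loss into the exponent 3, which still
      exceeds the growth exponent 2 of the Gaussian sums.\<close>
    also have "\<dots> \<ge> real j * ln peel_ratio * 3"
      using lnr by (intro mult_left_mono) (auto simp: peel_ratio_def power4_eq_xxxx)
    finally have "exp (- (L / ?\<beta> ^ (j + 1) * \<gamma> j)) \<le> exp (- (real j * ln peel_ratio * 3))" by simp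
    also have "\<dots> = (1 / peel_ratio ^ 3) ^ j"
    proof -
      have "(1 / peel_ratio ^ 3) ^ j = exp (real j * ln (1 / peel_ratio ^ 3))"
        by (simp add: exp_of_nat_mult peel_ratio_def)
      also have "ln (1 / peel_ratio ^ 3) = - (3 * ln peel_ratio)"
        by (simp add: ln_div ln_realpow peel_ratio_def)
      finally show ?thesis by (simp add: mult_ac)
    qed
    finally have "exp (- (L / ?\<beta> ^ (j + 1) * \<gamma> j)) * exp (- (L * ?u / ?\<beta> ^ (j + 1)))
        \<le> (1 / peel_ratio ^ 3) ^ j * exp (- (L * ?u / ?\<beta> ^ (j + 1)))"
      by (intro mult_right_mono) auto
    moreover have "- (L / ?\<beta> ^ (j + 1) * (\<gamma> j + ?u)) = - (L / ?\<beta> ^ (j + 1) * \<gamma> j) + - (L * ?u / ?\<beta> ^ (j + 1))"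
      by (simp add: distrib_left)
    ultimately show ?thesis by (simp only: exp_add)
  qed
  let ?E = "E' \<union> (\<Union>j<J. E j)"
  show ?thesis
  proof (rule that[of ?E])
    show sets: "?E \<in> sets M" using E E' by auto
    have "prob ?E \<le> prob E' + prob (\<Union>j<J. E j)"
      using E E' by (intro measure_Un_le) auto
    also have "\<dots> \<le> prob E' + (\<Sum>j<J. prob (E j))"
      using E by (intro add_left_mono measure_UNION_le) auto
    also have "\<dots> \<le> dev_bound J (L * ?u)"
      unfolding dev_bound_def using E'(2) order_trans[OF E(2) cell]
      by (intro add_mono sum_mono) auto
    finally show "prob ?E \<le> dev_bound J (L * ?u)" .
    fix \<omega> t
    assume \<omega>: "\<omega> \<in> space M" "\<omega> \<notin> ?E" and t: "t \<le> T" and n1: "num_pulls k t \<omega> \<ge> 1"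
      and x: "emp k t \<omega> \<in> closure (mean_set \<rho>)"
    let ?n = "num_pulls k t \<omega>"
    show "ereal (m v) \<le> index k t \<omega>"
    proof (rule ccontr)
      assume "\<not> ?thesis"
      then have "ucb_index \<rho> K T (\<lambda>s. A s \<omega>) (\<lambda>s. Y s \<omega>) k t < ereal (m v)" by (simp add: index_def)
      from ucb_index_less_imp[OF x[unfolded emp_def] this]
      have lt: "emp k t \<omega> < m v" "ereal (exploration K T ?n / real ?n) < kl_ext \<rho> (emp k t \<omega>) (m v)"
        by (simp_all add: emp_def num_pulls_def)
      show False
      proof (cases "L \<le> real ?n")
        case True
        have "ereal 0 < kl_ext \<rho> (emp k t \<omega>) (m v)"
          by (rule le_less_trans[OF _ lt(2)]) (simp add: exploration_nonneg)
        then show False using E'(3)[of \<omega> t] \<omega> t True n1 x lt(1) by blast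
      next
        case False
        \<comment> \<open>The cell of the current count: the least \<open>i\<close> is not 0 because
          the count is below \<open>L\<close>, and its predecessor \<open>j\<close> satisfies
          \<open>n * ?\<beta> ^ j \<le> L < n * ?\<beta> ^ (j + 1)\<close>.\<close>
        define i where "i = (LEAST i. L < real ?n * ?\<beta> ^ i)"
        have pos: "0 < ?\<beta> ^ j" for j by (simp add: peel_ratio_def)
        have "1 * ?\<beta> ^ J \<le> real ?n * ?\<beta> ^ J" using n1 pos[of J] by (intro mult_right_mono) auto
        then have ex: "L < real ?n * ?\<beta> ^ J" using J by linarith
        have i: "L < real ?n * ?\<beta> ^ i" "i \<le> J"
          unfolding i_def by (rule LeastI[of "\<lambda>i. L < real ?n * ?\<beta> ^ i", OF ex])
            (rule Least_le[of "\<lambda>i. L < real ?n * ?\<beta> ^ i", OF ex])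
        have "i \<noteq> 0" using i(1) False by (intro notI) simp
        then obtain j where j: "i = Suc j" using not0_implies_Suc by blast
        have "j < i" using j by simp
        then have "\<not> L < real ?n * ?\<beta> ^ j" unfolding i_def by (rule not_less_Least)
        then have nj: "real ?n * ?\<beta> ^ j \<le> L" by simp
        have "L / ?\<beta> ^ (j + 1) \<le> real ?n"
          using i(1) j pos[of "j + 1"] by (simp add: divide_le_eq)
        have KT: "real K * real ?n \<le> real T"
          using False K_pos by (simp add: L_def field_simps)
        have Ln: "real T / (real K * real ?n) = L / real ?n" by (simp add: L_def)
        have "real j * ln ?\<beta> = ln (?\<beta> ^ j)" using \<beta> by (simp add: ln_realpow)
        also have "\<dots> \<le> ln (L / real ?n)"
        proof -
          have "?\<beta> ^ j \<le> L / real ?n" using nj n1 by (simp add: field_simps)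
          then show ?thesis using pos[of j] by (intro ln_mono)
        qed
        also have "\<dots> \<le> exploration K T ?n"
          using exploration_ge_ln[OF K_pos n1 KT] Ln by simp
        finally have g: "real j * ln ?\<beta> \<le> exploration K T ?n" .
        have "\<gamma> j = real j * ln ?\<beta> * (?\<beta> ^ j / L)" by (simp add: \<gamma>_def)
        also have "\<dots> \<le> real j * ln ?\<beta> * (1 / real ?n)"
          using nj n1 L_pos \<beta> by (intro mult_left_mono) (auto simp: field_simps)
        also have "\<dots> \<le> exploration K T ?n * (1 / real ?n)"
          using g by (intro mult_right_mono) auto
        finally have "ereal (\<gamma> j) \<le> ereal (exploration K T ?n / real ?n)" by simp
        then have "ereal (\<gamma> j) < kl_ext \<rho> (emp k t \<omega>) (m v)" using lt(2) by (rule le_less_trans)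
        moreover have "\<omega> \<notin> E j" using \<omega> i(2) j by auto
        ultimately show False
          using E(3)[of \<omega> j t] \<omega> t \<open>L / ?\<beta> ^ (j + 1) \<le> real ?n\<close> n1 x lt(1) by blast
      qed
    qed
  qed
qed

text \<open>A level that leaves the mean set lies below all of it, and the index then exceeds it
  without any exceptional event.\<close>

lemma index_lower_deviation:
  assumes k: "k \<in> {1..K}" and u: "u \<ge> 0" and J: "L < (peel_ratio ^ 4) ^ J"
  obtains E where "E \<in> sets M" "prob E \<le> dev_bound J (L * (u\<^sup>2 / (2 * V)))"
    "\<And>\<omega> t. \<omega> \<in> space M \<Longrightarrow> \<omega> \<notin> E \<Longrightarrow> t \<le> T \<Longrightarrow> num_pulls k t \<omega> \<ge> 1 \<Longrightarrow>
      emp k t \<omega> \<in> closure (mean_set \<rho>) \<Longrightarrow> ereal (m (\<theta> k) - u) \<le> index k t \<omega>"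
proof (cases "m (\<theta> k) - u \<in> mean_set \<rho>")
  case True
  then obtain v where v: "m v = m (\<theta> k) - u" by (auto simp: mean_set_eq)
  then have "m v \<le> m (\<theta> k)" using u by simp
  then have "v \<le> \<theta> k" by simp
  have sq: "(m v - m (\<theta> k))\<^sup>2 = u\<^sup>2" using v by simp
  from index_lower_deviation_mean[OF k \<open>v \<le> \<theta> k\<close> J] show ?thesis
    unfolding sq unfolding v using that by blast
next
  case False
  have "\<not> m (\<theta> k) < m (\<theta> k) - u" using u by simp
  then have "\<forall>t. m (\<theta> k) - u < m t" using not_in_mean_set_cases[OF False] by blast
  then show ?thesis
    using dev_bound_nonneg[of J]
    by (intro that[of "{}"]) (auto simp: index_def emp_def intro!: ucb_index_ge intro: less_imp_le)
qed

text \<open>\<open>\<delta> / V\<close> minimises the Gaussian exponent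
  \<open>V / 2 * \<kappa>\<^sup>2 - \<kappa> * \<delta>\<close>. The additional term raises
  \<open>n\<close> times that exponent by only \<open>1 / 2\<close>, but it makes
  \<open>n * tilt n\<close> at least \<open>sqrt (n / V)\<close>, even for few pulls.\<close>

definition tilt :: "nat \<Rightarrow> real" where
  "tilt n = \<delta> / V + 1 / sqrt (real n * V)"

abbreviation tilted :: "nat \<Rightarrow> nat \<Rightarrow> nat \<Rightarrow> 'w \<Rightarrow> real" where
  "tilted k n \<equiv> exp_mart k (tilt n) (b (\<theta> k + tilt n) - b (\<theta> k))"

definition dev_weight :: "nat \<Rightarrow> real" where
  "dev_weight n = sqrt V * (1 / sqrt (real n) * exp (- (real n / (2 * L))))"

text \<open>The excess over \<open>\<delta>\<close> is linearised by
  \<open>y \<le> exp (y - 1)\<close> for \<open>y\<close> the excess times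
  \<open>n * tilt n\<close>; the exponential is the martingale up to a deterministic factor, and
  dividing by \<open>n * tilt n\<close> yields the weight \<open>sqrt (V / n)\<close>.\<close>

lemma emp_upper_deviation:
  assumes n: "num_pulls k t \<omega> = n" "n \<ge> 1"
  shows "emp k t \<omega> - m (\<theta> k) - \<delta> \<le> dev_weight n * tilted k n t \<omega>"
proof -
  let ?\<kappa> = "tilt n" and ?\<psi> = "b (\<theta> k + tilt n) - b (\<theta> k)"
  let ?x = "emp k t \<omega> - m (\<theta> k) - \<delta>"
  have n0: "real n > 0" using n by simp
  have \<kappa>: "?\<kappa> > 0" using V_pos \<delta>_pos n0 by (auto simp: tilt_def intro!: add_pos_pos)
  have "?\<psi> \<le> m (\<theta> k) * ?\<kappa> + V / 2 * ?\<kappa>\<^sup>2"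
    using bregman_le[of "\<theta> k" "\<theta> k + ?\<kappa>"] by (simp add: bregman_def)
  then have "real n * ?\<psi> \<le> real n * (m (\<theta> k) * ?\<kappa> + V / 2 * ?\<kappa>\<^sup>2)" by (intro mult_left_mono) auto
  moreover have "real n * (V / 2 * ?\<kappa>\<^sup>2 - ?\<kappa> * \<delta>) = 1 / 2 - real n / (2 * L)"
  proof -
    have "V / 2 * ?\<kappa>\<^sup>2 - ?\<kappa> * \<delta> = ((V * ?\<kappa> - \<delta>)\<^sup>2 - \<delta>\<^sup>2) / (2 * V)"
      using V_pos by (simp add: power2_eq_square field_simps)
    moreover have "V * ?\<kappa> - \<delta> = V / sqrt (real n * V)"
      using V_pos by (simp add: tilt_def distrib_left)
    moreover have "(V / sqrt (real n * V))\<^sup>2 = V / real n"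
      using V_pos n0 by (simp add: power_divide power2_eq_square)
    moreover have "\<delta>\<^sup>2 = V / L" using V_pos L_pos by (simp add: \<delta>_def)
    ultimately have "real n * (V / 2 * ?\<kappa>\<^sup>2 - ?\<kappa> * \<delta>) = real n * ((V / real n - V / L) / (2 * V))"
      by simp
    also have "\<dots> = 1 / 2 - real n / (2 * L)" using V_pos n0 L_pos by (simp add: field_simps)
    finally show ?thesis .
  qed
  ultimately have "real n * ?\<kappa> * ?x
      \<le> (1 / 2 - real n / (2 * L)) + (?\<kappa> * reward_sum k t \<omega> - ?\<psi> * real n)"
    using n0 n(1) by (simp add: emp_eq algebra_simps)
  \<comment> \<open>The \<open>- 1\<close> absorbs the \<open>1 / 2\<close> left over from the
    choice of \<open>tilt\<close>.\<close>
  then have "exp (real n * ?\<kappa> * ?x - 1)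
      \<le> exp (- (real n / (2 * L)) + (?\<kappa> * reward_sum k t \<omega> - ?\<psi> * real n))"
    by simp
  also have "\<dots> = exp (- (real n / (2 * L))) * tilted k n t \<omega>"
    by (simp add: exp_mart_def n(1) exp_add[symmetric])
  finally have "real n * ?\<kappa> * ?x \<le> exp (- (real n / (2 * L))) * tilted k n t \<omega>"
    using exp_ge_add_one_self[of "real n * ?\<kappa> * ?x - 1"] by linarith
  then have "?x \<le> 1 / (real n * ?\<kappa>) * (exp (- (real n / (2 * L))) * tilted k n t \<omega>)"
    using n0 \<kappa> by (simp add: field_simps)
  also have "\<dots> \<le> (sqrt V * (1 / sqrt (real n))) * (exp (- (real n / (2 * L))) * tilted k n t \<omega>)"
  proof (intro mult_right_mono)
    have "real n * (1 / sqrt (real n * V)) \<le> real n * ?\<kappa>"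
      using V_pos \<delta>_pos by (intro mult_left_mono) (auto simp: tilt_def)
    moreover have "real n * (1 / sqrt (real n * V)) = sqrt (real n) / sqrt V"
    proof -
      have "real n = sqrt (real n) * sqrt (real n)" by simp
      then show ?thesis using n0 V_pos by (simp add: real_sqrt_mult divide_simps)
    qed
    ultimately have "1 / (real n * ?\<kappa>) \<le> 1 / (sqrt (real n) / sqrt V)"
      using n0 V_pos \<kappa> by (intro divide_left_mono) auto
    then show "1 / (real n * ?\<kappa>) \<le> sqrt V * (1 / sqrt (real n))" by simp
  qed (auto simp: exp_mart_def)
  finally show ?thesis by (simp add: dev_weight_def mult.assoc)
qed

section \<open>The gap at one round and its sum over the rounds\<close>

definition bonus :: "nat \<Rightarrow> real" where
  "bonus n = sqrt (2 * V * (exploration K T n / real n))"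

lemma num_pulls_ge_1:
  assumes run: "klucbpp_run \<rho> K T (\<lambda>t. A t \<omega>) (\<lambda>t. Y t \<omega>)" and t: "K \<le> t" and k: "k \<in> {1..K}"
  shows "num_pulls k t \<omega> \<ge> 1"
proof -
  have "(\<lambda>t. A t \<omega>) ` {1..K} \<subseteq> {1..K}" "inj_on (\<lambda>t. A t \<omega>) {1..K}"
    using run K_le_T by (auto simp: klucbpp_run_def min_def)
  then have "(\<lambda>t. A t \<omega>) ` {1..K} = {1..K}" by (intro endo_inj_surj) auto
  then obtain s where "s \<in> {1..K}" "A s \<omega> = k" using k by (metis imageE)
  then have "s \<in> {s \<in> {1..t}. A s \<omega> = k}" using t by auto
  then have "card {s \<in> {1..t}. A s \<omega> = k} > 0" by (subst card_gt_0_iff) auto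
  then show ?thesis by (simp add: num_pulls_def pulls_def)
qed

lemma num_pulls_le: "num_pulls k t \<omega> \<le> t"
  by (induction t) (auto simp: num_pulls_Suc)

lemma gap_le:
  assumes run: "klucbpp_run \<rho> K T (\<lambda>t. A t \<omega>) (\<lambda>t. Y t \<omega>)" and t: "K \<le> t" "t < T"
    and Y: "\<forall>s\<in>{1..T}. Y s \<omega> \<in> closure (mean_set \<rho>)"
    and k: "A (Suc t) \<omega> = k" "k \<in> {1..K}" and n: "num_pulls k t \<omega> = n"
    and k': "k' \<in> {1..K}" and low: "ereal (m (\<theta> k') - u) \<le> index k' t \<omega>"
  shows "m (\<theta> k') - m (\<theta> k) \<le> u + \<delta> + (bonus n + dev_weight n * tilted k n t \<omega>)"
proof -
  have "is_arg_max (\<lambda>k. index k t \<omega>) (\<lambda>k. k \<in> {1..K}) k"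
    using run t k(1) by (auto simp: klucbpp_run_def index_def)
  then have "index k' t \<omega> \<le> index k t \<omega>" using k' by (auto simp: is_arg_max_def not_less)
  also have "\<dots> \<le> ereal (emp k t \<omega> + bonus n)"
    using ucb_index_le[OF emp_in_closure[OF Y _ num_pulls_ge_1[OF run t(1) k(2)], unfolded emp_def]]
      t n by (simp add: index_def emp_def bonus_def num_pulls_def)
  finally have "m (\<theta> k') - u \<le> emp k t \<omega> + bonus n" using low order_trans by fastforce
  then show ?thesis
    using emp_upper_deviation[OF n] num_pulls_ge_1[OF run t(1) k(2)] n by simp
qed

text \<open>Off by one: \<open>n\<close> counts the earlier pulls, so round \<open>Suc t\<close> is
  pull number \<open>n + 1\<close> of the arm, and the index at that round uses \<open>n\<close>
  samples.\<close>

definition nth_play :: "nat \<Rightarrow> nat \<Rightarrow> nat \<Rightarrow> 'w set" where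
  "nth_play k n t = {\<omega> \<in> space M. A (Suc t) \<omega> = k \<and> num_pulls k t \<omega> = n}"

lemma sum_nth_play:
  fixes f :: "nat \<Rightarrow> nat \<Rightarrow> real"
  assumes "\<omega> \<in> space M" "A (Suc t) \<omega> = k" "k \<in> {1..K}" "num_pulls k t \<omega> = n" "n \<in> {1..T}"
  shows "(\<Sum>k=1..K. \<Sum>n=1..T. f k n * indicator (nth_play k n t) \<omega>) = f k n"
proof -
  have "(\<Sum>j=1..K. \<Sum>i=1..T. f j i * indicator (nth_play j i t) \<omega>)
      = (\<Sum>j=1..K. if j = k then (\<Sum>i=1..T. if i = n then f j i else 0) else 0)"
    using assms by (intro sum.cong refl) (auto simp: nth_play_def indicator_def intro!: sum.cong)
  also have "\<dots> = f k n" using assms by (simp add: sum.delta)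
  finally show ?thesis .
qed

lemma tilted_mgf:
  "(\<integral>\<^sup>+x. ennreal (exp (tilt n * x)) \<partial>expfam_law \<rho> (\<theta> k)) = ennreal (exp (b (\<theta> k + tilt n) - b (\<theta> k)))"
  by (rule nn_integral_exp_law)

lemma sum_tilted_nth_play:
  "k \<in> {1..K} \<Longrightarrow> (\<Sum>t<T. \<integral>\<omega>. tilted k n t \<omega> * indicator (nth_play k n t) \<omega> \<partial>M) \<le> 1"
  unfolding nth_play_def by (rule exp_mart_nth_pull_integral(1)[OF _ tilted_mgf])

lemma integrable_tilted_nth_play:
  "k \<in> {1..K} \<Longrightarrow> t < T \<Longrightarrow> integrable M (\<lambda>\<omega>. tilted k n t \<omega> * indicator (nth_play k n t) \<omega>)"
  unfolding nth_play_def by (rule exp_mart_nth_pull_integral(2)[OF _ tilted_mgf])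

lemma exp_mart_zero: "exp_mart k 0 0 t \<omega> = 1"
  by (simp add: exp_mart_def)

text \<open>With exponent 0 the martingale is constantly 1, so stopping just before pull number
  \<open>n + 1\<close> counts that pull at most once.\<close>

lemma integrable_nth_play:
  assumes "k \<in> {1..K}" "t < T"
  shows "integrable M (\<lambda>\<omega>. indicat_real (nth_play k n t) \<omega>)"
    and "(\<Sum>t<T. \<integral>\<omega>. indicat_real (nth_play k n t) \<omega> \<partial>M) \<le> 1"
proof -
  have mgf: "(\<integral>\<^sup>+x. ennreal (exp (0 * x)) \<partial>expfam_law \<rho> (\<theta> k)) = ennreal (exp 0)"
    using nn_integral_exp_law[where l = 0 and \<theta> = "\<theta> k"] by simp
  show "integrable M (\<lambda>\<omega>. indicat_real (nth_play k n t) \<omega>)"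
    using exp_mart_nth_pull_integral(2)[OF assms(1) mgf assms(2)] by (simp add: exp_mart_zero nth_play_def)
  show "(\<Sum>t<T. \<integral>\<omega>. indicat_real (nth_play k n t) \<omega> \<partial>M) \<le> 1"
    using exp_mart_nth_pull_integral(1)[OF assms(1) mgf] by (simp add: exp_mart_zero nth_play_def)
qed

text \<open>The grid step is such that the exponent of the level \<open>i * \<delta>\<close> is
  \<open>i\<^sup>2 / 2\<close>, free of \<open>V\<close>, \<open>K\<close> and \<open>T\<close>; the
  sum over the grid is then \<open>sum_peeling_le\<close>.\<close>

lemma index_lower_grid:
  assumes k: "k \<in> {1..K}"
  obtains E where "\<And>i. E i \<in> sets M" "\<And>N. (\<Sum>i=1..N. prob (E i)) \<le> 39"
    "\<And>i \<omega> t. \<omega> \<in> space M \<Longrightarrow> \<omega> \<notin> E i \<Longrightarrow> t \<le> T \<Longrightarrow> num_pulls k t \<omega> \<ge> 1 \<Longrightarrow>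
      emp k t \<omega> \<in> closure (mean_set \<rho>) \<Longrightarrow> ereal (m (\<theta> k) - real i * \<delta>) \<le> index k t \<omega>"
proof -
  have "1 < peel_ratio ^ 4" by (simp add: peel_ratio_def)
  then obtain J where J: "L < (peel_ratio ^ 4) ^ J" using real_arch_pow by blast
  have "\<exists>E. E \<in> sets M \<and> prob E \<le> dev_bound J (L * ((real i * \<delta>)\<^sup>2 / (2 * V))) \<and>
    (\<forall>\<omega> t. \<omega> \<in> space M \<longrightarrow> \<omega> \<notin> E \<longrightarrow> t \<le> T \<longrightarrow> num_pulls k t \<omega> \<ge> 1 \<longrightarrow>
      emp k t \<omega> \<in> closure (mean_set \<rho>) \<longrightarrow> ereal (m (\<theta> k) - real i * \<delta>) \<le> index k t \<omega>)" for i
  proof -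
    have "real i * \<delta> \<ge> 0" using \<delta>_pos by simp
    from index_lower_deviation[OF k this J] show ?thesis by metis
  qed
  then obtain E where E: "\<And>i. E i \<in> sets M"
    "\<And>i. prob (E i) \<le> dev_bound J (L * ((real i * \<delta>)\<^sup>2 / (2 * V)))"
    "\<And>i \<omega> t. \<omega> \<in> space M \<Longrightarrow> \<omega> \<notin> E i \<Longrightarrow> t \<le> T \<Longrightarrow> num_pulls k t \<omega> \<ge> 1 \<Longrightarrow>
      emp k t \<omega> \<in> closure (mean_set \<rho>) \<Longrightarrow> ereal (m (\<theta> k) - real i * \<delta>) \<le> index k t \<omega>"
    by metis
  show ?thesis
  proof (rule that[OF E(1) _ E(3)])
    fix N
    have "L * ((real i * \<delta>)\<^sup>2 / (2 * V)) = (real i)\<^sup>2 / 2" for i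
      using V_pos L_pos by (simp add: \<delta>_def power_mult_distrib)
    then have "prob (E i) \<le> dev_bound J ((real i)\<^sup>2 / 2)" for i using E(2)[of i] by (simp only:)
    then have "(\<Sum>i=1..N. prob (E i)) \<le> (\<Sum>i=1..N. dev_bound J ((real i)\<^sup>2 / 2))"
      by (intro sum_mono)
    also have "\<dots> \<le> 39" using sum_peeling_le[of J N] by (simp add: dev_bound_def)
    finally show "(\<Sum>i=1..N. prob (E i)) \<le> 39" .
  qed
qed

lemma measurable_action_M: "t < T \<Longrightarrow> A (Suc t) \<in> measurable M (count_space UNIV)"
  by (rule measurable_F[OF action_measurable_nat]) auto

lemma integrable_gap: "t < T \<Longrightarrow> integrable M (\<lambda>\<omega>. c - m (\<theta> (A (Suc t) \<omega>)))"
proof -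
  assume t: "t < T"
  have [measurable]: "A (Suc t) \<in> measurable M (count_space UNIV)" by (rule measurable_action_M[OF t])
  have "integrable M (\<lambda>\<omega>. m (\<theta> (A (Suc t) \<omega>)))"
  proof (rule integrable_const_bound)
    show "AE \<omega> in M. norm (m (\<theta> (A (Suc t) \<omega>))) \<le> (\<Sum>k=1..K. \<bar>m (\<theta> k)\<bar>)"
    proof (rule AE_I2)
      fix \<omega> assume "\<omega> \<in> space M"
      then have "A (Suc t) \<omega> \<in> {1..K}" by (rule action_in[OF t])
      then show "norm (m (\<theta> (A (Suc t) \<omega>))) \<le> (\<Sum>k=1..K. \<bar>m (\<theta> k)\<bar>)"
        using member_le_sum[of "A (Suc t) \<omega>" "{1..K}" "\<lambda>k. \<bar>m (\<theta> k)\<bar>"] by simp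
    qed
  qed measurable
  then show ?thesis by simp
qed

text \<open>The shortfall of the index of the best arm is discretised on the grid \<open>\<delta>, 2 * \<delta>, \<dots>\<close>, and each
  overestimation of the pulled arm is charged to the pair of that arm and its number of pulls.\<close>

lemma sum_gap_le:
  assumes run: "AE \<omega> in M. klucbpp_run \<rho> K T (\<lambda>t. A t \<omega>) (\<lambda>t. Y t \<omega>)" and k': "k' \<in> {1..K}"
  shows "(\<Sum>t=K..<T. \<integral>\<omega>. m (\<theta> k') - m (\<theta> (A (Suc t) \<omega>)) \<partial>M) \<le> 59 * sqrt (V * real K * real T)"
proof -
  obtain E where E: "\<And>i. E i \<in> sets M" "\<And>N. (\<Sum>i=1..N. prob (E i)) \<le> 39"
    "\<And>i \<omega> t. \<omega> \<in> space M \<Longrightarrow> \<omega> \<notin> E i \<Longrightarrow> t \<le> T \<Longrightarrow> num_pulls k' t \<omega> \<ge> 1 \<Longrightarrow>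
      emp k' t \<omega> \<in> closure (mean_set \<rho>) \<Longrightarrow> ereal (m (\<theta> k') - real i * \<delta>) \<le> index k' t \<omega>"
    using index_lower_grid[OF k'] by metis
  \<comment> \<open>A grid reaching past every gap, so that the trivial bound on the gap applies
    when all grid events occur.\<close>
  obtain N where N: "\<And>k. k \<in> {1..K} \<Longrightarrow> m (\<theta> k') - m (\<theta> k) \<le> real N * \<delta>"
  proof -
    define D where "D = (\<Sum>k=1..K. \<bar>m (\<theta> k') - m (\<theta> k)\<bar>)"
    obtain N where "D / \<delta> \<le> real N" using real_arch_simple by blast
    then have "D \<le> real N * \<delta>" using \<delta>_pos by (simp add: field_simps)
    moreover have "m (\<theta> k') - m (\<theta> k) \<le> D" if k: "k \<in> {1..K}" for k
    proof -
      have "\<bar>m (\<theta> k') - m (\<theta> k)\<bar> \<le> D"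
        unfolding D_def by (rule member_le_sum[OF k]) simp_all
      then show ?thesis by linarith
    qed
    ultimately show ?thesis by (intro that[of N]) (rule order_trans)
  qed
  \<comment> \<open>One \<open>\<delta>\<close> for each grid event, one for rounding the shortfall
    up to the grid and one for the threshold in the excess; the double sum selects the pair that
    describes the current pull.\<close>
  define R where "R t \<omega> = \<delta> * (\<Sum>i=1..N. indicator (E i) \<omega>) + 2 * \<delta>
    + (\<Sum>k=1..K. \<Sum>n=1..T. (bonus n + dev_weight n * tilted k n t \<omega>) * indicator (nth_play k n t) \<omega>)"
    for t \<omega>
  have Y: "AE \<omega> in M. \<forall>t\<in>{1..T}. Y t \<omega> \<in> closure (mean_set \<rho>)"
    by (rule AE_reward_in) (auto intro: AE_law_closure)
  have gap: "AE \<omega> in M. m (\<theta> k') - m (\<theta> (A (Suc t) \<omega>)) \<le> R t \<omega>" if t: "K \<le> t" "t < T" for t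
    using run Y AE_space
  proof eventually_elim
    case (elim \<omega>)
    define k where "k = A (Suc t) \<omega>"
    define n where "n = num_pulls k t \<omega>"
    have k: "k \<in> {1..K}" using action_in[OF t(2) elim(3)] by (simp add: k_def)
    have n: "n \<in> {1..T}"
      using num_pulls_ge_1[OF elim(1) t(1) k] num_pulls_le[of k t \<omega>] t by (simp add: n_def)
    have n': "num_pulls k' t \<omega> \<ge> 1" by (rule num_pulls_ge_1[OF elim(1) t(1) k'])
    have emp': "emp k' t \<omega> \<in> closure (mean_set \<rho>)"
      using t by (intro emp_in_closure[OF elim(2) _ n']) simp
    let ?e = "bonus n + dev_weight n * tilted k n t \<omega>"
    let ?c = "\<Sum>i=1..N. indicat_real (E i) \<omega>"
    have e0: "?e \<ge> 0"
      using V_pos by (auto simp: bonus_def dev_weight_def exp_mart_def exploration_nonneg intro!: add_nonneg_nonneg)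
    have R: "R t \<omega> = \<delta> * ?c + 2 * \<delta> + ?e"
      unfolding R_def
      using sum_nth_play[OF elim(3) k_def[symmetric] k n_def[symmetric] n,
          of "\<lambda>k n. bonus n + dev_weight n * tilted k n t \<omega>"] by simp
    have "m (\<theta> k') - m (\<theta> k) \<le> R t \<omega>"
    proof (cases "\<forall>i\<in>{1..N}. \<omega> \<in> E i")
      case True
      then have "?c = real N" by simp
      then show ?thesis using N[OF k] e0 \<delta>_pos by (simp add: R mult.commute)
    next
      case False
      \<comment> \<open>The first grid level that holds. All \<open>j - 1\<close> earlier events
        occur, so \<open>j\<close> is at most their number plus one.\<close>
      define j where "j = (LEAST i. i \<in> {1..N} \<and> \<omega> \<notin> E i)"
      have j: "j \<in> {1..N}" "\<omega> \<notin> E j"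
        unfolding j_def using False LeastI_ex[of "\<lambda>i. i \<in> {1..N} \<and> \<omega> \<notin> E i"] by blast+
      have before: "\<omega> \<in> E i" if "i \<in> {1..<j}" for i
      proof -
        have "i < (LEAST i. i \<in> {1..N} \<and> \<omega> \<notin> E i)" using that by (simp only: j_def atLeastLessThan_iff)
        then have "\<not> (i \<in> {1..N} \<and> \<omega> \<notin> E i)" by (rule not_less_Least)
        then show ?thesis using that j(1) by simp
      qed
      have "(\<Sum>i\<in>{1..<j}. indicat_real (E i) \<omega>) = (\<Sum>i\<in>{1..<j}. 1)"
        by (intro sum.cong refl) (simp only: indicator_simps before)
      then have "real j - 1 = (\<Sum>i\<in>{1..<j}. indicat_real (E i) \<omega>)"
        using j(1) by (simp add: of_nat_diff)
      also have "\<dots> \<le> ?c" using j(1) by (intro sum_mono2) auto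
      finally have "real j * \<delta> \<le> (?c + 1) * \<delta>" using \<delta>_pos by (intro mult_right_mono) auto
      moreover have "ereal (m (\<theta> k') - real j * \<delta>) \<le> index k' t \<omega>"
        using t by (intro E(3)[OF elim(3) j(2) _ n' emp']) simp
      from gap_le[OF elim(1) t elim(2) k_def[symmetric] k n_def[symmetric] k' this]
      have "m (\<theta> k') - m (\<theta> k) \<le> real j * \<delta> + \<delta> + ?e" .
      ultimately show ?thesis by (simp add: R algebra_simps)
    qed
    then show ?case by (simp add: k_def)
  qed
  define P where "P k n t = (\<integral>\<omega>. indicat_real (nth_play k n t) \<omega> \<partial>M)" for k n t
  define Q where "Q k n t = (\<integral>\<omega>. tilted k n t \<omega> * indicator (nth_play k n t) \<omega> \<partial>M)" for k n t
  have R: "has_bochner_integral M (R t) (\<delta> * (\<Sum>i=1..N. prob (E i)) + 2 * \<delta>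
      + (\<Sum>k=1..K. \<Sum>n=1..T. bonus n * P k n t + dev_weight n * Q k n t))" if t: "t < T" for t
  proof -
    have "has_bochner_integral M (\<lambda>\<omega>. (bonus n + dev_weight n * tilted k n t \<omega>) * indicator (nth_play k n t) \<omega>)
        (bonus n * P k n t + dev_weight n * Q k n t)" if k: "k \<in> {1..K}" for k n
    proof -
      have "has_bochner_integral M (\<lambda>\<omega>. bonus n * indicat_real (nth_play k n t) \<omega>
          + dev_weight n * (tilted k n t \<omega> * indicator (nth_play k n t) \<omega>))
          (bonus n * P k n t + dev_weight n * Q k n t)"
        unfolding P_def Q_def
        by (intro has_bochner_integral_add has_bochner_integral_mult_right has_bochner_integral_integrable
            integrable_nth_play(1)[OF k t] integrable_tilted_nth_play[OF k t])
      then show ?thesis by (simp add: algebra_simps)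
    qed
    moreover have "has_bochner_integral M (\<lambda>\<omega>. \<delta>) \<delta>"
      by (simp add: has_bochner_integral_iff prob_space)
    moreover have "has_bochner_integral M (\<lambda>\<omega>. indicat_real (E i) \<omega>) (prob (E i))" for i
      using E(1)[of i] by (intro has_bochner_integral_real_indicator) (auto simp: less_top[symmetric])
    ultimately show ?thesis
      unfolding R_def
      by (intro has_bochner_integral_add has_bochner_integral_mult_right has_bochner_integral_sum) auto
  qed
  have bonus: "bonus n \<ge> 0" for n
    using V_pos by (simp add: bonus_def exploration_nonneg)
  have dev_weight: "dev_weight n \<ge> 0" for n
    using V_pos by (simp add: dev_weight_def)
  note weights = bonus dev_weight
  have P: "0 \<le> P k n t" for k n t
    unfolding P_def by (rule integral_nonneg_AE) simp
  have Q: "0 \<le> Q k n t" for k n t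
    unfolding Q_def exp_mart_def by (rule integral_nonneg_AE) simp
  have "(\<Sum>t=K..<T. \<integral>\<omega>. m (\<theta> k') - m (\<theta> (A (Suc t) \<omega>)) \<partial>M)
      \<le> (\<Sum>t=K..<T. \<delta> * 39 + 2 * \<delta> + (\<Sum>k=1..K. \<Sum>n=1..T. bonus n * P k n t + dev_weight n * Q k n t))"
  proof (intro sum_mono)
    fix t assume "t \<in> {K..<T}"
    then have t: "K \<le> t" "t < T" by auto
    have "(\<integral>\<omega>. m (\<theta> k') - m (\<theta> (A (Suc t) \<omega>)) \<partial>M) \<le> (\<integral>\<omega>. R t \<omega> \<partial>M)"
      using R[OF t(2)] gap[OF t] integrable_gap[OF t(2)]
      by (intro integral_mono_AE) (auto simp: has_bochner_integral_iff)
    also have "\<dots> = \<delta> * (\<Sum>i=1..N. prob (E i)) + 2 * \<delta>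
      + (\<Sum>k=1..K. \<Sum>n=1..T. bonus n * P k n t + dev_weight n * Q k n t)"
      using R[OF t(2)] by (simp add: has_bochner_integral_iff)
    also have "\<dots> \<le> \<delta> * 39 + 2 * \<delta>
      + (\<Sum>k=1..K. \<Sum>n=1..T. bonus n * P k n t + dev_weight n * Q k n t)"
      using E(2) \<delta>_pos by (intro add_right_mono mult_left_mono) auto
    finally show "(\<integral>\<omega>. m (\<theta> k') - m (\<theta> (A (Suc t) \<omega>)) \<partial>M) \<le> \<delta> * 39 + 2 * \<delta>
      + (\<Sum>k=1..K. \<Sum>n=1..T. bonus n * P k n t + dev_weight n * Q k n t)" .
  qed
  \<comment> \<open>The summands are nonnegative, and the bounds per arm and count concern the sum
    over all rounds.\<close>
  also have "\<dots> \<le> (\<Sum>t<T. \<delta> * 39 + 2 * \<delta> + (\<Sum>k=1..K. \<Sum>n=1..T. bonus n * P k n t + dev_weight n * Q k n t))"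
    using \<delta>_pos weights P Q by (intro sum_mono2) (auto intro!: add_nonneg_nonneg sum_nonneg)
  also have "\<dots> = real T * (41 * \<delta>)
      + (\<Sum>k=1..K. \<Sum>n=1..T. bonus n * (\<Sum>t<T. P k n t) + dev_weight n * (\<Sum>t<T. Q k n t))"
  proof -
    have "(\<Sum>t<T. \<Sum>k=1..K. \<Sum>n=1..T. bonus n * P k n t + dev_weight n * Q k n t)
      = (\<Sum>k=1..K. \<Sum>n=1..T. \<Sum>t<T. bonus n * P k n t + dev_weight n * Q k n t)"
      by (rule trans[OF sum.swap], rule sum.cong[OF refl], rule sum.swap)
    also have "\<dots> = (\<Sum>k=1..K. \<Sum>n=1..T. bonus n * (\<Sum>t<T. P k n t) + dev_weight n * (\<Sum>t<T. Q k n t))"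
      by (simp only: sum.distrib sum_distrib_left)
    finally show ?thesis
      by (simp only: sum.distrib[of "\<lambda>_. \<delta> * 39 + 2 * \<delta>"]) simp
  qed
  also have "\<dots> \<le> real T * (41 * \<delta>) + (\<Sum>k=1..K. \<Sum>n=1..T. bonus n * 1 + dev_weight n * 1)"
  proof (intro add_left_mono sum_mono add_mono mult_left_mono weights)
    fix k n assume k: "k \<in> {1..K}"
    show "(\<Sum>t<T. P k n t) \<le> 1"
      unfolding P_def by (rule integrable_nth_play(2)[OF k, of 0]) (use K_pos K_le_T in linarith)
    show "(\<Sum>t<T. Q k n t) \<le> 1"
      unfolding Q_def by (rule sum_tilted_nth_play[OF k])
  qed
  also have "\<dots> = real T * (41 * \<delta>) + real K * ((\<Sum>n=1..T. bonus n) + (\<Sum>n=1..T. dev_weight n))"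
    by (simp add: sum.distrib)
  also have "\<dots> \<le> real T * (41 * \<delta>) + real K * (14 * sqrt (V * L) + 4 * sqrt (V * L))"
  proof (intro add_left_mono mult_left_mono add_mono)
    show "(\<Sum>n=1..T. bonus n) \<le> 14 * sqrt (V * L)"
      unfolding bonus_def L_def by (rule sum_exploration_le[OF V_pos K_pos])
    have "(\<Sum>n=1..T. dev_weight n) \<le> sqrt V * (4 * sqrt L)"
      unfolding dev_weight_def sum_distrib_left[symmetric]
      using V_pos by (intro mult_left_mono sum_inverse_sqrt_exp_le L_pos) auto
    then show "(\<Sum>n=1..T. dev_weight n) \<le> 4 * sqrt (V * L)" by (simp add: real_sqrt_mult)
  qed simp
  also have "\<dots> = 59 * sqrt (V * real K * real T)"
  proof -
    have KT: "real K > 0" "real T > 0" using K_pos K_le_T by auto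
    have "real T * \<delta> = sqrt (V * real K * real T)"
    proof -
      have "real T * \<delta> = sqrt ((real T)\<^sup>2 * (V / L))"
        by (simp only: \<delta>_def real_sqrt_mult[of "(real T)\<^sup>2"] real_sqrt_abs abs_of_nat)
      also have "(real T)\<^sup>2 * (V / L) = V * real K * real T"
        using KT by (simp add: L_def power2_eq_square field_simps)
      finally show ?thesis .
    qed
    moreover have "real K * sqrt (V * L) = sqrt (V * real K * real T)"
    proof -
      have "real K * sqrt (V * L) = sqrt ((real K)\<^sup>2 * (V * L))"
        by (simp only: real_sqrt_mult[of "(real K)\<^sup>2"] real_sqrt_abs abs_of_nat)
      also have "(real K)\<^sup>2 * (V * L) = V * real K * real T"
        using KT by (simp add: L_def power2_eq_square field_simps)
      finally show ?thesis .
    qed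
    ultimately show ?thesis by (simp add: algebra_simps)
  qed
  finally show ?thesis .
qed

end

theorem theorem1:
  fixes \<rho> :: "real measure" and V \<mu>minus \<mu>plus :: real
    and K T :: nat and \<theta> :: "nat \<Rightarrow> real"
    and M :: "'w measure" and F :: "nat \<Rightarrow> 'w measure"
    and A :: "nat \<Rightarrow> 'w \<Rightarrow> nat" and Y :: "nat \<Rightarrow> 'w \<Rightarrow> real"
  assumes "exponential_family \<rho>"
    and "V > 0"
    and "\<And>\<mu>. \<mu> \<in> mean_set \<rho> \<Longrightarrow> expfam_variance \<rho> (param_of_mean \<rho> \<mu>) \<le> V"
    and "\<mu>minus < \<mu>plus"
    and "{\<mu>minus..\<mu>plus} \<subseteq> mean_set \<rho>"
    and "K \<ge> 2"
    and "\<And>k. k \<in> {1..K} \<Longrightarrow> \<theta> k \<in> nat_params \<rho>"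
    and "\<And>k. k \<in> {1..K} \<Longrightarrow> expfam_mean \<rho> (\<theta> k) \<in> {\<mu>minus..\<mu>plus}"
    and "T \<ge> 1"
    and "bandit_game M F (\<lambda>k. expfam_law \<rho> (\<theta> k)) K T A Y"
    and "AE \<omega> in M. klucbpp_run \<rho> K T (\<lambda>t. A t \<omega>) (\<lambda>t. Y t \<omega>)"
  shows "expected_regret M K T (\<lambda>k. expfam_mean \<rho> (\<theta> k)) Y
    \<le> 76 * sqrt (V * real K * real T) + (\<mu>plus - \<mu>minus) * real K"
proof -
  interpret bounded_variance_family \<rho> V
    by (intro bounded_variance_family.intro bounded_variance_family_axioms.intro assms(1-3))
  interpret G: bandit_game M F "\<lambda>k. expfam_law \<rho> (\<theta> k)" K T A Y by (rule assms(10))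
  interpret G: bandit_game_laws M F "\<lambda>k. expfam_law \<rho> (\<theta> k)" K T A Y
    by (intro bandit_game_laws.intro bandit_game_laws_axioms.intro assms(10) prob_space_law' sets_law)
  let ?\<mu> = "\<lambda>k. m (\<theta> k)"
  have ne: "?\<mu> ` {1..K} \<noteq> {}" using assms(6) by auto
  have "best_mean K ?\<mu> \<in> ?\<mu> ` {1..K}" unfolding best_mean_def by (rule Max_in[OF _ ne]) simp
  then obtain k' where k': "k' \<in> {1..K}" "best_mean K ?\<mu> = ?\<mu> k'" by blast
  let ?gap = "\<lambda>t. \<integral>\<omega>. ?\<mu> k' - ?\<mu> (A (Suc t) \<omega>) \<partial>M"
  have int: "integrable M (\<lambda>\<omega>. ?\<mu> (A (Suc t) \<omega>))" if t: "t < T" for t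
  proof (rule G.integrable_const_bound)
    show "AE \<omega> in M. norm (?\<mu> (A (Suc t) \<omega>)) \<le> max \<bar>\<mu>minus\<bar> \<bar>\<mu>plus\<bar>"
    proof (rule AE_I2)
      fix \<omega> assume "\<omega> \<in> space M"
      then have "?\<mu> (A (Suc t) \<omega>) \<in> {\<mu>minus..\<mu>plus}" by (intro assms(8) G.action_in[OF t])
      then show "norm (?\<mu> (A (Suc t) \<omega>)) \<le> max \<bar>\<mu>minus\<bar> \<bar>\<mu>plus\<bar>" by auto
    qed
    have [measurable]: "A (Suc t) \<in> measurable M (count_space UNIV)"
      by (rule G.measurable_F[OF G.action_measurable_nat[of _ t]]) (use t in auto)
    show "(\<lambda>\<omega>. ?\<mu> (A (Suc t) \<omega>)) \<in> borel_measurable M" by measurable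
  qed
  have reward: "integrable M (Y (Suc t))" "(\<integral>\<omega>. Y (Suc t) \<omega> \<partial>M) = (\<integral>\<omega>. ?\<mu> (A (Suc t) \<omega>) \<partial>M)"
    if "t < T" for t
    using G.integral_reward[OF that, of ?\<mu>] has_bochner_integral_law by auto
  have "(\<integral>\<omega>. (\<Sum>t=1..T. Y t \<omega>) \<partial>M) = (\<integral>\<omega>. (\<Sum>t<T. Y (Suc t) \<omega>) \<partial>M)"
    by (simp add: sum.atLeast1_atMost_eq)
  also have "\<dots> = (\<Sum>t<T. \<integral>\<omega>. ?\<mu> (A (Suc t) \<omega>) \<partial>M)"
    using reward by (subst Bochner_Integration.integral_sum) auto
  finally have "expected_regret M K T ?\<mu> Y = (\<Sum>t<T. ?\<mu> k' - (\<integral>\<omega>. ?\<mu> (A (Suc t) \<omega>) \<partial>M))"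
    by (simp add: expected_regret_def k'(2) sum_subtractf)
  also have "\<dots> = (\<Sum>t<T. ?gap t)"
    using int by (intro sum.cong refl) (simp add: Bochner_Integration.integral_diff G.prob_space)
  \<comment> \<open>Each initial round costs at most the width of the interval of means; if
    \<open>T < K\<close>, the second sum is empty.\<close>
  also have "\<dots> = (\<Sum>t<min K T. ?gap t) + (\<Sum>t=min K T..<T. ?gap t)"
    by (subst sum.union_disjoint[symmetric]) (auto intro!: sum.cong)
  also have "\<dots> \<le> (\<mu>plus - \<mu>minus) * real K + 59 * sqrt (V * real K * real T)"
  proof (rule add_mono)
    have "?gap t \<le> \<mu>plus - \<mu>minus" if t: "t < T" for t
    proof -
      have "?gap t \<le> (\<integral>\<omega>. \<mu>plus - \<mu>minus \<partial>M)"
      proof (rule integral_mono)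
        fix \<omega> assume "\<omega> \<in> space M"
        then have "?\<mu> (A (Suc t) \<omega>) \<in> {\<mu>minus..\<mu>plus}" by (intro assms(8) G.action_in[OF t])
        then show "?\<mu> k' - ?\<mu> (A (Suc t) \<omega>) \<le> \<mu>plus - \<mu>minus" using assms(8)[OF k'(1)] by simp
      qed (use int[OF t] in auto)
      then show ?thesis by (simp add: G.prob_space)
    qed
    then have "(\<Sum>t<min K T. ?gap t) \<le> (\<Sum>t<min K T. \<mu>plus - \<mu>minus)" by (intro sum_mono) auto
    also have "\<dots> \<le> (\<mu>plus - \<mu>minus) * real K" using assms(4) by (simp add: mult.commute mult_left_mono)
    finally show "(\<Sum>t<min K T. ?gap t) \<le> (\<mu>plus - \<mu>minus) * real K" .
    show "(\<Sum>t=min K T..<T. ?gap t) \<le> 59 * sqrt (V * real K * real T)"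
    proof (cases "K \<le> T")
      case True
      interpret klucb_setting \<rho> V M F \<theta> K T A Y
        using assms(6) True
        by (intro klucb_setting.intro klucb_setting_axioms.intro bounded_variance_family_axioms
            G.bandit_game_laws_axioms) auto
      show ?thesis using sum_gap_le[OF assms(11) k'(1)] True by (simp add: min_def)
    qed (use assms(2) in simp)
  qed
  \<comment> \<open>The argument yields 59, which leaves room below the stated constant.\<close>
  also have "\<dots> \<le> 76 * sqrt (V * real K * real T) + (\<mu>plus - \<mu>minus) * real K"
    using assms(2) by simp
  finally show ?thesis .
qed

end
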